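(* Let $(M,g,J,\omega)$ be a Kähler manifold of real dimension $2m$. If $\phi$ is a hamiltonian $2$-form, then, with $\sigma=\mathrm{tr}\,\phi$, $K=J\,\mathrm{grad}_g\sigma$ and $u=\frac12\Delta\sigma$, $$\nabla\phi+\tfrac12(K\wedge\mathrm{Id}+JK\wedge J)=0,\qquad(1)$$ $$\nabla K+\tfrac1{2m}\bigl(2u\,\omega-J\{\rho,\phi\}-2R(\phi)\bigr)=0,\qquad(2)$$ $$du+\rho(K)=0.\qquad(3)$$ Thus $(\phi,K,u)$ is parallel with respect to a natural covariant derivative $\mathcal D$ on $\Lambda^{J,+}M\oplus TM\oplus(M\times\mathbb R)$, namely the one whose three components are the left hand sides of (1)–(3). The integrability condition $F^{\mathcal D}\cdot(\phi,K,u)=0$, where $F^{\mathcal D}$ is the curvature of $\mathcal D$, is equivalent to the equations $$m[R(\psi),\phi]-\bigl[R(\phi)+\tfrac12J\{\rho,\phi\},\psi^{J,+}\bigr]=0,$$ $$(m+1)R_{K,X}-\rho(K,X)\,\omega+\tfrac12J\{\rho,(K\wedge X)^{J,+}\}-\tfrac12J\{\nabla_X\rho,\phi\}-(\nabla_XR)(\phi)=0,$$ $$-m\nabla_K\rho+[R(\phi),\rho]=0,$$ for any $2$-form $\psi$ and vector field $X$.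
   Context: $\omega(X,Y)=g(JX,Y)$; $\nabla$ is the Levi-Civita connection, with curvature convention $R_{X,Y}Z=\nabla_{[X,Y]}Z-[\nabla_X,\nabla_Y]Z$. Vectors and $1$-forms, and bilinear forms and endomorphisms, are identified via $g$ (a $2$-form $\psi$ corresponds to the skew endomorphism with $\psi(X,Y)=g(\psi(X),Y)$, so $\omega$ corresponds to $J$; $\nabla K$ is the endomorphism $X\mapsto\nabla_XK$; $\rho(K)=\rho(K,\cdot)$). $R$ also denotes the induced symmetric endomorphism of $\Lambda^2M$, $R(X\wedge Y)=R_{X,Y}$. $[\cdot,\cdot]$ and $\{\cdot,\cdot\}$ are the commutator and anticommutator of endomorphisms, and products such as $J\{\rho,\phi\}$ are compositions. $(K\wedge\mathrm{Id}+JK\wedge J)(X)=K\wedge X+JK\wedge JX$. $\Lambda^{J,+}M$ is the bundle of $J$-invariant $2$-forms and $\psi^{J,+}$ is the $J$-invariant part of $\psi$. $\rho(X,Y)=\mathrm{Ric}(JX,Y)$ is the Ricci form, $J\alpha=-\alpha\circ J$ on $1$-forms, $d^cf=Jdf$, $\Delta f=-\mathrm{tr}_g\nabla df$, and $\mathrm{tr}\,\phi=\langle\phi,\omega\rangle$ with $\langle\omega,\omega\rangle=m$. A real $J$-invariant $2$-form $\phi$ is hamiltonian if there is a function $\sigma$ (which may be taken to be $\mathrm{tr}\,\phi$) with $\nabla_X\phi=\frac12(d\sigma\wedge JX-d^c\sigma\wedge X)$ for all $X$; when $m=1$ one requires in addition that $J\,\mathrm{grad}_g\sigma$ is Killing.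 *)

theory Defs
  imports "HOL-Analysis.Analysis"
begin

section \<open>Smooth functions on open subsets of Euclidean space\<close>

primrec Ck_on :: "nat \<Rightarrow> 'a::euclidean_space set \<Rightarrow> ('a \<Rightarrow> 'b::real_normed_vector) \<Rightarrow> bool" where
  "Ck_on 0 S f \<longleftrightarrow> continuous_on S f"
| "Ck_on (Suc k) S f \<longleftrightarrow>
     (\<forall>x\<in>S. f differentiable (at x)) \<and> (\<forall>v. Ck_on k S (\<lambda>x. frechet_derivative f (at x) v))"

definition smooth_on :: "'a::euclidean_space set \<Rightarrow> ('a \<Rightarrow> 'b::real_normed_vector) \<Rightarrow> bool" where
  "smooth_on S f \<longleftrightarrow> (\<forall>k. Ck_on k S f)"

section \<open>Smooth manifolds and tensor fields\<close>

text \<open>A chart is a pair of a domain and a coordinate map into \<open>real ^ 'n\<close>, so the dimension of the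
  manifold is \<open>CARD('n)\<close>.\<close>

type_synonym ('a, 'n) chart = "'a set \<times> ('a \<Rightarrow> real ^ 'n)"

definition chart_dom :: "('a, 'n) chart \<Rightarrow> 'a set" where
  "chart_dom c = fst c"

definition chart_img :: "('a, 'n) chart \<Rightarrow> (real ^ 'n) set" where
  "chart_img c = snd c ` fst c"

definition overlap :: "('a, 'n) chart \<Rightarrow> ('a, 'n) chart \<Rightarrow> (real ^ 'n) set" where
  "overlap c d = snd c ` (chart_dom c \<inter> chart_dom d)"

definition transition :: "('a, 'n) chart \<Rightarrow> ('a, 'n) chart \<Rightarrow> real ^ 'n \<Rightarrow> real ^ 'n" where
  "transition c d = snd d \<circ> inv_into (chart_dom c) (snd c)"

definition jac :: "('a, 'n) chart \<Rightarrow> ('a, 'n) chart \<Rightarrow> real ^ 'n \<Rightarrow> real ^ 'n ^ 'n::finite" where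
  "jac c d x = matrix (frechet_derivative (transition c d) (at x))"

definition smooth_manifold :: "'a topology \<Rightarrow> ('a, 'n::finite) chart set \<Rightarrow> bool" where
  "smooth_manifold M A \<longleftrightarrow>
     Hausdorff_space M \<and> second_countable M \<and>
     (\<Union>c\<in>A. chart_dom c) = topspace M \<and>
     (\<forall>c\<in>A. openin M (chart_dom c) \<and> open (chart_img c) \<and>
        homeomorphic_map (subtopology M (chart_dom c)) (top_of_set (chart_img c)) (snd c)) \<and>
     (\<forall>c\<in>A. \<forall>d\<in>A. smooth_on (overlap c d) (transition c d))"

text \<open>Tensor fields are given by their components in every chart of the atlas, as functions of the
  coordinates, subject to the transformation law on overlaps. Components outside the image of the
  chart are junk, so fields are only ever compared on \<open>chart_img c\<close>.\<close>

type_synonym ('a, 'n, 'b) field = "('a, 'n) chart \<Rightarrow> real ^ 'n \<Rightarrow> 'b"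

definition smooth_field :: "('a, 'n::finite) chart set \<Rightarrow> ('a, 'n, 'b::real_normed_vector) field \<Rightarrow> bool" where
  "smooth_field A T \<longleftrightarrow> (\<forall>c\<in>A. smooth_on (chart_img c) (T c))"

definition scalar_field :: "('a, 'n::finite) chart set \<Rightarrow> ('a, 'n, real) field \<Rightarrow> bool" where
  "scalar_field A f \<longleftrightarrow> smooth_field A f \<and>
     (\<forall>c\<in>A. \<forall>d\<in>A. \<forall>x\<in>overlap c d. f d (transition c d x) = f c x)"

definition vector_field :: "('a, 'n::finite) chart set \<Rightarrow> ('a, 'n, real ^ 'n) field \<Rightarrow> bool" where
  "vector_field A X \<longleftrightarrow> smooth_field A X \<and>
     (\<forall>c\<in>A. \<forall>d\<in>A. \<forall>x\<in>overlap c d. X d (transition c d x) = jac c d x *v X c x)"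

definition endo_field :: "('a, 'n::finite) chart set \<Rightarrow> ('a, 'n, real ^ 'n ^ 'n) field \<Rightarrow> bool" where
  "endo_field A T \<longleftrightarrow> smooth_field A T \<and>
     (\<forall>c\<in>A. \<forall>d\<in>A. \<forall>x\<in>overlap c d. T d (transition c d x) ** jac c d x = jac c d x ** T c x)"

definition bilinear_field :: "('a, 'n::finite) chart set \<Rightarrow> ('a, 'n, real ^ 'n ^ 'n) field \<Rightarrow> bool" where
  "bilinear_field A b \<longleftrightarrow> smooth_field A b \<and>
     (\<forall>c\<in>A. \<forall>d\<in>A. \<forall>x\<in>overlap c d.
        transpose (jac c d x) ** b d (transition c d x) ** jac c d x = b c x)"

section \<open>Linear algebra at a point\<close>

text \<open>\<open>G\<close> is the Gram matrix of the metric. Two-forms are identified with skew endomorphisms by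
  \<open>\<psi>(X,Y) = g(\<psi> X, Y)\<close>. One-forms are covectors, i.e. \<open>\<alpha>(X) = \<alpha> \<bullet> X\<close>.\<close>

definition ip :: "real ^ 'n ^ 'n \<Rightarrow> real ^ 'n \<Rightarrow> real ^ 'n \<Rightarrow> real" where
  "ip G X Y = X \<bullet> (G *v Y)"

definition sharp :: "real ^ 'n ^ 'n \<Rightarrow> real ^ 'n \<Rightarrow> real ^ 'n::finite" where
  "sharp G \<alpha> = matrix_inv G *v \<alpha>"

definition endo_of_form :: "real ^ 'n ^ 'n \<Rightarrow> (real ^ 'n \<Rightarrow> real ^ 'n \<Rightarrow> real) \<Rightarrow> real ^ 'n ^ 'n::finite" where
  "endo_of_form G \<beta> = matrix_inv G ** (\<chi> i j. \<beta> (axis j 1) (axis i 1))"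

definition skew_endo :: "real ^ 'n ^ 'n \<Rightarrow> real ^ 'n ^ 'n \<Rightarrow> bool" where
  "skew_endo G \<psi> \<longleftrightarrow> (\<forall>X Y. ip G (\<psi> *v X) Y = - ip G (\<psi> *v Y) X)"

text \<open>The endomorphism of the two-form \<open>(Z,W) \<mapsto> g(X,Z) g(Y,W) - g(X,W) g(Y,Z)\<close>.\<close>
definition wedge :: "real ^ 'n ^ 'n \<Rightarrow> real ^ 'n \<Rightarrow> real ^ 'n \<Rightarrow> real ^ 'n ^ 'n::finite" where
  "wedge G X Y = matrix (\<lambda>Z. ip G X Z *\<^sub>R Y - ip G Y Z *\<^sub>R X)"

definition comm :: "real ^ 'n ^ 'n \<Rightarrow> real ^ 'n ^ 'n \<Rightarrow> real ^ 'n ^ 'n" where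
  "comm S T = S ** T - T ** S"

definition acomm :: "real ^ 'n ^ 'n \<Rightarrow> real ^ 'n ^ 'n \<Rightarrow> real ^ 'n ^ 'n" where
  "acomm S T = S ** T + T ** S"

text \<open>The inner product of two-forms: half the Hilbert--Schmidt product of the corresponding skew
  endomorphisms. Thus \<open>\<langle>J,J\<rangle> = m\<close> in real dimension \<open>2m\<close>.\<close>
definition form_inner :: "real ^ 'n ^ 'n \<Rightarrow> real ^ 'n ^ 'n \<Rightarrow> real" where
  "form_inner \<phi> \<psi> = - trace (\<phi> ** \<psi>) / 2"

definition form_tr :: "real ^ 'n ^ 'n \<Rightarrow> real ^ 'n ^ 'n \<Rightarrow> real" where
  "form_tr J \<phi> = form_inner \<phi> J"

definition J_invariant :: "real ^ 'n ^ 'n \<Rightarrow> real ^ 'n ^ 'n \<Rightarrow> real ^ 'n ^ 'n \<Rightarrow> bool" where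
  "J_invariant G J \<psi> \<longleftrightarrow> (\<forall>X Y. ip G (\<psi> *v (J *v X)) (J *v Y) = ip G (\<psi> *v X) Y)"

text \<open>The endomorphism of \<open>(X,Y) \<mapsto> (\<psi>(X,Y) + \<psi>(JX,JY)) / 2\<close>.\<close>
definition J_inv_part :: "real ^ 'n ^ 'n \<Rightarrow> real ^ 'n ^ 'n \<Rightarrow> real ^ 'n ^ 'n \<Rightarrow> real ^ 'n ^ 'n::finite" where
  "J_inv_part G J \<psi> =
     endo_of_form G (\<lambda>X Y. (ip G (\<psi> *v X) Y + ip G (\<psi> *v (J *v X)) (J *v Y)) / 2)"

text \<open>\<open>J\<alpha> = - \<alpha> \<circ> J\<close> on one-forms.\<close>
definition J_form :: "real ^ 'n ^ 'n \<Rightarrow> real ^ 'n \<Rightarrow> real ^ 'n" where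
  "J_form J \<alpha> = - (\<alpha> v* J)"

section \<open>Riemannian geometry in coordinates\<close>

text \<open>From here on \<open>g\<close>, \<open>J\<close> and all other fields are component functions in one chart. A tangent
  vector at a point is entered in an operator as the field with these constant components; this is
  harmless, as these operators are tensorial in the arguments concerned.\<close>

definition dir_deriv :: "(real ^ 'n \<Rightarrow> real ^ 'n) \<Rightarrow> (real ^ 'n \<Rightarrow> 'b::real_normed_vector) \<Rightarrow> real ^ 'n::finite \<Rightarrow> 'b" where
  "dir_deriv X f x = frechet_derivative f (at x) (X x)"

definition lie_bracket :: "(real ^ 'n \<Rightarrow> real ^ 'n) \<Rightarrow> (real ^ 'n \<Rightarrow> real ^ 'n) \<Rightarrow> real ^ 'n \<Rightarrow> real ^ 'n::finite" where
  "lie_bracket X Y x = dir_deriv X Y x - dir_deriv Y X x"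

definition partial :: "'n \<Rightarrow> (real ^ 'n \<Rightarrow> real) \<Rightarrow> real ^ 'n::finite \<Rightarrow> real" where
  "partial i f = dir_deriv (\<lambda>_. axis i 1) f"

text \<open>\<open>christoffel g x k i j\<close> is \<open>\<Gamma>\<close> with upper index \<open>k\<close> and lower indices \<open>i\<close>, \<open>j\<close>.\<close>
definition christoffel :: "(real ^ 'n \<Rightarrow> real ^ 'n ^ 'n) \<Rightarrow> real ^ 'n \<Rightarrow> 'n::finite \<Rightarrow> 'n \<Rightarrow> 'n \<Rightarrow> real" where
  "christoffel g x k i j =
     (\<Sum>l\<in>UNIV. matrix_inv (g x) $ k $ l *
        (partial i (\<lambda>y. g y $ j $ l) x + partial j (\<lambda>y. g y $ i $ l) x
         - partial l (\<lambda>y. g y $ i $ j) x)) / 2"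

text \<open>The connection matrix in direction \<open>v\<close>.\<close>
definition conn_mat :: "(real ^ 'n \<Rightarrow> real ^ 'n ^ 'n) \<Rightarrow> real ^ 'n \<Rightarrow> real ^ 'n \<Rightarrow> real ^ 'n ^ 'n::finite" where
  "conn_mat g x v = (\<chi> k j. \<Sum>i\<in>UNIV. v $ i * christoffel g x k i j)"

definition nabla_vec :: "(real ^ 'n \<Rightarrow> real ^ 'n ^ 'n) \<Rightarrow> (real ^ 'n \<Rightarrow> real ^ 'n) \<Rightarrow> (real ^ 'n \<Rightarrow> real ^ 'n)
    \<Rightarrow> real ^ 'n \<Rightarrow> real ^ 'n::finite" where
  "nabla_vec g X Y x = dir_deriv X Y x + conn_mat g x (X x) *v Y x"

definition nabla_form :: "(real ^ 'n \<Rightarrow> real ^ 'n ^ 'n) \<Rightarrow> (real ^ 'n \<Rightarrow> real ^ 'n) \<Rightarrow> (real ^ 'n \<Rightarrow> real ^ 'n)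
    \<Rightarrow> real ^ 'n \<Rightarrow> real ^ 'n::finite" where
  "nabla_form g X \<alpha> x = dir_deriv X \<alpha> x - \<alpha> x v* conn_mat g x (X x)"

definition nabla_endo :: "(real ^ 'n \<Rightarrow> real ^ 'n ^ 'n) \<Rightarrow> (real ^ 'n \<Rightarrow> real ^ 'n) \<Rightarrow> (real ^ 'n \<Rightarrow> real ^ 'n ^ 'n)
    \<Rightarrow> real ^ 'n \<Rightarrow> real ^ 'n ^ 'n::finite" where
  "nabla_endo g X T x = dir_deriv X T x + comm (conn_mat g x (X x)) (T x)"

text \<open>The endomorphism \<open>X \<mapsto> \<nabla>\<^sub>X K\<close>.\<close>
definition cov_diff :: "(real ^ 'n \<Rightarrow> real ^ 'n ^ 'n) \<Rightarrow> (real ^ 'n \<Rightarrow> real ^ 'n) \<Rightarrow> real ^ 'n \<Rightarrow> real ^ 'n ^ 'n::finite" where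
  "cov_diff g K x = matrix (\<lambda>v. nabla_vec g (\<lambda>_. v) K x)"

text \<open>Curvature of any covariant derivative \<open>D\<close>, with the sign convention
  \<open>D\<^sub>[\<^sub>X\<^sub>,\<^sub>Y\<^sub>] - [D\<^sub>X, D\<^sub>Y]\<close>, under which the curvature operator below is the identity
  on the unit sphere.\<close>
definition curv_op :: "((real ^ 'n \<Rightarrow> real ^ 'n) \<Rightarrow> (real ^ 'n \<Rightarrow> 'b) \<Rightarrow> real ^ 'n \<Rightarrow> 'b)
    \<Rightarrow> (real ^ 'n \<Rightarrow> real ^ 'n) \<Rightarrow> (real ^ 'n \<Rightarrow> real ^ 'n) \<Rightarrow> (real ^ 'n \<Rightarrow> 'b)
    \<Rightarrow> real ^ 'n::finite \<Rightarrow> 'b::real_normed_vector" where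
  "curv_op D X Y s x = D (lie_bracket X Y) s x - (D X (D Y s) x - D Y (D X s) x)"

definition riem :: "(real ^ 'n \<Rightarrow> real ^ 'n ^ 'n) \<Rightarrow> real ^ 'n \<Rightarrow> real ^ 'n \<Rightarrow> real ^ 'n \<Rightarrow> real ^ 'n ^ 'n::finite" where
  "riem g x X Y = matrix (\<lambda>Z. curv_op (nabla_vec g) (\<lambda>_. X) (\<lambda>_. Y) (\<lambda>_. Z) x)"

text \<open>The linear map with \<open>X \<and> Y \<mapsto> R\<^sub>X\<^sub>,\<^sub>Y\<close>. Raising an index, the endomorphism
  \<open>X \<and> Y\<close> becomes the matrix with entries \<open>Y\<^sub>i X\<^sub>j - X\<^sub>i Y\<^sub>j\<close>, whence the order of
  \<open>j\<close> and \<open>i\<close> in the curvature term.\<close>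
definition riem_form :: "(real ^ 'n \<Rightarrow> real ^ 'n ^ 'n) \<Rightarrow> real ^ 'n \<Rightarrow> real ^ 'n ^ 'n \<Rightarrow> real ^ 'n ^ 'n::finite" where
  "riem_form g x \<psi> =
     (1/2) *\<^sub>R (\<Sum>i\<in>UNIV. \<Sum>j\<in>UNIV.
        ((\<psi> ** matrix_inv (g x)) $ i $ j) *\<^sub>R riem g x (axis j 1) (axis i 1))"

text \<open>\<open>(\<nabla>\<^sub>X R)(\<phi>)\<close> for a field \<open>\<phi>\<close> of two-forms.\<close>
definition nabla_riem_form :: "(real ^ 'n \<Rightarrow> real ^ 'n ^ 'n) \<Rightarrow> (real ^ 'n \<Rightarrow> real ^ 'n) \<Rightarrow> (real ^ 'n \<Rightarrow> real ^ 'n ^ 'n)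
    \<Rightarrow> real ^ 'n \<Rightarrow> real ^ 'n ^ 'n::finite" where
  "nabla_riem_form g X \<phi> x =
     nabla_endo g X (\<lambda>y. riem_form g y (\<phi> y)) x - riem_form g x (nabla_endo g X \<phi> x)"

text \<open>Normalised so that the unit sphere has positive Ricci curvature.\<close>
definition ric :: "(real ^ 'n \<Rightarrow> real ^ 'n ^ 'n) \<Rightarrow> real ^ 'n \<Rightarrow> real ^ 'n \<Rightarrow> real ^ 'n \<Rightarrow> real" where
  "ric g x X Y = trace (matrix (\<lambda>Z. riem g x X Z *v Y) :: real ^ 'n ^ 'n::finite)"

definition ricci_form :: "(real ^ 'n \<Rightarrow> real ^ 'n ^ 'n) \<Rightarrow> (real ^ 'n \<Rightarrow> real ^ 'n ^ 'n) \<Rightarrow> real ^ 'n \<Rightarrow> real ^ 'n ^ 'n::finite" where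
  "ricci_form g J x = endo_of_form (g x) (\<lambda>X Y. ric g x (J x *v X) Y)"

definition diff :: "(real ^ 'n \<Rightarrow> real) \<Rightarrow> real ^ 'n \<Rightarrow> real ^ 'n::finite" where
  "diff f x = (\<chi> i. partial i f x)"

definition grad :: "(real ^ 'n \<Rightarrow> real ^ 'n ^ 'n) \<Rightarrow> (real ^ 'n \<Rightarrow> real) \<Rightarrow> real ^ 'n \<Rightarrow> real ^ 'n::finite" where
  "grad g f x = sharp (g x) (diff f x)"

definition dc :: "(real ^ 'n \<Rightarrow> real ^ 'n ^ 'n) \<Rightarrow> (real ^ 'n \<Rightarrow> real) \<Rightarrow> real ^ 'n \<Rightarrow> real ^ 'n::finite" where
  "dc J f x = J_form (J x) (diff f x)"

definition hessian :: "(real ^ 'n \<Rightarrow> real ^ 'n ^ 'n) \<Rightarrow> (real ^ 'n \<Rightarrow> real) \<Rightarrow> real ^ 'n \<Rightarrow> real ^ 'n ^ 'n::finite" where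
  "hessian g f x = (\<chi> i j. nabla_form g (\<lambda>_. axis i 1) (diff f) x $ j)"

text \<open>The Laplacian is the positive one, \<open>- tr\<^sub>g \<nabla>df\<close>.\<close>
definition laplacian :: "(real ^ 'n \<Rightarrow> real ^ 'n ^ 'n) \<Rightarrow> (real ^ 'n \<Rightarrow> real) \<Rightarrow> real ^ 'n::finite \<Rightarrow> real" where
  "laplacian g f x = - trace (matrix_inv (g x) ** hessian g f x)"

definition lie_metric :: "(real ^ 'n \<Rightarrow> real ^ 'n ^ 'n) \<Rightarrow> (real ^ 'n \<Rightarrow> real ^ 'n) \<Rightarrow> real ^ 'n \<Rightarrow> real ^ 'n
    \<Rightarrow> real ^ 'n::finite \<Rightarrow> real" where
  "lie_metric g K X Y x =
     dir_deriv K (\<lambda>y. ip (g y) X Y) x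
     - ip (g x) (lie_bracket K (\<lambda>_. X) x) Y - ip (g x) X (lie_bracket K (\<lambda>_. Y) x)"

section \<open>Kaehler manifolds and hamiltonian two-forms\<close>

definition riemannian_metric :: "('a, 'n::finite) chart set \<Rightarrow> ('a, 'n, real ^ 'n ^ 'n) field \<Rightarrow> bool" where
  "riemannian_metric A g \<longleftrightarrow> bilinear_field A g \<and>
     (\<forall>c\<in>A. \<forall>x\<in>chart_img c.
        (\<forall>X Y. ip (g c x) X Y = ip (g c x) Y X) \<and> (\<forall>X. X \<noteq> 0 \<longrightarrow> ip (g c x) X X > 0))"

text \<open>The Kaehler form \<open>\<omega>(X,Y) = g(JX,Y)\<close> is determined by \<open>g\<close> and \<open>J\<close>; as an endomorphism it
  is \<open>J\<close> itself.\<close>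
definition kaehler_manifold :: "'a topology \<Rightarrow> ('a, 'n::finite) chart set
    \<Rightarrow> ('a, 'n, real ^ 'n ^ 'n) field \<Rightarrow> ('a, 'n, real ^ 'n ^ 'n) field \<Rightarrow> bool" where
  "kaehler_manifold M A g J \<longleftrightarrow>
     smooth_manifold M A \<and> riemannian_metric A g \<and> endo_field A J \<and>
     (\<forall>c\<in>A. \<forall>x\<in>chart_img c.
        J c x ** J c x = - mat 1 \<and>
        (\<forall>X Y. ip (g c x) (J c x *v X) (J c x *v Y) = ip (g c x) X Y) \<and>
        (\<forall>X. nabla_endo (g c) (\<lambda>_. X) (J c) x = 0))"

definition J_inv_two_form :: "('a, 'n::finite) chart set \<Rightarrow> ('a, 'n, real ^ 'n ^ 'n) field
    \<Rightarrow> ('a, 'n, real ^ 'n ^ 'n) field \<Rightarrow> ('a, 'n, real ^ 'n ^ 'n) field \<Rightarrow> bool" where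
  "J_inv_two_form A g J \<phi> \<longleftrightarrow> endo_field A \<phi> \<and>
     (\<forall>c\<in>A. \<forall>x\<in>chart_img c. skew_endo (g c x) (\<phi> c x) \<and> J_invariant (g c x) (J c x) (\<phi> c x))"

definition killing :: "('a, 'n::finite) chart set \<Rightarrow> ('a, 'n, real ^ 'n ^ 'n) field
    \<Rightarrow> ('a, 'n, real ^ 'n) field \<Rightarrow> bool" where
  "killing A g K \<longleftrightarrow> (\<forall>c\<in>A. \<forall>x\<in>chart_img c. \<forall>X Y. lie_metric (g c) (K c) X Y x = 0)"

definition hamiltonian :: "('a, 'n::finite) chart set \<Rightarrow> ('a, 'n, real ^ 'n ^ 'n) field
    \<Rightarrow> ('a, 'n, real ^ 'n ^ 'n) field \<Rightarrow> ('a, 'n, real ^ 'n ^ 'n) field \<Rightarrow> bool" where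
  "hamiltonian A g J \<phi> \<longleftrightarrow> J_inv_two_form A g J \<phi> \<and>
     (\<exists>\<sigma>. scalar_field A \<sigma> \<and>
        (\<forall>c\<in>A. \<forall>x\<in>chart_img c. \<forall>X.
           nabla_endo (g c) (\<lambda>_. X) (\<phi> c) x =
           (1/2) *\<^sub>R (wedge (g c x) (sharp (g c x) (diff (\<sigma> c) x)) (J c x *v X)
                    - wedge (g c x) (sharp (g c x) (dc (J c) (\<sigma> c) x)) X)) \<and>
        (CARD('n) = 2 \<longrightarrow> killing A g (\<lambda>c x. J c x *v grad (g c) (\<sigma> c) x)))"

section \<open>The covariant derivative on triples\<close>

text \<open>The components of the following operator on triples \<open>(\<phi>, K, u)\<close> in real dimension \<open>2m\<close>:
    \<open>\<nabla>\<^sub>X \<phi> + (K \<and> X + JK \<and> JX) / 2\<close>,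
    \<open>\<nabla>\<^sub>X K + (2u \<omega> - J{\<rho>,\<phi>} - 2R(\<phi>))(X) / 2m\<close>,
    \<open>du(X) + \<rho>(K,X)\<close>.\<close>

type_synonym 'n triple = "(real ^ 'n ^ 'n) \<times> (real ^ 'n) \<times> real"

definition ham_D :: "nat \<Rightarrow> (real ^ 'n \<Rightarrow> real ^ 'n ^ 'n) \<Rightarrow> (real ^ 'n \<Rightarrow> real ^ 'n ^ 'n)
    \<Rightarrow> (real ^ 'n \<Rightarrow> real ^ 'n) \<Rightarrow> (real ^ 'n \<Rightarrow> 'n triple) \<Rightarrow> real ^ 'n \<Rightarrow> 'n::finite triple" where
  "ham_D m g J X s x =
     (let \<phi> = (\<lambda>y. fst (s y)); K = (\<lambda>y. fst (snd (s y))); u = (\<lambda>y. snd (snd (s y)));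
          \<rho> = ricci_form g J x
      in (nabla_endo g X \<phi> x
            + (1/2) *\<^sub>R (wedge (g x) (K x) (X x) + wedge (g x) (J x *v K x) (J x *v X x)),
          nabla_vec g X K x
            + (1 / (2 * real m)) *\<^sub>R
                (((2 * u x) *\<^sub>R J x - J x ** acomm \<rho> (\<phi> x) - 2 *\<^sub>R riem_form g x (\<phi> x)) *v X x),
          dir_deriv X u x + ip (g x) (\<rho> *v K x) (X x)))"

text \<open>Smooth sections of the bundle of triples (\<open>J\<close>-invariant two-form, tangent vector, scalar).\<close>
definition triple_sections :: "('a, 'n::finite) chart set \<Rightarrow> ('a, 'n, real ^ 'n ^ 'n) field
    \<Rightarrow> ('a, 'n, real ^ 'n ^ 'n) field \<Rightarrow> ('a, 'n, 'n triple) field set" where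
  "triple_sections A g J =
     {s. J_inv_two_form A g J (\<lambda>c x. fst (s c x)) \<and>
         vector_field A (\<lambda>c x. fst (snd (s c x))) \<and>
         scalar_field A (\<lambda>c x. snd (snd (s c x)))}"

text \<open>\<open>D\<close>, given in each chart, is a well-defined covariant derivative on the vector bundle whose
  smooth sections are \<open>Sec\<close>.\<close>
definition covariant_derivative :: "('a, 'n::finite) chart set
    \<Rightarrow> ('a, 'n, 'b::real_normed_vector) field set
    \<Rightarrow> (('a, 'n) chart \<Rightarrow> (real ^ 'n \<Rightarrow> real ^ 'n) \<Rightarrow> (real ^ 'n \<Rightarrow> 'b) \<Rightarrow> real ^ 'n \<Rightarrow> 'b) \<Rightarrow> bool" where
  "covariant_derivative A Sec D \<longleftrightarrow>
     (\<forall>X s. vector_field A X \<longrightarrow> s \<in> Sec \<longrightarrow> (\<lambda>c. D c (X c) (s c)) \<in> Sec) \<and>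
     (\<forall>X Y s t f. vector_field A X \<longrightarrow> vector_field A Y \<longrightarrow> s \<in> Sec \<longrightarrow> t \<in> Sec \<longrightarrow> scalar_field A f \<longrightarrow>
        (\<forall>c\<in>A. \<forall>x\<in>chart_img c.
           D c (\<lambda>y. X c y + Y c y) (s c) x = D c (X c) (s c) x + D c (Y c) (s c) x \<and>
           D c (\<lambda>y. f c y *\<^sub>R X c y) (s c) x = f c x *\<^sub>R D c (X c) (s c) x \<and>
           D c (X c) (\<lambda>y. s c y + t c y) x = D c (X c) (s c) x + D c (X c) (t c) x \<and>
           D c (X c) (\<lambda>y. f c y *\<^sub>R s c y) x =
             dir_deriv (X c) (f c) x *\<^sub>R s c x + f c x *\<^sub>R D c (X c) (s c) x))"

end

theory Submission
  imports Defs
begin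

text \<open>All of the statement is local except that the operator preserves sections and that \<open>(\<phi>, K, u)\<close>
  is one; these two points are naturality under a change of charts, which rests on the
  characterization of the connection as the only torsion free metric one
  (\<open>connection_change\<close>, \<open>curvature_change\<close>).

  In a chart, write \<open>A(X,Y) = X \<and> Y + JX \<and> JY\<close>. The definition of a hamiltonian form, with its
  potential replaced by the trace of \<open>\<phi>\<close>, says that \<open>\<nabla>\<^sub>X\<phi> = - A(K,X) / 2\<close>. Differentiating
  once more and skew-symmetrizing gives \<open>[R\<^sub>X\<^sub>,\<^sub>Y, \<phi>] = (A(SX,Y) - A(SY,X)) / 2\<close> with
  \<open>S = \<nabla>K\<close> (\<open>integrability\<close>). A trace over \<open>Y\<close> turns the left hand side into
  \<open>R(\<phi>) + \<phi>\<rho>J\<close> by the Bianchi identity, and the right hand side into a combination of \<open>S\<close>,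
  \<open>JSJ\<close> and \<open>J\<close> (\<open>contracted_integrability\<close>). Since the left hand side commutes with \<open>J\<close>,
  this forces \<open>S\<close> to commute with \<open>J\<close> if \<open>m > 1\<close>; for \<open>m = 1\<close> this is the Killing equation.
  As \<open>S\<close> is \<open>J\<close> composed with a Hessian, it is then skew, so \<open>K\<close> is a Killing field. Now the
  trace can be solved for \<open>S\<close>, which is the second equation, and \<open>\<phi>\<close> is seen to commute with
  \<open>\<rho>\<close> (\<open>integrability_solved\<close>). Finally \<open>\<nabla>\<^sub>XS = R\<^sub>K\<^sub>,\<^sub>X\<close> for a Killing field, and the
  trace of this against \<open>J\<close> is the third equation, because \<open>R(\<omega>) = \<rho>\<close> (\<open>scalar_equation\<close>).

  For the curvature of the covariant derivative on an arbitrary triple one computes the three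
  components. The first is, up to a factor, the first condition with \<open>\<psi> = X \<and> Y\<close>, and such
  \<open>\<psi>\<close> span. The second is \<open>I2(Y)X - I2(X)Y\<close> up to a factor, where \<open>I2(X)\<close> is the left hand
  side of the second condition; as \<open>I2(X)\<close> is skew, it vanishes as soon as \<open>I2(X)Y\<close> is symmetric
  in \<open>X\<close> and \<open>Y\<close> (\<open>symmetric_skew_zero\<close>). The third is the third condition up to a factor
  and the term \<open>[J{\<rho>,\<phi>}, \<rho>]\<close>. That term vanishes as soon as the first condition holds, since
  for \<open>\<psi> = \<omega>\<close> this condition says that \<open>\<rho>\<close> and \<open>\<phi>\<close> commute.\<close>

section \<open>Smooth maps on open sets\<close>

lemma Ck_on_cong:
  assumes "open S" "\<And>x. x \<in> S \<Longrightarrow> f x = h x" "Ck_on k S f"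
  shows "Ck_on k S h"
  using assms(2,3)
proof (induction k arbitrary: f h)
  case 0
  then show ?case by (simp cong: continuous_on_cong)
next
  case (Suc k)
  have ev: "\<And>x. x \<in> S \<Longrightarrow> frechet_derivative f (at x) = frechet_derivative h (at x)"
    using Suc.prems assms(1) by (intro frechet_derivative_transform_within_open[of _ _ S]) auto
  have d: "h differentiable (at x)" if "x \<in> S" for x
  proof -
    have "(f has_derivative frechet_derivative f (at x)) (at x)"
      using Suc.prems that frechet_derivative_works by auto
    then have "(h has_derivative frechet_derivative f (at x)) (at x)"
      using has_derivative_transform_within_open[of f _ x UNIV S h] assms(1) Suc.prems(1) that by auto
    then show ?thesis by (rule differentiableI)
  qed
  have "Ck_on k S (\<lambda>x. frechet_derivative h (at x) v)" for v
    using Suc.IH[of "\<lambda>x. frechet_derivative f (at x) v" "\<lambda>x. frechet_derivative h (at x) v"] Suc.prems(2) ev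
    by auto
  with d show ?case by simp
qed

lemma Ck_on_Suc_imp: "Ck_on (Suc k) S f \<Longrightarrow> Ck_on k S f"
proof (induction k arbitrary: f)
  case 0
  then show ?case
    by (auto intro!: continuous_at_imp_continuous_on differentiable_imp_continuous_within)
next
  case (Suc k)
  then show ?case by (metis Ck_on.simps(2))
qed

lemma Ck_on_const: "Ck_on k S (\<lambda>x. c)"
  by (induction k arbitrary: c) auto

lemma frechet_derivative_apply:
  "(f has_derivative F) (at x) \<Longrightarrow> frechet_derivative f (at x) v = F v"
  using frechet_derivative_at by metis

lemma Ck_on_differentiable:
  "Ck_on (Suc k) S f \<Longrightarrow> x \<in> S \<Longrightarrow> (f has_derivative frechet_derivative f (at x)) (at x)"
  using frechet_derivative_works by auto

text \<open>Closure properties are proved by induction on the order of differentiability, with the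
  derivative given by a formula that is valid on the open set only.\<close>
lemma Ck_on_SucI:
  assumes "open S" "\<And>x. x \<in> S \<Longrightarrow> (f has_derivative F x) (at x)" "\<And>v. Ck_on k S (\<lambda>x. F x v)"
  shows "Ck_on (Suc k) S f"
proof -
  have "Ck_on k S (\<lambda>x. frechet_derivative f (at x) v)" for v
    by (rule Ck_on_cong[OF assms(1) _ assms(3)[of v]]) (simp add: frechet_derivative_apply[OF assms(2)])
  then show ?thesis using assms(2) by (auto intro: differentiableI)
qed

lemma Ck_on_bounded_linear:
  assumes "open S" "bounded_linear L" "Ck_on k S f"
  shows "Ck_on k S (\<lambda>x. L (f x))"
  using assms(3)
proof (induction k arbitrary: f)
  case 0
  then show ?case using assms(2) by (simp add: bounded_linear.continuous_on)
next
  case (Suc k)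
  show ?case
    using Suc by (intro Ck_on_SucI[OF assms(1) bounded_linear.has_derivative[OF assms(2) Ck_on_differentiable[OF Suc.prems]]]) auto
qed

lemma Ck_on_add:
  assumes "open S" "Ck_on k S f" "Ck_on k S h"
  shows "Ck_on k S (\<lambda>x. f x + h x)"
  using assms(2,3)
proof (induction k arbitrary: f h)
  case 0
  then show ?case by (simp add: continuous_on_add)
next
  case (Suc k)
  show ?case
    using Suc by (intro Ck_on_SucI[OF assms(1) has_derivative_add[OF Ck_on_differentiable[OF Suc.prems(1)]
          Ck_on_differentiable[OF Suc.prems(2)]]]) auto
qed

lemma Ck_on_bilinear:
  assumes "open S" "bounded_bilinear B" "Ck_on k S f" "Ck_on k S h"
  shows "Ck_on k S (\<lambda>x. B (f x) (h x))"
  using assms(3,4)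
proof (induction k arbitrary: f h)
  case 0
  then show ?case using assms(2) by (simp add: bounded_bilinear.continuous_on)
next
  case (Suc k)
  show ?case
    by (rule Ck_on_SucI[OF assms(1) bounded_bilinear.FDERIV[OF assms(2) Ck_on_differentiable[OF Suc.prems(1)]
          Ck_on_differentiable[OF Suc.prems(2)]]], assumption+)
      (use Suc.prems in \<open>auto intro!: Ck_on_add assms(1) Suc.IH intro: Ck_on_Suc_imp\<close>)
qed

lemma Ck_on_inverse:
  fixes f :: "'a::euclidean_space \<Rightarrow> real"
  assumes "open S" "\<And>x. x \<in> S \<Longrightarrow> f x \<noteq> 0" "Ck_on k S f"
  shows "Ck_on k S (\<lambda>x. inverse (f x))"
  using assms(3)
proof (induction k)
  case 0
  then show ?case using assms(2) by (auto intro: continuous_on_inverse)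
next
  case (Suc k)
  have I: "Ck_on k S (\<lambda>x. inverse (f x))" using Suc Ck_on_Suc_imp by blast
  show ?case
    by (rule Ck_on_SucI[OF assms(1) Deriv.has_derivative_inverse[OF assms(2) Ck_on_differentiable[OF Suc.prems]]],
        assumption+)
      (use Suc.prems I in \<open>auto intro!: Ck_on_bounded_linear[OF assms(1) bounded_linear_minus[OF bounded_linear_ident]]
        Ck_on_bilinear[OF assms(1) bounded_bilinear_mult]\<close>)
qed

lemma smooth_on_cong:
  assumes "open S" "smooth_on S f" "\<And>x. x \<in> S \<Longrightarrow> f x = h x"
  shows "smooth_on S h"
  using assms Ck_on_cong unfolding smooth_on_def by blast

lemma smooth_on_const [simp, intro]: "smooth_on S (\<lambda>x. c)"
  by (simp add: smooth_on_def Ck_on_const)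

lemma smooth_on_linear: "open S \<Longrightarrow> linear L \<Longrightarrow> smooth_on S f \<Longrightarrow> smooth_on S (\<lambda>x. L (f x))"
  for L :: "'b::euclidean_space \<Rightarrow> 'c::real_normed_vector"
  by (simp add: smooth_on_def Ck_on_bounded_linear linear_conv_bounded_linear)

lemma smooth_on_bilinear:
  "open S \<Longrightarrow> bounded_bilinear B \<Longrightarrow> smooth_on S f \<Longrightarrow> smooth_on S h \<Longrightarrow> smooth_on S (\<lambda>x. B (f x) (h x))"
  by (simp add: smooth_on_def Ck_on_bilinear)

lemma smooth_on_add [simp, intro]:
  "open S \<Longrightarrow> smooth_on S f \<Longrightarrow> smooth_on S h \<Longrightarrow> smooth_on S (\<lambda>x. f x + h x)"
  by (simp add: smooth_on_def Ck_on_add)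

lemma smooth_on_scaleR [simp, intro]:
  "open S \<Longrightarrow> smooth_on S f \<Longrightarrow> smooth_on S h \<Longrightarrow> smooth_on S (\<lambda>x. f x *\<^sub>R h x)"
  by (rule smooth_on_bilinear[OF _ bounded_bilinear_scaleR])

lemma smooth_on_mult [simp, intro]:
  "open S \<Longrightarrow> smooth_on S f \<Longrightarrow> smooth_on S h \<Longrightarrow> smooth_on S (\<lambda>x. f x * (h x::real))"
  by (rule smooth_on_bilinear[OF _ bounded_bilinear_mult])

lemma smooth_on_inner [simp, intro]:
  "open S \<Longrightarrow> smooth_on S f \<Longrightarrow> smooth_on S h \<Longrightarrow> smooth_on S (\<lambda>x. f x \<bullet> h x)"
  by (rule smooth_on_bilinear[OF _ bounded_bilinear_inner])

lemma smooth_on_minus [simp, intro]: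
  "open S \<Longrightarrow> smooth_on S f \<Longrightarrow> smooth_on S (\<lambda>x. - f x)"
  using smooth_on_scaleR[of S "\<lambda>_. -1" f] by simp

lemma smooth_on_diff [simp, intro]:
  "open S \<Longrightarrow> smooth_on S f \<Longrightarrow> smooth_on S h \<Longrightarrow> smooth_on S (\<lambda>x. f x - h x)"
  using smooth_on_add[of S f "\<lambda>x. - h x"] by simp

lemma smooth_on_sum [intro]:
  assumes "open S" "\<And>i. i \<in> I \<Longrightarrow> smooth_on S (f i)"
  shows "smooth_on S (\<lambda>x. \<Sum>i\<in>I. f i x)"
proof (cases "finite I")
  case True
  then show ?thesis using assms(2) by (induction I) (auto simp: assms(1))
qed simp

lemma smooth_on_prod [intro]:
  assumes "open S" "finite I" "\<And>i. i \<in> I \<Longrightarrow> smooth_on S (f i)"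
  shows "smooth_on S (\<lambda>x. \<Prod>i\<in>I. (f i x::real))"
  using assms(2,3) by (induction I) (auto simp: assms(1))

lemma smooth_on_divide [intro]:
  assumes "open S" "smooth_on S f" "smooth_on S h" "\<And>x. x \<in> S \<Longrightarrow> h x \<noteq> (0::real)"
  shows "smooth_on S (\<lambda>x. f x / h x)"
  using smooth_on_mult[OF assms(1,2), of "\<lambda>x. inverse (h x)"] Ck_on_inverse[OF assms(1,4)] assms(3)
  by (simp add: smooth_on_def divide_inverse)

lemma linear_vec_nth': "linear (\<lambda>v. v $ i)"
  by (auto intro!: linearI)

lemma smooth_on_nth [simp, intro]:
  "open S \<Longrightarrow> smooth_on S f \<Longrightarrow> smooth_on S (\<lambda>x. f x $ i)"
  for f :: "'a::euclidean_space \<Rightarrow> 'b::euclidean_space ^ 'n"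
  by (rule smooth_on_linear[OF _ linear_vec_nth'])

lemma linear_axis: "linear (axis i)"
  by (auto intro!: linearI simp: axis_def vec_eq_iff)

lemma smooth_on_vec [intro]:
  fixes f :: "'n::finite \<Rightarrow> 'a::euclidean_space \<Rightarrow> 'b::euclidean_space"
  assumes "open S" "\<And>i. smooth_on S (f i)"
  shows "smooth_on S (\<lambda>x. \<chi> i. f i x)"
proof -
  have "smooth_on S (\<lambda>x. \<Sum>i\<in>UNIV. axis i (f i x))"
    by (intro smooth_on_sum assms smooth_on_linear[OF _ linear_axis])
  moreover have "(\<Sum>i\<in>UNIV. axis i (f i x)) = (\<chi> i. f i x)" for x
    by (auto simp: vec_eq_iff axis_def)
  ultimately show ?thesis by simp
qed

lemma matrix_add_rdistrib': "(A + B) ** C = A ** C + B ** C"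
  for A B :: "real^'n^'m" and C :: "real^'k^'n"
  by (simp add: matrix_matrix_mult_def vec_eq_iff sum.distrib distrib_right)

lemma bounded_bilinear_matrix_mult:
  "bounded_bilinear ((**) :: real^'n^'m \<Rightarrow> real^'k^'n \<Rightarrow> real^'k^'m)"
  unfolding bilinear_conv_bounded_bilinear[symmetric] bilinear_def
  by (auto intro!: linearI simp: matrix_add_ldistrib matrix_add_rdistrib' matrix_scalar_ac
      scalar_matrix_assoc[symmetric])

lemma bounded_bilinear_matrix_vector_mult:
  "bounded_bilinear ((*v) :: real^'n^'m \<Rightarrow> real^'n \<Rightarrow> real^'m)"
  unfolding bilinear_conv_bounded_bilinear[symmetric] bilinear_def
  by (auto intro!: linearI simp: matrix_vector_right_distrib matrix_vector_mult_add_rdistrib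
      matrix_vector_mult_scaleR scaleR_matrix_vector_assoc)

lemma linear_transpose: "linear (transpose :: real^'n^'m \<Rightarrow> real^'m^'n)"
  by (auto intro!: linearI simp: transpose_def vec_eq_iff)

lemma linear_trace: "linear (trace :: real^'n^'n \<Rightarrow> real)"
  by (auto intro!: linearI simp: trace_def sum.distrib sum_distrib_left)

lemma smooth_on_matrix_mult [simp, intro]:
  fixes f :: "'a::euclidean_space \<Rightarrow> real^'n^'m" and h :: "'a \<Rightarrow> real^'k^'n"
  shows "open S \<Longrightarrow> smooth_on S f \<Longrightarrow> smooth_on S h \<Longrightarrow> smooth_on S (\<lambda>x. f x ** h x)"
  by (rule smooth_on_bilinear[OF _ bounded_bilinear_matrix_mult])

lemma smooth_on_matrix_vector_mult [simp, intro]: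
  fixes f :: "'a::euclidean_space \<Rightarrow> real^'n^'m" and h :: "'a \<Rightarrow> real^'n"
  shows "open S \<Longrightarrow> smooth_on S f \<Longrightarrow> smooth_on S h \<Longrightarrow> smooth_on S (\<lambda>x. f x *v h x)"
  by (rule smooth_on_bilinear[OF _ bounded_bilinear_matrix_vector_mult])

lemma smooth_on_trace [simp, intro]:
  fixes f :: "'a::euclidean_space \<Rightarrow> real^'n^'n"
  shows "open S \<Longrightarrow> smooth_on S f \<Longrightarrow> smooth_on S (\<lambda>x. trace (f x))"
  by (rule smooth_on_linear[OF _ linear_trace])

lemma smooth_on_det:
  fixes f :: "'a::euclidean_space \<Rightarrow> real^'n^'n"
  assumes "open S" "smooth_on S f"
  shows "smooth_on S (\<lambda>x. det (f x))"
  unfolding det_def using assms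
  by (intro smooth_on_sum smooth_on_mult smooth_on_prod) auto

lemma matrix_inv_works:
  fixes A :: "real^'n^'n"
  assumes "det A \<noteq> 0"
  shows "A ** matrix_inv A = mat 1" "matrix_inv A ** A = mat 1"
proof -
  have "\<exists>B. A ** B = mat 1 \<and> B ** A = mat 1"
    using assms invertible_det_nz[of A] by (simp add: invertible_def)
  then have "A ** matrix_inv A = mat 1 \<and> matrix_inv A ** A = mat 1"
    unfolding matrix_inv_def by (rule someI_ex)
  then show "A ** matrix_inv A = mat 1" "matrix_inv A ** A = mat 1" by auto
qed

text \<open>By Cramer's rule the entries of the inverse are rational functions of the entries.\<close>
lemma smooth_on_matrix_inv:
  fixes f :: "'a::euclidean_space \<Rightarrow> real^'n^'n"
  assumes "open S" "smooth_on S f" "\<And>x. x \<in> S \<Longrightarrow> det (f x) \<noteq> 0"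
  shows "smooth_on S (\<lambda>x. matrix_inv (f x))"
proof -
  let ?h = "\<lambda>x j. (\<chi> k. det(\<chi> i l. if l=k then axis j 1 $ i else f x$i$l) / det (f x))"
  have eq: "matrix_inv (f x) *v axis j 1 = ?h x j" if "x \<in> S" for x j
    using cramer[OF assms(3)[OF that], of "matrix_inv (f x) *v axis j 1" "axis j 1"]
    by (simp add: matrix_vector_mul_assoc matrix_inv_works[OF assms(3)[OF that]])
  have entry: "smooth_on S (\<lambda>x. if l=k then axis j 1 $ i else f x$i$l)" for i j k l
    using assms(1,2) by (cases "l = k") auto
  have "smooth_on S (\<lambda>x. ?h x j $ i)" for i j
    using assms by (simp, intro smooth_on_divide smooth_on_det smooth_on_vec entry) auto
  then have "smooth_on S (\<lambda>x. \<chi> i j. ?h x j $ i)"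
    using assms(1) by (intro smooth_on_vec) auto
  then show ?thesis
  proof (rule smooth_on_cong[OF assms(1)])
    fix x assume "x \<in> S"
    have "matrix_inv (f x) $ i $ j = (matrix_inv (f x) *v axis j 1) $ i" for i j
      by (simp add: matrix_vector_mul_component inner_axis)
    then show "(\<chi> i j. ?h x j $ i) = matrix_inv (f x)"
      unfolding eq[OF \<open>x \<in> S\<close>] by (simp add: vec_eq_iff)
  qed
qed

lemma smooth_on_matrixI:
  fixes T :: "'a::euclidean_space \<Rightarrow> real^'n^'m"
  assumes "open S" "\<And>w. smooth_on S (\<lambda>x. T x *v w)"
  shows "smooth_on S T"
proof -
  have "smooth_on S (\<lambda>x. \<chi> i j. (T x *v axis j 1) $ i)"
    by (intro smooth_on_vec smooth_on_nth assms)
  moreover have "(\<lambda>x. \<chi> i j. (T x *v axis j 1) $ i) = T"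
    by (simp add: fun_eq_iff vec_eq_iff matrix_vector_mul_component inner_axis)
  ultimately show ?thesis by simp
qed

lemma smooth_on_subset: "smooth_on S f \<Longrightarrow> T \<subseteq> S \<Longrightarrow> smooth_on T f"
proof -
  have "Ck_on k S f \<Longrightarrow> T \<subseteq> S \<Longrightarrow> Ck_on k T f" for k
    by (induction k arbitrary: f) (auto intro: continuous_on_subset)
  then show "smooth_on S f \<Longrightarrow> T \<subseteq> S \<Longrightarrow> smooth_on T f" by (auto simp: smooth_on_def)
qed

section \<open>Directional derivatives\<close>

abbreviation pd :: "real^'n \<Rightarrow> (real^'n \<Rightarrow> 'b::real_normed_vector) \<Rightarrow> real^'n::finite \<Rightarrow> 'b" where
  "pd v \<equiv> dir_deriv (\<lambda>_. v)"

lemma dir_deriv_eq_pd: "dir_deriv X f x = pd (X x) f x"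
  by (simp add: dir_deriv_def)

lemma smooth_on_has_derivative:
  "smooth_on S f \<Longrightarrow> x \<in> S \<Longrightarrow> (f has_derivative (\<lambda>v. pd v f x)) (at x)"
  using Ck_on_differentiable[of 0 S f x] by (simp add: smooth_on_def dir_deriv_def)

lemma pd_eqI: "(f has_derivative F) (at x) \<Longrightarrow> pd v f x = F v"
  by (simp add: dir_deriv_def frechet_derivative_apply)

lemma smooth_on_pd [simp, intro]: "smooth_on S f \<Longrightarrow> smooth_on S (pd v f)"
  unfolding smooth_on_def dir_deriv_def
proof
  fix k assume "\<forall>k. Ck_on k S f"
  then have "Ck_on (Suc k) S f" by blast
  then show "Ck_on k S (\<lambda>x. frechet_derivative f (at x) v)" by simp
qed

lemma linear_pd: "smooth_on S f \<Longrightarrow> x \<in> S \<Longrightarrow> linear (\<lambda>v. pd v f x)"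
  by (rule has_derivative_linear[OF smooth_on_has_derivative])

lemma pd_const [simp]: "pd v (\<lambda>_. c) x = 0"
  by (simp add: dir_deriv_def)

lemma pd_cong:
  assumes "open S" "smooth_on S f" "x \<in> S" "\<And>y. y \<in> S \<Longrightarrow> f y = h y"
  shows "pd v f x = pd v h x"
  using frechet_derivative_transform_within_open[of f x S h] assms
    smooth_on_has_derivative[OF assms(2,3)]
  by (simp add: dir_deriv_def differentiableI)

lemma pd_linear:
  fixes L :: "'b::euclidean_space \<Rightarrow> 'c::real_normed_vector"
  assumes "linear L" "smooth_on S f" "x \<in> S"
  shows "pd v (\<lambda>y. L (f y)) x = L (pd v f x)"
  by (rule pd_eqI[OF bounded_linear.has_derivative[OF _ smooth_on_has_derivative[OF assms(2,3)]]])
    (use assms(1) in \<open>simp add: linear_conv_bounded_linear[symmetric]\<close>)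

lemma pd_bilinear:
  assumes "bounded_bilinear B" "smooth_on S f" "smooth_on S h" "x \<in> S"
  shows "pd v (\<lambda>y. B (f y) (h y)) x = B (f x) (pd v h x) + B (pd v f x) (h x)"
  by (rule pd_eqI[OF bounded_bilinear.FDERIV[OF assms(1)
        smooth_on_has_derivative[OF assms(2,4)] smooth_on_has_derivative[OF assms(3,4)]]])

lemma pd_add:
  assumes "smooth_on S f" "smooth_on S h" "x \<in> S"
  shows "pd v (\<lambda>y. f y + h y) x = pd v f x + pd v h x"
  by (rule pd_eqI[OF has_derivative_add[OF
        smooth_on_has_derivative[OF assms(1,3)] smooth_on_has_derivative[OF assms(2,3)]]])

lemma pd_diff:
  assumes "smooth_on S f" "smooth_on S h" "x \<in> S"
  shows "pd v (\<lambda>y. f y - h y) x = pd v f x - pd v h x"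
  by (rule pd_eqI[OF has_derivative_diff[OF
        smooth_on_has_derivative[OF assms(1,3)] smooth_on_has_derivative[OF assms(2,3)]]])

lemma pd_minus:
  assumes "smooth_on S f" "x \<in> S"
  shows "pd v (\<lambda>y. - f y) x = - pd v f x"
  by (rule pd_eqI[OF has_derivative_minus[OF smooth_on_has_derivative[OF assms]]])

lemmas pd_scaleR = pd_bilinear[OF bounded_bilinear_scaleR]
  and pd_mult = pd_bilinear[OF bounded_bilinear_mult]
  and pd_inner = pd_bilinear[OF bounded_bilinear_inner]
  and pd_matrix_mult = pd_bilinear[OF bounded_bilinear_matrix_mult]
  and pd_matrix_vector_mult = pd_bilinear[OF bounded_bilinear_matrix_vector_mult]
  and pd_transpose = pd_linear[OF linear_transpose]
  and pd_trace = pd_linear[OF linear_trace]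
  and pd_nth = pd_linear[OF linear_vec_nth']

lemma pd_scaleR_const:
  "smooth_on S f \<Longrightarrow> x \<in> S \<Longrightarrow> pd v (\<lambda>y. c *\<^sub>R f y) x = c *\<^sub>R pd v f x"
  using pd_scaleR[of S "\<lambda>_. c" f x v] by simp

lemma pd_sum:
  assumes "open S" "\<And>i. i \<in> I \<Longrightarrow> smooth_on S (f i)" "x \<in> S"
  shows "pd v (\<lambda>y. \<Sum>i\<in>I. f i y) x = (\<Sum>i\<in>I. pd v (f i) x)"
  by (rule pd_eqI[OF has_derivative_sum[OF smooth_on_has_derivative[OF assms(2,3)]]])

lemma vec_basis: "v = (\<Sum>i\<in>UNIV. v $ i *\<^sub>R axis i 1)" for v :: "real^'n"
  by (simp add: vec_eq_iff axis_def if_distrib cong: if_cong)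

lemma pd_basis:
  assumes "smooth_on S f" "x \<in> S"
  shows "pd v f x = (\<Sum>i\<in>UNIV. v $ i *\<^sub>R pd (axis i 1) f x)"
proof -
  have "pd v f x = pd (\<Sum>i\<in>UNIV. v $ i *\<^sub>R axis i 1) f x"
    by (rule arg_cong[OF vec_basis, of "\<lambda>w. pd w f x"])
  also have "\<dots> = (\<Sum>i\<in>UNIV. v $ i *\<^sub>R pd (axis i 1) f x)"
    unfolding linear_sum[OF linear_pd[OF assms]] linear_scale[OF linear_pd[OF assms]] ..
  finally show ?thesis .
qed

lemma smooth_on_dir_deriv:
  fixes f :: "real^'n \<Rightarrow> 'b::real_normed_vector"
  assumes "open S" "smooth_on S X" "smooth_on S f"
  shows "smooth_on S (dir_deriv X f)"
proof -
  have "smooth_on S (\<lambda>y. \<Sum>i\<in>UNIV. X y $ i *\<^sub>R pd (axis i 1) f y)"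
    using assms by (intro smooth_on_sum smooth_on_scaleR smooth_on_nth smooth_on_pd)
  then show ?thesis
    by (rule smooth_on_cong[OF assms(1)])
      (rule trans[OF pd_basis[OF assms(3), symmetric] dir_deriv_eq_pd[symmetric]])
qed

lemma diff_inner: "smooth_on S f \<Longrightarrow> x \<in> S \<Longrightarrow> diff f x \<bullet> v = pd v f x"
  by (subst pd_basis) (auto simp: diff_def inner_vec_def partial_def mult.commute)

lemma smooth_on_diff_form: "open S \<Longrightarrow> smooth_on S f \<Longrightarrow> smooth_on S (diff f)"
  unfolding diff_def[abs_def] partial_def by (intro smooth_on_vec) auto

text \<open>The second difference of \<open>f\<close> over a parallelogram with sides \<open>s v\<close>, \<open>s w\<close> is, by the mean value
  theorem applied to each side in turn, \<open>s\<^sup>2\<close> times a mixed second derivative at a point of it.\<close>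
lemma second_difference_mvt:
  fixes f :: "real^'n \<Rightarrow> real"
  assumes sm: "smooth_on S f" and s: "s > 0"
    and inS: "\<And>a b. a \<in> {0..s} \<Longrightarrow> b \<in> {0..s} \<Longrightarrow> x + a *\<^sub>R v + b *\<^sub>R w \<in> S"
  shows "\<exists>a\<in>{0..s}. \<exists>b\<in>{0..s}.
    f (x + s *\<^sub>R v + s *\<^sub>R w) - f (x + s *\<^sub>R v) - f (x + s *\<^sub>R w) + f x
      = s * s * pd w (pd v f) (x + a *\<^sub>R v + b *\<^sub>R w)"
proof -
  have D: "((\<lambda>a. h (p + a *\<^sub>R u)) has_real_derivative pd u h (p + a *\<^sub>R u)) (at a)"
    if "smooth_on S h" "p + a *\<^sub>R u \<in> S" for h :: "real^'n \<Rightarrow> real" and p u a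
  proof -
    have A: "((\<lambda>a. p + a *\<^sub>R u) has_derivative (\<lambda>t. t *\<^sub>R u)) (at a)"
      by (auto intro!: derivative_eq_intros)
    have "((\<lambda>a. h (p + a *\<^sub>R u)) has_derivative (\<lambda>t. pd (t *\<^sub>R u) h (p + a *\<^sub>R u))) (at a)"
      by (rule has_derivative_compose[OF A smooth_on_has_derivative[OF that]])
    moreover have "(\<lambda>t. pd (t *\<^sub>R u) h (p + a *\<^sub>R u)) = (*) (pd u h (p + a *\<^sub>R u))"
      using linear_scale[OF linear_pd[OF that]] by (auto simp: fun_eq_iff)
    ultimately show ?thesis by (simp add: has_field_derivative_def)
  qed
  define q where "q a = f ((x + s *\<^sub>R w) + a *\<^sub>R v) - f (x + a *\<^sub>R v)" for a
  have "\<exists>a. 0 < a \<and> a < s \<and> q s - q 0 = (s - 0) * (pd v f ((x + s *\<^sub>R w) + a *\<^sub>R v) - pd v f (x + a *\<^sub>R v))"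
    unfolding q_def using s inS[of _ s] inS[of _ 0]
    by (intro MVT2[OF s] DERIV_diff D[OF sm]) (auto simp: algebra_simps)
  then obtain a where a: "0 < a" "a < s"
    "q s - q 0 = s * (pd v f ((x + s *\<^sub>R w) + a *\<^sub>R v) - pd v f (x + a *\<^sub>R v))" by auto
  define r where "r b = pd v f ((x + a *\<^sub>R v) + b *\<^sub>R w)" for b
  have "\<exists>b. 0 < b \<and> b < s \<and> r s - r 0 = (s - 0) * pd w (pd v f) ((x + a *\<^sub>R v) + b *\<^sub>R w)"
    unfolding r_def using inS[of a] a sm by (intro MVT2[OF s] D[OF smooth_on_pd[OF sm]]) auto
  then obtain b where b: "0 < b" "b < s" "r s - r 0 = s * pd w (pd v f) (x + a *\<^sub>R v + b *\<^sub>R w)"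
    by auto
  have "f (x + s *\<^sub>R v + s *\<^sub>R w) - f (x + s *\<^sub>R v) - f (x + s *\<^sub>R w) + f x = q s - q 0"
    by (simp add: q_def algebra_simps)
  also have "\<dots> = s * (r s - r 0)" using a(3) by (simp add: r_def algebra_simps)
  finally show ?thesis using a b by (intro bexI[of _ a] bexI[of _ b]) auto
qed

text \<open>Both mixed derivatives are limits of the same second difference quotient, which is symmetric
  in the two directions.\<close>
lemma pd_commute_real:
  fixes f :: "real^'n \<Rightarrow> real"
  assumes "open S" "smooth_on S f" "x \<in> S"
  shows "pd v (pd w f) x = pd w (pd v f) x"
proof (rule ccontr)
  let ?a = "pd v (pd w f)" and ?b = "pd w (pd v f)"
  assume ne: "?a x \<noteq> ?b x"
  define e where "e = \<bar>?a x - ?b x\<bar> / 2"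
  have e: "e > 0" using ne by (simp add: e_def)
  have "isCont ?a x" "isCont ?b x"
    using smooth_on_has_derivative[of S ?a x] smooth_on_has_derivative[of S ?b x] assms
    by (auto intro: has_derivative_continuous)
  then obtain d1 d2 where d1: "d1 > 0" "\<And>y. dist y x < d1 \<Longrightarrow> dist (?a y) (?a x) < e"
    and d2: "d2 > 0" "\<And>y. dist y x < d2 \<Longrightarrow> dist (?b y) (?b x) < e"
    using e unfolding continuous_at_eps_delta by metis
  obtain d3 where d3: "d3 > 0" "\<And>y. dist y x < d3 \<Longrightarrow> y \<in> S"
    using assms(1,3) open_dist by metis
  define d where "d = Min {d1, d2, d3}"
  have d: "d > 0" "d \<le> d1" "d \<le> d2" "d \<le> d3" using d1 d2 d3 by (auto simp: d_def)
  \<comment> \<open>The side length \<open>s\<close> keeps the whole parallelogram within distance \<open>d\<close> of \<open>x\<close>.\<close>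
  define N where "N = norm v + norm w + 1"
  have N: "N > 0" by (simp add: N_def add_nonneg_pos)
  define s where "s = d / (2 * N)"
  have s: "s > 0" using d N by (simp add: s_def)
  have near: "dist (x + a *\<^sub>R v + b *\<^sub>R w) x < d" if "a \<in> {0..s}" "b \<in> {0..s}" for a b
  proof -
    have "dist (x + a *\<^sub>R v + b *\<^sub>R w) x \<le> norm (a *\<^sub>R v) + norm (b *\<^sub>R w)"
      by (simp add: dist_norm add.assoc norm_triangle_ineq del: norm_scaleR)
    also have "\<dots> \<le> s * norm v + s * norm w"
      using that by (intro add_mono) (auto intro: mult_right_mono)
    also have "\<dots> \<le> s * N" using s by (simp add: N_def algebra_simps)
    also have "\<dots> = d / 2" using N by (simp add: s_def)
    finally show ?thesis using d by simp
  qed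
  have near': "dist (x + b *\<^sub>R w + a *\<^sub>R v) x < d" if "a \<in> {0..s}" "b \<in> {0..s}" for a b
    using near[OF that] by (simp add: algebra_simps)
  obtain a b where 1: "a \<in> {0..s}" "b \<in> {0..s}"
    "f (x + s *\<^sub>R v + s *\<^sub>R w) - f (x + s *\<^sub>R v) - f (x + s *\<^sub>R w) + f x
      = s * s * ?b (x + a *\<^sub>R v + b *\<^sub>R w)"
    using second_difference_mvt[OF assms(2) s, of x v w] near d d3 by (meson order_less_le_trans)
  obtain a' b' where 2: "a' \<in> {0..s}" "b' \<in> {0..s}"
    "f (x + s *\<^sub>R w + s *\<^sub>R v) - f (x + s *\<^sub>R w) - f (x + s *\<^sub>R v) + f x
      = s * s * ?a (x + a' *\<^sub>R w + b' *\<^sub>R v)"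
    using second_difference_mvt[OF assms(2) s, of x w v] near' d d3 by (meson order_less_le_trans)
  have "s * s * ?b (x + a *\<^sub>R v + b *\<^sub>R w) = s * s * ?a (x + a' *\<^sub>R w + b' *\<^sub>R v)"
    using 1(3) 2(3) by (simp add: algebra_simps)
  then have "?b (x + a *\<^sub>R v + b *\<^sub>R w) = ?a (x + a' *\<^sub>R w + b' *\<^sub>R v)" using s by simp
  moreover have "dist (?b (x + a *\<^sub>R v + b *\<^sub>R w)) (?b x) < e"
    using near[OF 1(1,2)] d by (intro d2) auto
  moreover have "dist (?a (x + a' *\<^sub>R w + b' *\<^sub>R v)) (?a x) < e"
    using near'[OF 2(2,1)] d by (intro d1) auto
  moreover have "False" if "\<bar>r - q\<bar> < \<bar>p - q\<bar> / 2" "\<bar>r - p\<bar> < \<bar>p - q\<bar> / 2" for p q r :: real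
    using that abs_triangle_ineq4[of "r - q" "r - p"] by auto
  ultimately show False unfolding e_def dist_real_def by metis
qed

text \<open>Reduction to the scalar case by taking inner products with a basis vector.\<close>
lemma pd_commute:
  fixes f :: "real^'n \<Rightarrow> 'b::euclidean_space"
  assumes "open S" "smooth_on S f" "x \<in> S"
  shows "pd v (pd w f) x = pd w (pd v f) x"
proof (rule euclidean_eqI)
  fix b :: 'b
  have L: "linear (\<lambda>z::'b. z \<bullet> b)" by (auto intro!: linearI simp: inner_add_left)
  have s: "smooth_on S (\<lambda>y. f y \<bullet> b)" using assms(1,2) by auto
  have "pd v (pd w f) x \<bullet> b = pd v (pd w (\<lambda>y. f y \<bullet> b)) x" for v w
  proof -
    have "pd v (pd w (\<lambda>y. f y \<bullet> b)) x = pd v (\<lambda>y. pd w f y \<bullet> b) x"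
      by (rule pd_cong[OF assms(1) smooth_on_pd[OF s] assms(3) pd_linear[OF L assms(2)]])
    also have "\<dots> = pd v (pd w f) x \<bullet> b"
      by (rule pd_linear[OF L smooth_on_pd[OF assms(2)] assms(3)])
    finally show ?thesis by simp
  qed
  then show "pd v (pd w f) x \<bullet> b = pd w (pd v f) x \<bullet> b"
    using pd_commute_real[OF assms(1) s assms(3)] by metis
qed

lemma pd_compose:
  assumes "smooth_on S p" "x \<in> S" "smooth_on T f" "p x \<in> T"
  shows "pd v (\<lambda>y. f (p y)) x = pd (pd v p x) f (p x)"
  by (rule pd_eqI[OF has_derivative_compose[OF smooth_on_has_derivative[OF assms(1,2)]
        smooth_on_has_derivative[OF assms(3,4)]]])

text \<open>The chain rule writes a derivative of the composition as a sum of products of smooth functions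
  with compositions of the same kind, so the induction hypothesis applies to the latter.\<close>
lemma smooth_on_compose:
  fixes p :: "real^'n \<Rightarrow> real^'m" and f :: "real^'m \<Rightarrow> 'b::real_normed_vector"
  assumes S: "open S" "smooth_on S p" and T: "p ` S \<subseteq> T" and f: "smooth_on T f"
  shows "smooth_on S (\<lambda>y. f (p y))"
proof -
  have c: "Ck_on k S (\<lambda>y. f (p y))" if "smooth_on T f" for k f
    using that
  proof (induction k arbitrary: f)
    case 0
    have "continuous_on T f" "continuous_on S p"
      using 0 S(2) unfolding smooth_on_def by (metis Ck_on.simps(1))+
    then show ?case using T by (simp add: continuous_on_compose2)
  next
    case (Suc k)
    have D: "((\<lambda>y. f (p y)) has_derivative (\<lambda>v. pd (pd v p x) f (p x))) (at x)" if "x \<in> S" for x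
      using T that by (intro has_derivative_compose[OF smooth_on_has_derivative[OF S(2) that]
            smooth_on_has_derivative[OF Suc.prems]]) auto
    have "Ck_on k S (\<lambda>x. pd (pd v p x) f (p x))" for v
    proof (rule Ck_on_cong[OF S(1)])
      have i: "Ck_on k S (\<lambda>x. pd v p x $ i *\<^sub>R pd (axis i 1) f (p x))" for i
      proof (rule Ck_on_bilinear[OF S(1) bounded_bilinear_scaleR])
        show "Ck_on k S (\<lambda>x. pd v p x $ i)"
          using smooth_on_nth[OF S(1) smooth_on_pd[OF S(2)]] by (simp add: smooth_on_def)
        show "Ck_on k S (\<lambda>x. pd (axis i 1) f (p x))"
          by (rule Suc.IH[OF smooth_on_pd[OF Suc.prems]])
      qed
      have "Ck_on k S (\<lambda>x. \<Sum>i\<in>I. pd v p x $ i *\<^sub>R pd (axis i 1) f (p x))" for I :: "'m set"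
        by (induction I rule: infinite_finite_induct) (simp_all add: Ck_on_const Ck_on_add S(1) i)
      then show "Ck_on k S (\<lambda>x. \<Sum>i\<in>UNIV. pd v p x $ i *\<^sub>R pd (axis i 1) f (p x))" .
      show "(\<Sum>i\<in>UNIV. pd v p x $ i *\<^sub>R pd (axis i 1) f (p x)) = pd (pd v p x) f (p x)" if "x \<in> S" for x
        using T that by (intro pd_basis[OF Suc.prems, symmetric]) auto
    qed
    then show ?case using Ck_on_SucI[OF S(1) D] by blast
  qed
  show ?thesis unfolding smooth_on_def using c[OF f] by blast
qed

section \<open>Linear algebra of a metric at a point\<close>

lemma matrix_vector_minus_left [simp]: "(- A) *v x = - (A *v x)" for A :: "real^'n^'m"
  by (simp add: matrix_vector_mult_def vec_eq_iff sum_negf)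

lemma matrix_vector_minus_right [simp]: "A *v (- x) = - (A *v x)" for A :: "real^'n^'m"
  by (simp add: matrix_vector_mult_def vec_eq_iff sum_negf)

lemma matrix_vector_sum_left: "(\<Sum>i\<in>I. A i) *v x = (\<Sum>i\<in>I. A i *v x)" for A :: "'i \<Rightarrow> real^'n^'m"
  by (induction I rule: infinite_finite_induct) (auto simp: matrix_vector_mult_add_rdistrib)

lemma numeral_mult_vec [simp]: "numeral k * x = numeral k *\<^sub>R x" for x :: "real^'n"
  by (simp add: vec_eq_iff)

lemmas mv_simps = matrix_vector_mul_assoc[symmetric] matrix_vector_right_distrib
  matrix_vector_mult_add_rdistrib matrix_vector_mult_diff_distrib matrix_vector_mult_diff_rdistrib
  matrix_vector_mult_scaleR scaleR_matrix_vector_assoc[symmetric]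
  matrix_vector_minus_left matrix_vector_minus_right comm_def acomm_def

lemma ip_add_left: "ip G (X + Y) Z = ip G X Z + ip G Y Z"
  and ip_add_right: "ip G X (Y + Z) = ip G X Y + ip G X Z"
  and ip_diff_left: "ip G (X - Y) Z = ip G X Z - ip G Y Z"
  and ip_diff_right: "ip G X (Y - Z) = ip G X Y - ip G X Z"
  and ip_minus_left: "ip G (- X) Z = - ip G X Z"
  and ip_minus_right: "ip G X (- Z) = - ip G X Z"
  and ip_scaleR_left: "ip G (c *\<^sub>R X) Z = c * ip G X Z"
  and ip_scaleR_right: "ip G X (c *\<^sub>R Z) = c * ip G X Z"
  and ip_zero_left: "ip G 0 Z = 0"
  and ip_zero_right: "ip G X 0 = 0"
  by (simp_all add: ip_def mv_simps inner_simps)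

lemmas ip_simps = ip_add_left ip_add_right ip_diff_left ip_diff_right ip_minus_left ip_minus_right
  ip_scaleR_left ip_scaleR_right ip_zero_left ip_zero_right

lemma ip_sum_apply: "ip G ((\<Sum>i\<in>I. A i) *v X) Y = (\<Sum>i\<in>I. ip G (A i *v X) Y)"
  by (induction I rule: infinite_finite_induct) (simp_all add: ip_simps mv_simps)

text \<open>Contractions are taken as traces, for which no orthonormal basis has to be chosen.\<close>
definition tr :: "(real^'n \<Rightarrow> real^'n) \<Rightarrow> real" where
  "tr f = trace (matrix f :: real^'n^'n::finite)"

lemma tr_basis: "tr f = (\<Sum>i\<in>UNIV. f (axis i 1) $ i)"
  by (simp add: tr_def trace_def matrix_def)

lemma tr_add: "tr (\<lambda>Z. f Z + h Z) = tr f + tr h"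
  and tr_diff: "tr (\<lambda>Z. f Z - h Z) = tr f - tr h"
  and tr_minus: "tr (\<lambda>Z. - f Z) = - tr f"
  and tr_scaleR: "tr (\<lambda>Z. c *\<^sub>R f Z) = c * tr f"
  by (simp_all add: tr_basis sum.distrib sum_subtractf sum_negf sum_distrib_left)

lemma tr_matrix: "tr (\<lambda>Z. A *v Z) = trace A"
  by (simp add: tr_def)

lemma tr_ident: "tr (\<lambda>Z. Z :: real^'n) = real CARD('n::finite)"
  using trace_I[where 'n='n and 'a=real] tr_matrix[of "mat 1 :: real^'n^'n"] by simp

lemma tr_comp_matrix:
  assumes "linear f"
  shows "tr (\<lambda>Z. f (A *v Z)) = tr (\<lambda>Z. A *v f Z)"
proof -
  obtain B where f: "f = (*v) B" using matrix_vector_mul(2)[OF assms] by metis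
  show ?thesis
    unfolding f by (simp add: matrix_vector_mul_assoc tr_matrix) (rule trace_mul_sym)
qed

lemma tr_rank_one: "tr (\<lambda>Z. (V \<bullet> Z) *\<^sub>R W) = V \<bullet> W"
  by (simp add: tr_basis inner_axis) (simp add: inner_vec_def)

lemma linear_matrix_vector: "linear f \<Longrightarrow> matrix f *v x = f x"
  for f :: "real^'n \<Rightarrow> real^'m"
  using matrix_vector_mul(2) by metis

locale metric_at =
  fixes G :: "real^'n^'n::finite"
  assumes ip_sym: "ip G X Y = ip G Y X"
    and ip_pos: "X \<noteq> 0 \<Longrightarrow> ip G X X > 0"
begin

lemma G_transpose: "transpose G = G"
proof -
  have "(Y v* G) \<bullet> X = (G *v Y) \<bullet> X" for X Y
    using ip_sym[of X Y] dot_lmul_matrix[of Y G X] by (simp add: ip_def inner_commute)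
  then have "transpose G *v Y = G *v Y" for Y
    unfolding transpose_matrix_vector by (metis vector_eq_rdot)
  then show ?thesis by (simp add: matrix_eq)
qed

lemma det_G: "det G \<noteq> 0"
proof -
  have "X = 0" if "G *v X = 0" for X
    using ip_pos[of X] that by (auto simp: ip_def)
  then have "\<exists>B. B ** G = mat 1" by (simp add: matrix_left_invertible_ker)
  then show ?thesis
    using invertible_det_nz[of G] matrix_left_right_inverse unfolding invertible_def by blast
qed

lemmas G_inv = matrix_inv_works[OF det_G]

lemma ip_eq_inner: "ip G X Y = (G *v X) \<bullet> Y"
  using ip_sym[of X Y] by (simp add: ip_def inner_commute)

lemma ip_eqI: "(\<And>Y. ip G X Y = ip G X' Y) \<Longrightarrow> X = X'"
proof -
  assume "\<And>Y. ip G X Y = ip G X' Y"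
  then have "ip G (X - X') (X - X') = 0" by (simp add: ip_simps)
  then show "X = X'" using ip_pos[of "X - X'"] by auto
qed

lemma ip_endo_eqI: "(\<And>X Y. ip G (A *v X) Y = ip G (B *v X) Y) \<Longrightarrow> A = B"
  using ip_eqI matrix_eq by metis

lemma ip_sharp: "ip G (sharp G \<alpha>) Y = \<alpha> \<bullet> Y"
  by (simp add: ip_eq_inner sharp_def matrix_vector_mul_assoc G_inv)

lemma ip_endo_of_form:
  assumes "\<And>Y. linear (\<lambda>X. \<beta> X Y)" "\<And>X. linear (\<beta> X)"
  shows "ip G (endo_of_form G \<beta> *v X) Y = \<beta> X Y"
proof -
  let ?B = "(\<chi> i j. \<beta> (axis j 1) (axis i 1)) :: real^'n^'n"
  have "ip G (endo_of_form G \<beta> *v X) Y = (?B *v X) \<bullet> Y"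
    by (simp add: ip_eq_inner endo_of_form_def matrix_vector_mul_assoc matrix_mul_assoc G_inv)
  also have "\<dots> = (\<Sum>i\<in>UNIV. \<Sum>j\<in>UNIV. X $ j * (Y $ i * \<beta> (axis j 1) (axis i 1)))"
    by (simp add: inner_vec_def matrix_vector_mult_def sum_distrib_left sum_distrib_right mult_ac)
  also have "\<dots> = (\<Sum>j\<in>UNIV. X $ j * (\<Sum>i\<in>UNIV. Y $ i * \<beta> (axis j 1) (axis i 1)))"
    by (subst sum.swap) (simp add: sum_distrib_left)
  also have "\<dots> = (\<Sum>j\<in>UNIV. X $ j * \<beta> (axis j 1) (\<Sum>i\<in>UNIV. Y $ i *\<^sub>R axis i 1))"
    by (simp add: linear_sum[OF assms(2)] linear_scale[OF assms(2)])
  also have "\<dots> = \<beta> (\<Sum>j\<in>UNIV. X $ j *\<^sub>R axis j 1) Y"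
    unfolding vec_basis[of Y, symmetric] by (simp add: linear_sum[OF assms(1)] linear_scale[OF assms(1)])
  also have "\<dots> = \<beta> X Y" unfolding vec_basis[of X, symmetric] ..
  finally show ?thesis .
qed

lemma wedge_apply: "wedge G X Y *v Z = ip G X Z *\<^sub>R Y - ip G Y Z *\<^sub>R X"
  unfolding wedge_def
  by (rule linear_matrix_vector) (auto intro!: linearI simp: ip_simps algebra_simps)

lemma wedge_add1: "wedge G (X + X') Y = wedge G X Y + wedge G X' Y"
  and wedge_add2: "wedge G X (Y + Y') = wedge G X Y + wedge G X Y'"
  and wedge_scaleR1: "wedge G (c *\<^sub>R X) Y = c *\<^sub>R wedge G X Y"
  and wedge_scaleR2: "wedge G X (c *\<^sub>R Y) = c *\<^sub>R wedge G X Y"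
  and wedge_anti: "wedge G Y X = - wedge G X Y"
  by (simp_all add: matrix_eq mv_simps wedge_apply ip_simps algebra_simps)

lemma tr_ip: "tr (\<lambda>Z. ip G V Z *\<^sub>R W) = ip G V W"
  unfolding ip_eq_inner by (rule tr_rank_one)

text \<open>The adjoint is the transpose conjugated by the Gram matrix.\<close>
lemma trace_adjoint:
  assumes "\<And>Z W. ip G (A *v Z) W = ip G Z (B *v W)"
  shows "trace A = trace B"
proof -
  have "(transpose A ** G) *v W = (G ** B) *v W" for W
  proof -
    have "Z \<bullet> ((transpose A ** G) *v W) = Z \<bullet> ((G ** B) *v W)" for Z
      using assms[of Z W] dot_lmul_matrix[of "G *v W" A Z]
      by (simp add: ip_def matrix_vector_mul_assoc[symmetric] inner_commute)
    then show ?thesis by (metis vector_eq_ldot)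
  qed
  then have "transpose A ** G = G ** B" by (simp add: matrix_eq)
  then have "matrix_inv G ** (transpose A ** G) = B"
    by (simp add: matrix_mul_assoc G_inv)
  then have "trace B = trace (transpose A)"
    using trace_mul_sym[of "matrix_inv G" "transpose A ** G"]
    by (simp add: matrix_mul_assoc[symmetric] G_inv)
  then show ?thesis by (simp add: trace_def transpose_def)
qed

lemma tr_adjoint:
  assumes "linear f" "linear h" "\<And>Z W. ip G (f Z) W = ip G Z (h W)"
  shows "tr f = tr h"
  unfolding tr_def
  by (rule trace_adjoint) (simp add: linear_matrix_vector[OF assms(1)] linear_matrix_vector[OF assms(2)] assms(3))

lemma skew_endoD: "skew_endo G \<psi> \<Longrightarrow> ip G (\<psi> *v X) Y = - ip G X (\<psi> *v Y)"
  unfolding skew_endo_def using ip_sym by metis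

lemma skew_endoI: "(\<And>X Y. ip G (\<psi> *v X) Y = - ip G X (\<psi> *v Y)) \<Longrightarrow> skew_endo G \<psi>"
  unfolding skew_endo_def using ip_sym by metis

lemma skew_add: "skew_endo G A \<Longrightarrow> skew_endo G B \<Longrightarrow> skew_endo G (A + B)"
  and skew_diff: "skew_endo G A \<Longrightarrow> skew_endo G B \<Longrightarrow> skew_endo G (A - B)"
  and skew_scaleR: "skew_endo G A \<Longrightarrow> skew_endo G (c *\<^sub>R A)"
  by (auto intro!: skew_endoI simp: mv_simps ip_simps skew_endoD)

lemma skew_wedge: "skew_endo G (wedge G X Y)"
  by (rule skew_endoI) (simp add: wedge_apply ip_simps ip_sym)

text \<open>Permuting the arguments of \<open>g(C(X)Y, Z)\<close> alternately by the two symmetries comes back to the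
  start with the opposite sign. This one fact gives the uniqueness of the Levi-Civita connection,
  the formula for the second derivative of a Killing field, and the second integrability condition
  from the part of it that is visible in the curvature.\<close>
lemma symmetric_skew_zero:
  assumes "\<And>X. skew_endo G (C X)" "\<And>X Y. C X *v Y = C Y *v X"
  shows "C X = 0"
proof -
  have s: "ip G (C X *v Y) Z = - ip G (C X *v Z) Y" for X Y Z
    using assms(1) unfolding skew_endo_def by blast
  have "ip G (C X *v Y) Z = - ip G (C X *v Y) Z" for X Y Z
    using s[of X Y Z] s[of Y X Z] s[of Z X Y] unfolding assms(2)[of Y X] assms(2)[of Z Y] assms(2)[of Z X]
    by linarith
  then have "ip G (C X *v Y) Z = ip G (0 *v Y) Z" for Y Z
    by (simp add: ip_zero_left) 
  then show ?thesis by (rule ip_endo_eqI)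
qed

lemma trace_wedge_comp: "trace (wedge G X Y ** A) = ip G X (A *v Y) - ip G Y (A *v X)"
proof -
  have "trace (wedge G X Y ** A) = tr (\<lambda>Z. A *v (ip G X Z *\<^sub>R Y - ip G Y Z *\<^sub>R X))"
    by (subst trace_mul_sym) (simp add: tr_matrix[symmetric] matrix_vector_mul_assoc[symmetric] wedge_apply)
  also have "\<dots> = ip G X (A *v Y) - ip G Y (A *v X)"
    by (simp add: mv_simps tr_diff tr_ip)
  finally show ?thesis .
qed

text \<open>Paired with \<open>Z\<close> and \<open>W\<close>, the sum is the antisymmetrization of
  \<open>g(\<psi>Z, W)\<close>. Conditions that are linear in \<open>\<psi>\<close> thereby reduce to \<open>\<psi> = X \<and> Y\<close>.\<close>
lemma skew_eq_sum_wedge: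
  assumes "skew_endo G \<psi>"
  shows "\<psi> = (1/2) *\<^sub>R (\<Sum>i\<in>UNIV. \<Sum>j\<in>UNIV.
    ((\<psi> ** matrix_inv G) $ i $ j) *\<^sub>R wedge G (axis j 1) (axis i 1))" (is "_ = ?w")
proof (rule ip_endo_eqI)
  fix Z W
  let ?S = "\<psi> ** matrix_inv G"
  have s: "(\<Sum>i\<in>UNIV. \<Sum>j\<in>UNIV. ?S $ i $ j * (a $ j * b $ i)) = b \<bullet> (?S *v a)" for a b
    by (simp add: inner_vec_def matrix_vector_mult_def sum_distrib_left mult_ac)
  have "ip G (wedge G (axis j 1) (axis i 1) *v Z) W
      = (G *v Z) $ j * (G *v W) $ i - (G *v W) $ j * (G *v Z) $ i" for i j
    by (simp add: wedge_apply ip_simps) (simp add: ip_def inner_axis')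
  then have "ip G (?w *v Z) W = ((G *v W) \<bullet> (?S *v (G *v Z)) - (G *v Z) \<bullet> (?S *v (G *v W))) / 2"
    by (simp add: mv_simps ip_simps ip_sum_apply right_diff_distrib sum_subtractf s)
  also have "\<dots> = (ip G W (\<psi> *v Z) - ip G Z (\<psi> *v W)) / 2"
  proof -
    have "?S *v (G *v V) = \<psi> *v V" for V
      by (simp add: matrix_vector_mul_assoc matrix_mul_assoc[symmetric] G_inv)
    then show ?thesis by (simp only: ip_eq_inner)
  qed
  also have "\<dots> = ip G (\<psi> *v Z) W"
    using skew_endoD[OF assms, of Z W] ip_sym[of W "\<psi> *v Z"] by simp
  finally show "ip G (\<psi> *v Z) W = ip G (?w *v Z) W" by (rule sym)
qed

end

section \<open>Algebraic curvature tensors\<close>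

text \<open>The formula of \<open>riem_form\<close> for an arbitrary bilinear map in place of the curvature at a point.\<close>
definition form_op :: "real^'n^'n \<Rightarrow> (real^'n \<Rightarrow> real^'n \<Rightarrow> real^'n^'n) \<Rightarrow> real^'n^'n \<Rightarrow> real^'n^'n::finite" where
  "form_op G R \<psi> = (1/2) *\<^sub>R (\<Sum>i\<in>UNIV. \<Sum>j\<in>UNIV.
     ((\<psi> ** matrix_inv G) $ i $ j) *\<^sub>R R (axis j 1) (axis i 1))"

definition ric_of :: "(real^'n \<Rightarrow> real^'n \<Rightarrow> real^'n^'n) \<Rightarrow> real^'n \<Rightarrow> real^'n \<Rightarrow> real" where
  "ric_of R X Y = tr (\<lambda>Z. R X Z *v Y :: real^'n::finite)"

lemma form_op_add: "form_op G R (\<phi> + \<psi>) = form_op G R \<phi> + form_op G R \<psi>"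
  and form_op_scaleR: "form_op G R (c *\<^sub>R \<phi>) = c *\<^sub>R form_op G R \<phi>"
  by (simp_all add: form_op_def matrix_add_rdistrib' scaleR_add_left sum.distrib
      scalar_matrix_assoc[symmetric] scaleR_sum_right algebra_simps)

locale curvature_at = metric_at G for G :: "real^'n^'n::finite" +
  fixes R :: "real^'n \<Rightarrow> real^'n \<Rightarrow> real^'n^'n"
  assumes R_linear2: "linear (R X)"
    and R_anti: "R X Y = - R Y X"
    and R_skew: "skew_endo G (R X Y)"
    and R_bianchi: "R X Y *v Z + R Y Z *v X + R Z X *v Y = 0"
begin

abbreviation Rf :: "real^'n^'n \<Rightarrow> real^'n^'n" where "Rf \<equiv> form_op G R"
abbreviation Ric :: "real^'n \<Rightarrow> real^'n \<Rightarrow> real" where "Ric \<equiv> ric_of R"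

lemma R_linear1: "linear (\<lambda>X. R X Y)"
proof -
  have "(\<lambda>X. R X Y) = (\<lambda>X. - R Y X)" using R_anti by blast
  then show ?thesis using linear_compose_neg[OF R_linear2] by simp
qed

lemmas R_lin = linear_add[OF R_linear1] linear_add[OF R_linear2] linear_diff[OF R_linear1]
  linear_diff[OF R_linear2] linear_scale[OF R_linear1] linear_scale[OF R_linear2]
  linear_neg[OF R_linear1] linear_neg[OF R_linear2]

lemma linear_R_vec: "linear (\<lambda>Z. R X Z *v Y)" "linear (\<lambda>Z. R Z X *v Y)"
  by (auto intro!: linearI simp: R_lin mv_simps)

lemma R_pair: "ip G (R X Y *v Z) W = ip G (R Z W *v X) Y"
proof -
  have b: "ip G (R X Y *v Z) W + ip G (R Y Z *v X) W + ip G (R Z X *v Y) W = 0" for X Y Z W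
    using arg_cong[OF R_bianchi[of X Y Z], of "\<lambda>V. ip G V W"] by (simp add: ip_simps)
  have s: "ip G (R X Y *v Z) W = - ip G (R X Y *v W) Z" for X Y Z W
    using R_skew unfolding skew_endo_def by blast
  have a: "ip G (R X Y *v Z) W = - ip G (R Y X *v Z) W" for X Y Z W
    by (subst R_anti) (simp add: ip_minus_left)
  \<comment> \<open>Milnor's octahedron: the four Bianchi identities obtained by cycling the arguments.\<close>
  show ?thesis
    using b[of X Y Z W] b[of Y Z W X] b[of Z W X Y] b[of W X Y Z]
      s[of X Y Z W] s[of Y Z X W] s[of Z X Y W] s[of Y Z W X] s[of Z W X Y] s[of W X Y Z]
      s[of W Y Z X] s[of X Z W Y] s[of Y W X Z]
      a[of W Y Z X] a[of X Z W Y] a[of Z X Y W] a[of W X Y Z] a[of X W Z Y] a[of Y W X Z] a[of Y W Z X]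
      s[of W X Z Y] s[of Z W Y X] s[of X Y W Z] s[of X Z Y W] s[of Y W Z X]
    by linarith
qed

text \<open>Pair symmetry turns the sum over coordinates into a trace; this pairing determines the operator
  and is used in place of its definition from here on.\<close>
lemma ip_Rf: "ip G (Rf \<phi> *v X) Y = - trace (\<phi> ** R X Y) / 2"
proof -
  let ?S = "\<phi> ** matrix_inv G"
  have e: "ip G (R (axis j 1) (axis i 1) *v X) Y = (G ** R X Y) $ i $ j" for i j
  proof -
    have "ip G (R (axis j 1) (axis i 1) *v X) Y = axis i 1 \<bullet> ((G ** R X Y) *v axis j 1)"
      using R_pair[of "axis j 1" "axis i 1" X Y] ip_sym[of "R X Y *v axis j 1" "axis i 1"]
      by (simp add: ip_def matrix_vector_mul_assoc[symmetric])
    then show ?thesis by (simp add: inner_axis' matrix_vector_mul_component inner_axis)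
  qed
  have "ip G (Rf \<phi> *v X) Y = (\<Sum>i\<in>UNIV. \<Sum>j\<in>UNIV. ?S $ i $ j * (G ** R X Y) $ i $ j) / 2"
    by (simp add: form_op_def mv_simps ip_simps ip_sum_apply e)
  also have "(\<Sum>i\<in>UNIV. \<Sum>j\<in>UNIV. ?S $ i $ j * (G ** R X Y) $ i $ j) = trace (?S ** transpose (G ** R X Y))"
    by (simp add: trace_def matrix_matrix_mult_def transpose_def)
  also have "transpose (G ** R X Y) = - (G ** R X Y)"
  proof -
    have "Z \<bullet> ((G ** R X Y) *v W) = Z \<bullet> (- transpose (G ** R X Y) *v W)" for Z W
      using skew_endoD[OF R_skew, of X Y Z W] dot_lmul_matrix[of W "G ** R X Y" Z] ip_eq_inner[of "R X Y *v Z" W]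
      by (simp add: ip_def matrix_vector_mul_assoc[symmetric] inner_commute)
    then have "G ** R X Y = - transpose (G ** R X Y)" by (metis vector_eq_ldot matrix_eq)
    then show ?thesis by (metis minus_minus)
  qed
  also have "?S ** - (G ** R X Y) = - (\<phi> ** R X Y)"
    by (simp add: matrix_eq matrix_vector_mul_assoc[symmetric])
      (simp add: matrix_vector_mul_assoc matrix_mul_assoc[symmetric] G_inv, simp add: matrix_mul_assoc G_inv)
  also have "trace (- (\<phi> ** R X Y)) = - trace (\<phi> ** R X Y)"
    using linear_neg[OF linear_trace] .
  finally show ?thesis .
qed

lemma Rf_skew: "skew_endo G (Rf \<phi>)"
  unfolding skew_endo_def ip_Rf
proof (intro allI)
  fix X Y
  have "\<phi> ** R X Y = - (\<phi> ** R Y X)"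
    by (subst R_anti) (simp add: matrix_eq mv_simps)
  then show "- trace (\<phi> ** R X Y) / 2 = - (- trace (\<phi> ** R Y X) / 2)"
    using linear_neg[OF linear_trace, of "\<phi> ** R Y X"] by simp
qed

lemma Rf_wedge: "Rf (wedge G X Y) = R X Y"
proof (rule ip_endo_eqI)
  fix Z W
  have "ip G (Rf (wedge G X Y) *v Z) W = ip G (R Z W *v X) Y"
    using skew_endoD[OF R_skew, of Z W X Y] skew_endoD[OF R_skew, of Z W Y X]
      ip_sym[of "R Z W *v X" Y] ip_sym[of "R Z W *v Y" X]
    by (simp add: ip_Rf trace_wedge_comp)
  then show "ip G (Rf (wedge G X Y) *v Z) W = ip G (R X Y *v Z) W"
    by (simp add: R_pair[of X Y])
qed

text \<open>The left hand side is skew in \<open>X\<close>, \<open>Y\<close>, since the adjoint of \<open>Z \<mapsto> R\<^sub>X\<^sub>,\<^sub>Z Y\<close> is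
  \<open>Z \<mapsto> R\<^sub>Y\<^sub>,\<^sub>Z X\<close>, and by the Bianchi identity its skew part is the pairing of
  \<open>\<phi>\<close> with \<open>R\<^sub>X\<^sub>,\<^sub>Y\<close>.\<close>
lemma tr_skew_R:
  assumes "skew_endo G \<phi>"
  shows "tr (\<lambda>Z. \<phi> *v (R X Z *v Y)) = - ip G (Rf \<phi> *v X) Y"
proof -
  let ?f = "\<lambda>X Y. tr (\<lambda>Z. \<phi> *v (R X Z *v Y))"
  have "\<phi> *v (R X Z *v Y) = \<phi> *v (R Y Z *v X) + \<phi> *v (R X Y *v Z)" for Z
  proof -
    have "R X Z *v Y = R Y Z *v X + R X Y *v Z"
      using R_bianchi[of X Z Y] R_anti[of Z Y] R_anti[of Y X]
      by (simp add: algebra_simps)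
    then show ?thesis by (simp add: mv_simps)
  qed
  then have 1: "?f X Y = ?f Y X + trace (\<phi> ** R X Y)"
    by (simp add: tr_add tr_matrix[symmetric] matrix_vector_mul_assoc)
  have "?f X Y = tr (\<lambda>Z. - (R Y (\<phi> *v Z) *v X))"
  proof (rule tr_adjoint)
    show "linear (\<lambda>Z. \<phi> *v (R X Z *v Y))" "linear (\<lambda>Z. - (R Y (\<phi> *v Z) *v X))"
      by (auto intro!: linearI simp: R_lin mv_simps algebra_simps)
    show "ip G (\<phi> *v (R X Z *v Y)) W = ip G Z (- (R Y (\<phi> *v W) *v X))" for Z W
      using R_pair[of X Z Y "\<phi> *v W"] by (simp add: skew_endoD[OF assms] ip_simps ip_sym)
  qed
  also have "\<dots> = - tr (\<lambda>Z. R Y (\<phi> *v Z) *v X)" by (rule tr_minus)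
  also have "tr (\<lambda>Z. R Y (\<phi> *v Z) *v X) = ?f Y X"
    by (rule tr_comp_matrix[OF linear_R_vec(1)])
  finally show ?thesis using 1 by (simp add: ip_Rf)
qed

end

text \<open>The curvature of a Kaehler metric at a point commutes with \<open>J\<close> because \<open>J\<close> is parallel.\<close>
locale kaehler_at = curvature_at G R for G :: "real^'n^'n::finite" and R +
  fixes J :: "real^'n^'n"
  assumes JJ: "J ** J = - mat 1"
    and J_isom: "ip G (J *v X) (J *v Y) = ip G X Y"
    and R_J: "R X Y ** J = J ** R X Y"
begin

lemma J_J [simp]: "J *v (J *v X) = - X"
  by (simp add: matrix_vector_mul_assoc JJ)

lemma ip_J_left: "ip G (J *v X) Y = - ip G X (J *v Y)"
  using J_isom[of X "J *v Y"] by (simp add: ip_simps)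

lemma skew_J: "skew_endo G J"
  by (rule skew_endoI) (rule ip_J_left)

lemma R_J_apply: "R X Y *v (J *v Z) = J *v (R X Y *v Z)"
  by (simp add: matrix_vector_mul_assoc R_J)

text \<open>Pair symmetry transports the commutation with \<open>J\<close> from the values of \<open>R\<close> to its arguments.\<close>
lemma R_JJ: "R (J *v X) (J *v Y) = R X Y"
proof (rule ip_endo_eqI)
  show "ip G (R (J *v X) (J *v Y) *v Z) W = ip G (R X Y *v Z) W" for Z W
    by (simp add: R_pair[of "J *v X"] R_J_apply J_isom R_pair[of Z W])
qed

lemma R_J_left: "R (J *v X) Y = - R X (J *v Y)"
proof -
  have "- R (J *v X) Y = R X (J *v Y)" using R_JJ[of X "J *v Y"] by (simp add: R_lin)
  then show ?thesis by (metis minus_minus)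
qed

lemma Rf_J: "Rf \<phi> ** J = J ** Rf \<phi>"
proof (rule ip_endo_eqI)
  fix X Y
  have "\<phi> ** R X (J *v Y) = - (\<phi> ** R (J *v X) Y)"
    by (simp add: R_J_left matrix_eq mv_simps)
  then have "trace (\<phi> ** R X (J *v Y)) = - trace (\<phi> ** R (J *v X) Y)"
    using linear_neg[OF linear_trace] by metis
  then have "ip G (Rf \<phi> *v (J *v X)) Y = - ip G (Rf \<phi> *v X) (J *v Y)"
    by (simp add: ip_Rf)
  then show "ip G ((Rf \<phi> ** J) *v X) Y = ip G ((J ** Rf \<phi>) *v X) Y"
    by (simp add: matrix_vector_mul_assoc[symmetric] ip_J_left)
qed

text \<open>Invariance moves \<open>J\<close> from the argument of \<open>R\<close> in front of it, where \<open>tr_skew_R\<close> applies.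
  So the Ricci form is the image of the Kaehler form under the curvature operator.\<close>
lemma Ric_J: "Ric (J *v X) Y = ip G (Rf J *v X) Y"
proof -
  have "Ric (J *v X) Y = tr (\<lambda>Z. - (R X (J *v Z) *v Y))"
    by (simp add: ric_of_def R_J_left)
  also have "\<dots> = - tr (\<lambda>Z. J *v (R X Z *v Y))"
    by (simp add: tr_minus tr_comp_matrix[OF linear_R_vec(1)])
  finally show ?thesis by (simp add: tr_skew_R[OF skew_J])
qed

lemma Ric_eq: "Ric X Y = - ip G (Rf J *v (J *v X)) Y"
  using Ric_J[of "J *v X" Y] by (simp add: ric_of_def R_lin tr_minus)

lemma J_invariant_commutes: "J_invariant G J \<psi> \<longleftrightarrow> \<psi> ** J = J ** \<psi>"
proof
  assume i: "J_invariant G J \<psi>"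
  show "\<psi> ** J = J ** \<psi>"
  proof (rule ip_endo_eqI)
    fix X Y
    have "ip G (\<psi> *v (J *v X)) (J *v (J *v Y)) = ip G (\<psi> *v X) (J *v Y)"
      using i unfolding J_invariant_def by blast
    then show "ip G ((\<psi> ** J) *v X) Y = ip G ((J ** \<psi>) *v X) Y"
      by (simp add: matrix_vector_mul_assoc[symmetric] ip_J_left ip_simps)
  qed
next
  assume "\<psi> ** J = J ** \<psi>"
  then have "\<psi> *v (J *v X) = J *v (\<psi> *v X)" for X by (simp add: matrix_vector_mul_assoc)
  then show "J_invariant G J \<psi>" by (simp add: J_invariant_def J_isom)
qed

lemma skew_J_acomm:
  assumes "skew_endo G A" "A ** J = J ** A" "skew_endo G B" "B ** J = J ** B"
  shows "skew_endo G (J ** acomm A B)"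
proof -
  have "A *v (J *v X) = J *v (A *v X)" "B *v (J *v X) = J *v (B *v X)" for X
    by (simp_all add: matrix_vector_mul_assoc assms)
  then show ?thesis
    by (intro skew_endoI) (simp add: mv_simps ip_simps ip_J_left skew_endoD[OF assms(1)] skew_endoD[OF assms(3)])
qed

lemma acomm_commutes_J:
  assumes "A ** J = J ** A" "B ** J = J ** B"
  shows "(J ** acomm A B) ** J = J ** (J ** acomm A B)"
proof -
  have "A *v (J *v X) = J *v (A *v X)" "B *v (J *v X) = J *v (B *v X)" for X
    by (simp_all add: matrix_vector_mul_assoc assms)
  then show ?thesis by (simp add: matrix_eq mv_simps)
qed

lemma J_inv_part_eq: "J_inv_part G J \<psi> = (1/2) *\<^sub>R (\<psi> - J ** \<psi> ** J)"
proof (rule ip_endo_eqI)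
  fix X Y
  have "ip G (J_inv_part G J \<psi> *v X) Y = (ip G (\<psi> *v X) Y + ip G (\<psi> *v (J *v X)) (J *v Y)) / 2"
    unfolding J_inv_part_def
    by (rule ip_endo_of_form) (auto intro!: linearI simp: mv_simps ip_simps field_simps)
  then show "ip G (J_inv_part G J \<psi> *v X) Y = ip G ((1/2) *\<^sub>R (\<psi> - J ** \<psi> ** J) *v X) Y"
    by (simp add: mv_simps ip_simps ip_J_left)
qed

text \<open>Twice the \<open>J\<close>-invariant part of \<open>X \<and> Y\<close>, as in the equation of a hamiltonian form.\<close>
abbreviation hwedge :: "real^'n \<Rightarrow> real^'n \<Rightarrow> real^'n^'n" where
  "hwedge X Y \<equiv> wedge G X Y + wedge G (J *v X) (J *v Y)"

lemma hwedge_apply: "hwedge X Y *v Z = ip G X Z *\<^sub>R Y - ip G Y Z *\<^sub>R X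
    + (ip G (J *v X) Z *\<^sub>R (J *v Y) - ip G (J *v Y) Z *\<^sub>R (J *v X))"
  by (simp add: mv_simps wedge_apply)

lemma hwedge_J: "hwedge X Y ** J = J ** hwedge X Y"
  by (simp add: matrix_eq matrix_vector_mul_assoc[symmetric] hwedge_apply)
     (simp add: mv_simps ip_simps ip_J_left)

lemma J_inv_part_wedge: "J_inv_part G J (wedge G X Y) = (1/2) *\<^sub>R hwedge X Y"
  by (simp add: J_inv_part_eq matrix_eq mv_simps wedge_apply ip_J_left ip_simps)

lemma J_inv_part_commuting: "\<psi> ** J = J ** \<psi> \<Longrightarrow> J_inv_part G J \<psi> = \<psi>"
proof -
  assume "\<psi> ** J = J ** \<psi>"
  then have "J ** \<psi> ** J = - \<psi>"
    by (simp add: matrix_mul_assoc[symmetric]) (simp add: matrix_mul_assoc JJ matrix_eq mv_simps)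
  then have "\<psi> - J ** \<psi> ** J = 2 *\<^sub>R \<psi>" by (simp only: scaleR_2 diff_minus_eq_add)
  then show ?thesis by (simp add: J_inv_part_eq)
qed

lemma Rf_hwedge: "Rf (hwedge X Y) = 2 *\<^sub>R R X Y"
  by (simp only: form_op_add Rf_wedge R_JJ scaleR_2)

text \<open>Skew endomorphisms act on wedge products as derivations, and those commuting with \<open>J\<close> also on
  their invariant parts.\<close>
lemma comm_hwedge:
  assumes "skew_endo G E" "E ** J = J ** E"
  shows "comm E (hwedge X Y) = hwedge (E *v X) Y + hwedge X (E *v Y)"
proof -
  have EJ: "E *v (J *v Z) = J *v (E *v Z)" for Z
    by (simp add: matrix_vector_mul_assoc assms(2))
  show ?thesis
    by (simp add: matrix_eq mv_simps wedge_apply EJ skew_endoD[OF assms(1)] ip_J_left ip_simps algebra_simps)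
qed

lemma trace_J: "trace J = 0"
proof -
  have "trace J = trace (- J)"
    by (rule trace_adjoint) (simp add: ip_J_left ip_simps)
  then show ?thesis using linear_neg[OF linear_trace, of J] by simp
qed

lemma tr_ip_endo: "tr (\<lambda>Z. ip G (A *v Z) Y *\<^sub>R W) = ip G (A *v W) Y"
proof -
  have "ip G (A *v Z) Y = ((G *v Y) v* A) \<bullet> Z" for Z
    by (metis dot_lmul_matrix ip_def inner_commute)
  then show ?thesis by (simp add: tr_rank_one)
qed

lemma tr_hwedge_right: "tr (\<lambda>Z. hwedge V Z *v Y) = real CARD('n) * ip G V Y"
  using tr_ip_endo[of "mat 1" Y V] tr_ip_endo[of J Y "J *v V"]
  by (simp add: hwedge_apply tr_add tr_diff tr_scaleR tr_ident tr_matrix trace_J ip_simps)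

lemma tr_hwedge_left: "tr (\<lambda>Z. hwedge (S *v Z) X *v Y) =
    ip G (S *v X) Y - trace S * ip G X Y + ip G (J *v (S *v (J *v X))) Y - trace (J ** S) * ip G (J *v X) Y"
  using tr_ip_endo[of S Y X] tr_ip_endo[of "J ** S" Y "J *v X"] tr_matrix[of "J ** S"]
  by (simp add: hwedge_apply tr_add tr_diff tr_scaleR tr_matrix matrix_vector_mul_assoc[symmetric] mult.commute)

text \<open>A trace of the integrability condition that a hamiltonian form satisfies with \<open>S = \<nabla>K\<close>.
  It is formed for a general \<open>S\<close>, because skewness and \<open>J\<close>-linearity will be deduced from it:
  the left hand side is \<open>tr_skew_R\<close> together with the Ricci tensor, the right hand side consists
  of traces of maps of rank one and of multiples of \<open>S\<close>, \<open>J\<close> and the identity.\<close>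
lemma contracted_integrability:
  assumes \<phi>: "skew_endo G \<phi>"
    and int: "\<And>X Y. comm (R X Y) \<phi> = (1/2) *\<^sub>R (hwedge (S *v X) Y - hwedge (S *v Y) X)"
  shows "\<phi> ** Rf J ** J + Rf \<phi> = (1/2) *\<^sub>R (real CARD('n) *\<^sub>R S - S - J ** S ** J
      + trace S *\<^sub>R mat 1 + trace (J ** S) *\<^sub>R J)"
proof (rule ip_endo_eqI)
  fix X Y
  have "tr (\<lambda>Z. comm (R X Z) \<phi> *v Y) = tr (\<lambda>Z. R X Z *v (\<phi> *v Y)) - tr (\<lambda>Z. \<phi> *v (R X Z *v Y))"
    by (simp add: mv_simps tr_diff)
  also have "\<dots> = - ip G (Rf J *v (J *v X)) (\<phi> *v Y) + ip G (Rf \<phi> *v X) Y"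
    using Ric_eq[of X "\<phi> *v Y"] by (simp add: ric_of_def tr_skew_R[OF \<phi>])
  also have "- ip G (Rf J *v (J *v X)) (\<phi> *v Y) = ip G (\<phi> *v (Rf J *v (J *v X))) Y"
    by (simp add: skew_endoD[OF \<phi>])
  finally have 1: "tr (\<lambda>Z. comm (R X Z) \<phi> *v Y) = ip G ((\<phi> ** Rf J ** J + Rf \<phi>) *v X) Y"
    by (simp add: mv_simps ip_simps)
  have "tr (\<lambda>Z. comm (R X Z) \<phi> *v Y)
      = tr (\<lambda>Z. (1/2) *\<^sub>R (hwedge (S *v X) Z *v Y - hwedge (S *v Z) X *v Y))"
    unfolding int by (simp only: mv_simps)
  also have "\<dots> = (1/2) * (tr (\<lambda>Z. hwedge (S *v X) Z *v Y) - tr (\<lambda>Z. hwedge (S *v Z) X *v Y))"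
    by (simp only: tr_scaleR tr_diff)
  finally have 2: "tr (\<lambda>Z. comm (R X Z) \<phi> *v Y)
      = (1/2) * (real CARD('n) * ip G (S *v X) Y - (ip G (S *v X) Y - trace S * ip G X Y
        + ip G (J *v (S *v (J *v X))) Y - trace (J ** S) * ip G (J *v X) Y))"
    unfolding tr_hwedge_right tr_hwedge_left .
  show "ip G ((\<phi> ** Rf J ** J + Rf \<phi>) *v X) Y = ip G ((1/2) *\<^sub>R (real CARD('n) *\<^sub>R S - S - J ** S ** J
      + trace S *\<^sub>R mat 1 + trace (J ** S) *\<^sub>R J) *v X) Y"
    unfolding 1[symmetric] 2 by (simp add: mv_simps ip_simps)
qed

lemma commutes_Rf_apply: "Rf \<psi> *v (J *v X) = J *v (Rf \<psi> *v X)"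
  by (simp add: matrix_vector_mul_assoc Rf_J)

text \<open>The left hand side of the contracted condition commutes with \<open>J\<close>. The \<open>J\<close>-antiinvariant part
  of \<open>S\<close> enters its right hand side with a positive multiple of \<open>n - 2\<close>, so it vanishes
  in real dimension \<open>n\<close> greater than two.\<close>
lemma integrability_J_linear:
  assumes \<phi>: "skew_endo G \<phi>" "\<phi> ** J = J ** \<phi>"
    and int: "\<And>X Y. comm (R X Y) \<phi> = (1/2) *\<^sub>R (hwedge (S *v X) Y - hwedge (S *v Y) X)"
    and S0: "trace S = 0" and dim: "CARD('n) > 2"
  shows "S ** J = J ** S"
proof -
  have \<phi>J: "\<phi> *v (J *v X) = J *v (\<phi> *v X)" for X by (simp add: matrix_vector_mul_assoc \<phi>(2))
  have c: "\<phi> *v (Rf J *v (J *v X)) + Rf \<phi> *v X = (1/2) *\<^sub>R (real CARD('n) *\<^sub>R (S *v X) - S *v X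
      - J *v (S *v (J *v X)) + trace (J ** S) *\<^sub>R (J *v X))" for X
    using arg_cong[OF contracted_integrability[OF \<phi>(1) int], of "\<lambda>A. A *v X"]
    by (simp add: mv_simps S0)
  have comm: "J *v (\<phi> *v (Rf J *v (J *v X)) + Rf \<phi> *v X) = \<phi> *v (Rf J *v (J *v (J *v X))) + Rf \<phi> *v (J *v X)" for X
    by (simp add: mv_simps \<phi>J commutes_Rf_apply)
  have "(real CARD('n) - 2) *\<^sub>R (J *v (S *v X) - S *v (J *v X)) = 0" for X
  proof -
    let ?c = "\<lambda>X. (1/2) *\<^sub>R (real CARD('n) *\<^sub>R (S *v X) - S *v X
      - J *v (S *v (J *v X)) + trace (J ** S) *\<^sub>R (J *v X))"
    have "(real CARD('n) - 2) *\<^sub>R (J *v (S *v X) - S *v (J *v X)) = 2 *\<^sub>R (J *v ?c X - ?c (J *v X))"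
      by (simp add: mv_simps algebra_simps)
    moreover have "J *v ?c X = ?c (J *v X)"
      using comm[of X] unfolding c .
    ultimately show ?thesis by simp
  qed
  then have "J *v (S *v X) - S *v (J *v X) = 0" for X using dim by fastforce
  then show ?thesis by (simp add: matrix_eq matrix_vector_mul_assoc[symmetric])
qed

text \<open>For \<open>S\<close> skew and commuting with \<open>J\<close> the contracted condition can be solved for \<open>S\<close>. Its
  terms other than \<open>\<phi>\<rho>J\<close> are skew, hence so is this one, which means that \<open>\<phi>\<close> commutes
  with the Ricci form \<open>\<rho>\<close> and that \<open>2\<phi>\<rho>J\<close> may be replaced by \<open>J{\<rho>,\<phi>}\<close>.\<close>
lemma integrability_solved:
  assumes \<phi>: "skew_endo G \<phi>" "\<phi> ** J = J ** \<phi>"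
    and int: "\<And>X Y. comm (R X Y) \<phi> = (1/2) *\<^sub>R (hwedge (S *v X) Y - hwedge (S *v Y) X)"
    and S: "skew_endo G S" "S ** J = J ** S"
  shows "real CARD('n) *\<^sub>R S = J ** acomm (Rf J) \<phi> + 2 *\<^sub>R Rf \<phi> - trace (J ** S) *\<^sub>R J"
    and "comm (Rf J) \<phi> = 0"
proof -
  let ?n = "real CARD('n)"
  have \<phi>J: "\<phi> *v (J *v X) = J *v (\<phi> *v X)" for X by (simp add: matrix_vector_mul_assoc \<phi>(2))
  have SJ: "S *v (J *v X) = J *v (S *v X)" for X by (simp add: matrix_vector_mul_assoc S(2))
  have "trace S = trace (- S)"
    by (rule trace_adjoint) (simp add: skew_endoD[OF S(1)] ip_simps)
  then have S0: "trace S = 0" using linear_neg[OF linear_trace, of S] by simp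
  have c: "J *v (\<phi> *v (Rf J *v X)) + Rf \<phi> *v X = (1/2) *\<^sub>R (?n *\<^sub>R (S *v X) + trace (J ** S) *\<^sub>R (J *v X))" for X
    using arg_cong[OF contracted_integrability[OF \<phi>(1) int], of "\<lambda>A. A *v X"]
    by (simp add: mv_simps S0 commutes_Rf_apply \<phi>J SJ)
  have "J *v (\<phi> *v (Rf J *v X)) = ((1/2) *\<^sub>R (?n *\<^sub>R S + trace (J ** S) *\<^sub>R J) - Rf \<phi>) *v X" for X
    using c[of X] by (simp add: mv_simps algebra_simps)
  moreover have "skew_endo G ((1/2) *\<^sub>R (?n *\<^sub>R S + trace (J ** S) *\<^sub>R J) - Rf \<phi>)"
    by (intro skew_diff skew_scaleR skew_add S skew_J Rf_skew)
  ultimately have "ip G (J *v (\<phi> *v (Rf J *v X))) Y = - ip G X (J *v (\<phi> *v (Rf J *v Y)))" for X Y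
    using skew_endoD by metis
  moreover have "ip G (J *v (\<phi> *v (Rf J *v X))) Y = - ip G X (Rf J *v (\<phi> *v (J *v Y)))" for X Y
    by (simp add: ip_J_left skew_endoD[OF \<phi>(1)] skew_endoD[OF Rf_skew] ip_simps)
  ultimately have "ip G X (J *v (\<phi> *v (Rf J *v Y))) = ip G X (J *v (Rf J *v (\<phi> *v Y)))" for X Y
    by (simp add: \<phi>J commutes_Rf_apply)
  then have "J *v (\<phi> *v (Rf J *v Y)) = J *v (Rf J *v (\<phi> *v Y))" for Y
    using ip_eqI ip_sym by metis
  then have "J *v (J *v (\<phi> *v (Rf J *v Y))) = J *v (J *v (Rf J *v (\<phi> *v Y)))" for Y by metis
  then have sw: "\<phi> *v (Rf J *v Y) = Rf J *v (\<phi> *v Y)" for Y by simp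
  then show "comm (Rf J) \<phi> = 0" by (simp add: matrix_eq mv_simps)
  have "?n *\<^sub>R (S *v X) = 2 *\<^sub>R (J *v (\<phi> *v (Rf J *v X)) + Rf \<phi> *v X) - trace (J ** S) *\<^sub>R (J *v X)" for X
    unfolding c by simp
  then show "?n *\<^sub>R S = J ** acomm (Rf J) \<phi> + 2 *\<^sub>R Rf \<phi> - trace (J ** S) *\<^sub>R J"
    by (simp add: matrix_eq mv_simps sw algebra_simps)
qed

end

section \<open>The Levi-Civita connection in a chart\<close>

locale riemannian_chart =
  fixes U :: "(real^'n::finite) set" and g :: "real^'n \<Rightarrow> real^'n^'n"
  assumes open_U [simp]: "open U"
    and smooth_g [simp]: "smooth_on U g"
    and metric: "x \<in> U \<Longrightarrow> metric_at (g x)"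
begin

lemma g_entry_derivative: "x \<in> U \<Longrightarrow> partial i (\<lambda>y. g y $ j $ l) x = pd (axis i 1) g x $ j $ l"
proof -
  assume x: "x \<in> U"
  have "pd (axis i 1) (\<lambda>y. g y $ j $ l) x = pd (axis i 1) (\<lambda>y. g y $ j) x $ l"
    by (rule pd_nth[of U]) (use x in auto)
  also have "pd (axis i 1) (\<lambda>y. g y $ j) x = pd (axis i 1) g x $ j"
    by (rule pd_nth[of U]) (use x in auto)
  finally show ?thesis by (simp add: partial_def)
qed

lemma smooth_matrix_inv_g [simp]: "smooth_on U (\<lambda>x. matrix_inv (g x))"
  using metric metric_at.det_G by (intro smooth_on_matrix_inv) auto

lemma smooth_conn [simp]: "smooth_on U (\<lambda>x. conn_mat g x v)"
proof -
  have p: "smooth_on U (partial i (\<lambda>y. g y $ j $ l))" for i j l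
    unfolding partial_def by auto
  have "smooth_on U (\<lambda>x. christoffel g x k i j)" for k i j
    unfolding christoffel_def
    by (intro smooth_on_divide smooth_on_sum smooth_on_mult smooth_on_add smooth_on_diff)
       (use p in auto)
  then show ?thesis
    unfolding conn_mat_def by (intro smooth_on_vec smooth_on_sum smooth_on_mult) auto
qed

lemma linear_conn: "linear (conn_mat g x)"
  by (auto intro!: linearI simp: conn_mat_def vec_eq_iff distrib_right sum.distrib sum_distrib_left mult.assoc)

lemma conn_basis: "conn_mat g x v = (\<Sum>i\<in>UNIV. v $ i *\<^sub>R conn_mat g x (axis i 1))"
  using arg_cong[OF vec_basis, of "conn_mat g x" v]
  by (simp only: linear_sum[OF linear_conn] linear_scale[OF linear_conn])

lemmas conn_lin = linear_add[OF linear_conn] linear_diff[OF linear_conn] linear_scale[OF linear_conn]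
  linear_0[OF linear_conn] linear_neg[OF linear_conn]

lemma pd_g_symmetric: "x \<in> U \<Longrightarrow> ip (pd v g x) X Y = ip (pd v g x) Y X"
proof -
  assume x: "x \<in> U"
  have "pd v g x = pd v (\<lambda>y. transpose (g y)) x"
    by (rule pd_cong[OF open_U smooth_g x]) (simp add: metric_at.G_transpose[OF metric])
  also have "\<dots> = transpose (pd v g x)" by (rule pd_transpose[OF smooth_g x])
  finally have "X v* pd v g x = pd v g x *v X" using transpose_matrix_vector by metis
  then show ?thesis using dot_lmul_matrix[of X "pd v g x" Y] by (simp add: ip_def inner_commute)
qed

text \<open>The Christoffel symbols are the Koszul formula in coordinates; from here on the connection is
  only used through this formula and its consequences.\<close>
lemma koszul:
  assumes x: "x \<in> U"
  shows "ip (g x) (conn_mat g x v *v w) z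
    = (ip (pd v g x) w z + ip (pd w g x) v z - ip (pd z g x) v w) / 2"
proof -
  interpret metric_at "g x" by (rule metric[OF x])
  let ?D = "\<lambda>i. pd (axis i 1) g x"
  have F: "ip (pd v g x) w z = (\<Sum>i\<in>UNIV. \<Sum>j\<in>UNIV. \<Sum>l\<in>UNIV. v$i * w$j * z$l * ?D i $ j $ l)" for v w z
  proof -
    have "pd v g x = (\<Sum>i\<in>UNIV. v$i *\<^sub>R ?D i)" by (rule pd_basis[OF smooth_g x])
    then have "ip (pd v g x) w z = (\<Sum>i\<in>UNIV. v$i * (w \<bullet> (?D i *v z)))"
      by (simp add: ip_def matrix_vector_sum_left mv_simps inner_sum_right)
    then show ?thesis
      by (simp add: inner_vec_def matrix_vector_mult_def sum_distrib_left mult_ac)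
  qed
  define c where "c l = (\<Sum>i\<in>UNIV. \<Sum>j\<in>UNIV. v$i * w$j * (?D i $ j $ l + ?D j $ i $ l - ?D l $ i $ j))" for l
  have "conn_mat g x v *v w = matrix_inv (g x) *v (\<chi> l. c l / 2)"
  proof -
    let ?t = "\<lambda>k l i j. matrix_inv (g x) $ k $ l * (v$i * w$j * (?D i $ j $ l + ?D j $ i $ l - ?D l $ i $ j)) / 2"
    have "(conn_mat g x v *v w) $ k = (\<Sum>j\<in>UNIV. \<Sum>i\<in>UNIV. \<Sum>l\<in>UNIV. ?t k l i j)" for k
      by (simp add: matrix_vector_mult_def conn_mat_def christoffel_def g_entry_derivative[OF x]
          sum_distrib_left sum_distrib_right sum_divide_distrib mult_ac)
    also have "\<dots> k = (\<Sum>i\<in>UNIV. \<Sum>j\<in>UNIV. \<Sum>l\<in>UNIV. ?t k l i j)" for k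
      by (rule sum.swap)
    also have "\<dots> k = (\<Sum>i\<in>UNIV. \<Sum>l\<in>UNIV. \<Sum>j\<in>UNIV. ?t k l i j)" for k
      by (intro sum.cong refl sum.swap)
    also have "\<dots> k = (\<Sum>l\<in>UNIV. \<Sum>i\<in>UNIV. \<Sum>j\<in>UNIV. ?t k l i j)" for k
      by (rule sum.swap)
    finally show ?thesis
      by (simp add: vec_eq_iff matrix_vector_mult_def c_def sum_distrib_left sum_divide_distrib)
  qed
  then have "ip (g x) (conn_mat g x v *v w) z = (\<chi> l. c l / 2) \<bullet> z"
    using ip_sharp unfolding sharp_def by metis
  also have "\<dots> = (\<Sum>l\<in>UNIV. z$l * c l) / 2"
    by (simp add: inner_vec_def sum_divide_distrib mult.commute)
  also have "(\<Sum>l\<in>UNIV. z$l * c l) = (\<Sum>l\<in>UNIV. \<Sum>i\<in>UNIV. \<Sum>j\<in>UNIV. v$i * w$j * z$l * ?D i $ j $ l)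
      + (\<Sum>l\<in>UNIV. \<Sum>i\<in>UNIV. \<Sum>j\<in>UNIV. v$i * w$j * z$l * ?D j $ i $ l)
      - (\<Sum>l\<in>UNIV. \<Sum>i\<in>UNIV. \<Sum>j\<in>UNIV. v$i * w$j * z$l * ?D l $ i $ j)"
    by (simp add: c_def sum_distrib_left sum.distrib sum_subtractf algebra_simps)
  also have "(\<Sum>l\<in>UNIV. \<Sum>i\<in>UNIV. \<Sum>j\<in>UNIV. v$i * w$j * z$l * ?D i $ j $ l) = ip (pd v g x) w z"
    unfolding F by (subst sum.swap) (intro sum.cong refl sum.swap)
  also have "(\<Sum>l\<in>UNIV. \<Sum>i\<in>UNIV. \<Sum>j\<in>UNIV. v$i * w$j * z$l * ?D j $ i $ l) = ip (pd w g x) v z"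
  proof -
    have "(\<Sum>l\<in>UNIV. \<Sum>i\<in>UNIV. \<Sum>j\<in>UNIV. v$i * w$j * z$l * ?D j $ i $ l)
        = (\<Sum>i\<in>UNIV. \<Sum>l\<in>UNIV. \<Sum>j\<in>UNIV. w$j * v$i * z$l * ?D j $ i $ l)"
      by (subst sum.swap) (simp add: mult_ac)
    also have "\<dots> = (\<Sum>i\<in>UNIV. \<Sum>j\<in>UNIV. \<Sum>l\<in>UNIV. w$j * v$i * z$l * ?D j $ i $ l)"
      by (intro sum.cong refl sum.swap)
    also have "\<dots> = (\<Sum>j\<in>UNIV. \<Sum>i\<in>UNIV. \<Sum>l\<in>UNIV. w$j * v$i * z$l * ?D j $ i $ l)"
      by (rule sum.swap)
    finally show ?thesis unfolding F .
  qed
  also have "(\<Sum>l\<in>UNIV. \<Sum>i\<in>UNIV. \<Sum>j\<in>UNIV. v$i * w$j * z$l * ?D l $ i $ j) = ip (pd z g x) v w"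
    unfolding F by (simp add: mult_ac)
  finally show ?thesis .
qed

lemma torsion_free: "x \<in> U \<Longrightarrow> conn_mat g x v *v w = conn_mat g x w *v v"
proof (rule metric_at.ip_eqI[OF metric[of x]])
  fix z assume x: "x \<in> U"
  show "ip (g x) (conn_mat g x v *v w) z = ip (g x) (conn_mat g x w *v v) z"
    unfolding koszul[OF x] using pd_g_symmetric[OF x, of z v w] by simp
qed

lemma metric_compatible:
  assumes x: "x \<in> U"
  shows "ip (pd v g x) w z = ip (g x) (conn_mat g x v *v w) z + ip (g x) w (conn_mat g x v *v z)"
  using koszul[OF x, of v w z] koszul[OF x, of v z w] pd_g_symmetric[OF x, of v w z]
    pd_g_symmetric[OF x, of w v z] pd_g_symmetric[OF x, of z v w]
    metric_at.ip_sym[OF metric[OF x], of w]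
  by (simp add: field_simps)

text \<open>The difference to the given connection is symmetric by torsion-freeness and skew by
  compatibility with the metric.\<close>
lemma levi_civita_unique:
  assumes x: "x \<in> U"
    and sym: "\<And>v w. B v *v w = B w *v v"
    and met: "\<And>v w z. ip (pd v g x) w z = ip (g x) (B v *v w) z + ip (g x) w (B v *v z)"
  shows "B v = conn_mat g x v"
proof -
  interpret metric_at "g x" by (rule metric[OF x])
  have "skew_endo (g x) (B v - conn_mat g x v)" for v
    using met[of v] metric_compatible[OF x, of v]
    by (intro skew_endoI) (simp add: mv_simps ip_simps, smt (verit))
  moreover have "(B v - conn_mat g x v) *v w = (B w - conn_mat g x w) *v v" for v w
    using sym torsion_free[OF x] by (simp add: mv_simps)
  ultimately have "B v - conn_mat g x v = 0" by (rule symmetric_skew_zero)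
  then show ?thesis by simp
qed

abbreviation nv :: "real^'n \<Rightarrow> (real^'n \<Rightarrow> real^'n) \<Rightarrow> real^'n \<Rightarrow> real^'n" where
  "nv v \<equiv> nabla_vec g (\<lambda>_. v)"
abbreviation ne :: "real^'n \<Rightarrow> (real^'n \<Rightarrow> real^'n^'n) \<Rightarrow> real^'n \<Rightarrow> real^'n^'n" where
  "ne v \<equiv> nabla_endo g (\<lambda>_. v)"

lemma smooth_nv [simp]: "smooth_on U Y \<Longrightarrow> smooth_on U (nv v Y)"
  unfolding nabla_vec_def[abs_def] by auto

lemma smooth_ne [simp]: "smooth_on U T \<Longrightarrow> smooth_on U (ne v T)"
  unfolding nabla_endo_def[abs_def] comm_def by auto

lemma nv_const: "nv v (\<lambda>_. w) x = conn_mat g x v *v w"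
  by (simp add: nabla_vec_def)

lemma nv_cong:
  "x \<in> U \<Longrightarrow> smooth_on U Y \<Longrightarrow> (\<And>y. y \<in> U \<Longrightarrow> Y y = Z y) \<Longrightarrow> nv v Y x = nv v Z x"
  unfolding nabla_vec_def by (subst pd_cong[OF open_U, of Y x Z v]) auto

lemma ne_cong:
  "x \<in> U \<Longrightarrow> smooth_on U S \<Longrightarrow> (\<And>y. y \<in> U \<Longrightarrow> S y = T y) \<Longrightarrow> ne v S x = ne v T x"
  unfolding nabla_endo_def by (subst pd_cong[OF open_U, of S x T v]) auto

lemma nv_add: "x \<in> U \<Longrightarrow> smooth_on U Y \<Longrightarrow> smooth_on U Z \<Longrightarrow> nv v (\<lambda>y. Y y + Z y) x = nv v Y x + nv v Z x"
  by (simp add: nabla_vec_def pd_add[of U] mv_simps)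

lemma nv_diff: "x \<in> U \<Longrightarrow> smooth_on U Y \<Longrightarrow> smooth_on U Z \<Longrightarrow> nv v (\<lambda>y. Y y - Z y) x = nv v Y x - nv v Z x"
  by (simp add: nabla_vec_def pd_diff[of U] mv_simps)

lemma nv_scaleR: "x \<in> U \<Longrightarrow> smooth_on U Y \<Longrightarrow> nv v (\<lambda>y. c *\<^sub>R Y y) x = c *\<^sub>R nv v Y x"
  by (simp add: nabla_vec_def pd_scaleR_const[of U] mv_simps scaleR_add_right)

lemma ne_add: "x \<in> U \<Longrightarrow> smooth_on U S \<Longrightarrow> smooth_on U T \<Longrightarrow> ne v (\<lambda>y. S y + T y) x = ne v S x + ne v T x"
  by (simp add: nabla_endo_def pd_add[of U] matrix_eq mv_simps)

lemma ne_diff: "x \<in> U \<Longrightarrow> smooth_on U S \<Longrightarrow> smooth_on U T \<Longrightarrow> ne v (\<lambda>y. S y - T y) x = ne v S x - ne v T x"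
  by (simp add: nabla_endo_def pd_diff[of U] matrix_eq mv_simps)

lemma ne_scaleR: "x \<in> U \<Longrightarrow> smooth_on U S \<Longrightarrow> ne v (\<lambda>y. c *\<^sub>R S y) x = c *\<^sub>R ne v S x"
  by (simp add: nabla_endo_def pd_scaleR_const[of U] matrix_eq mv_simps scaleR_add_right scaleR_diff_right)

lemma ne_scaleR_fun: "x \<in> U \<Longrightarrow> smooth_on U f \<Longrightarrow> smooth_on U S \<Longrightarrow>
    ne v (\<lambda>y. f y *\<^sub>R S y) x = pd v f x *\<^sub>R S x + f x *\<^sub>R ne v S x"
  by (simp add: nabla_endo_def pd_scaleR[of U] matrix_eq mv_simps algebra_simps)

lemma ne_mult: "x \<in> U \<Longrightarrow> smooth_on U S \<Longrightarrow> smooth_on U T \<Longrightarrow>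
    ne v (\<lambda>y. S y ** T y) x = ne v S x ** T x + S x ** ne v T x"
  by (simp add: nabla_endo_def pd_matrix_mult[of U] matrix_eq mv_simps)

lemma nv_apply: "x \<in> U \<Longrightarrow> smooth_on U S \<Longrightarrow> smooth_on U Y \<Longrightarrow>
    nv v (\<lambda>y. S y *v Y y) x = ne v S x *v Y x + S x *v nv v Y x"
  by (simp add: nabla_endo_def nabla_vec_def pd_matrix_vector_mult[of U] mv_simps)

lemma ne_acomm: "x \<in> U \<Longrightarrow> smooth_on U S \<Longrightarrow> smooth_on U T \<Longrightarrow>
    ne v (\<lambda>y. acomm (S y) (T y)) x = acomm (ne v S x) (T x) + acomm (S x) (ne v T x)"
  by (simp add: acomm_def ne_add ne_mult algebra_simps)

lemma pd_ip:
  assumes "x \<in> U" "smooth_on U Y" "smooth_on U Z"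
  shows "pd v (\<lambda>y. ip (g y) (Y y) (Z y)) x = ip (g x) (nv v Y x) (Z x) + ip (g x) (Y x) (nv v Z x)"
proof -
  have "pd v (\<lambda>y. ip (g y) (Y y) (Z y)) x
      = ip (g x) (pd v Y x) (Z x) + ip (pd v g x) (Y x) (Z x) + ip (g x) (Y x) (pd v Z x)"
    unfolding ip_def using assms
    by (simp add: pd_inner[of U] pd_matrix_vector_mult[of U] inner_simps)
  then show ?thesis using assms(1) by (simp add: metric_compatible nabla_vec_def ip_simps)
qed

lemma smooth_ip [simp]: "smooth_on U Y \<Longrightarrow> smooth_on U Z \<Longrightarrow> smooth_on U (\<lambda>y. ip (g y) (Y y) (Z y))"
  unfolding ip_def by auto

lemma pd_trace_ne: "x \<in> U \<Longrightarrow> smooth_on U T \<Longrightarrow> pd v (\<lambda>y. trace (T y)) x = trace (ne v T x)"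
proof -
  assume a: "x \<in> U" "smooth_on U T"
  have "trace (comm A B) = 0" for A B :: "real^'n^'n"
    by (simp add: comm_def trace_sub trace_mul_sym[of A B])
  then show ?thesis using a by (simp add: nabla_endo_def pd_trace[of U] trace_add)
qed

lemma skew_ne:
  assumes x: "x \<in> U" and T: "smooth_on U T" "\<And>y. y \<in> U \<Longrightarrow> skew_endo (g y) (T y)"
  shows "skew_endo (g x) (ne v T x)"
proof -
  interpret metric_at "g x" by (rule metric[OF x])
  show ?thesis
  proof (rule skew_endoI)
    fix X Y
    have "pd v (\<lambda>y. ip (g y) (T y *v X) Y) x = pd v (\<lambda>y. - ip (g y) X (T y *v Y)) x"
      using T by (intro pd_cong[OF open_U _ x]) (auto simp: metric_at.skew_endoD[OF metric])
    also have "\<dots> = - pd v (\<lambda>y. ip (g y) X (T y *v Y)) x"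
      by (rule pd_minus[OF _ x]) (use T in auto)
    finally have "ip (g x) (nv v (\<lambda>y. T y *v X) x) Y + ip (g x) (T x *v X) (nv v (\<lambda>_. Y) x)
        = - (ip (g x) (nv v (\<lambda>_. X) x) (T x *v Y) + ip (g x) X (nv v (\<lambda>y. T y *v Y) x))"
      using x T by (simp add: pd_ip)
    then show "ip (g x) (ne v T x *v X) Y = - ip (g x) X (ne v T x *v Y)"
      using x T by (simp add: nv_apply ip_simps skew_endoD)
  qed
qed

lemma nv_scaleR_fun: "x \<in> U \<Longrightarrow> smooth_on U f \<Longrightarrow> smooth_on U Y \<Longrightarrow>
    nv v (\<lambda>y. f y *\<^sub>R Y y) x = pd v f x *\<^sub>R Y x + f x *\<^sub>R nv v Y x"
  by (simp add: nabla_vec_def pd_scaleR[of U] mv_simps algebra_simps)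

lemma wedge_apply_on: "x \<in> U \<Longrightarrow> wedge (g x) X Y *v Z = ip (g x) X Z *\<^sub>R Y - ip (g x) Y Z *\<^sub>R X"
  by (rule metric_at.wedge_apply[OF metric])

lemma smooth_wedge [simp]:
  assumes "smooth_on U X" "smooth_on U Y"
  shows "smooth_on U (\<lambda>y. wedge (g y) (X y) (Y y))"
proof (rule smooth_on_matrixI[OF open_U])
  fix w
  have "smooth_on U (\<lambda>y. ip (g y) (X y) w *\<^sub>R Y y - ip (g y) (Y y) w *\<^sub>R X y)" using assms by auto
  then show "smooth_on U (\<lambda>y. wedge (g y) (X y) (Y y) *v w)"
    by (rule smooth_on_cong[OF open_U]) (simp add: wedge_apply_on)
qed

lemma ne_wedge:
  assumes x: "x \<in> U" and s: "smooth_on U X" "smooth_on U Y"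
  shows "ne v (\<lambda>y. wedge (g y) (X y) (Y y)) x = wedge (g x) (nv v X x) (Y x) + wedge (g x) (X x) (nv v Y x)"
proof -
  have "ne v (\<lambda>y. wedge (g y) (X y) (Y y)) x *v w
    = (wedge (g x) (nv v X x) (Y x) + wedge (g x) (X x) (nv v Y x)) *v w" for w
  proof -
    have "ne v (\<lambda>y. wedge (g y) (X y) (Y y)) x *v w + wedge (g x) (X x) (Y x) *v nv v (\<lambda>_. w) x
        = nv v (\<lambda>y. wedge (g y) (X y) (Y y) *v w) x"
      using s by (subst nv_apply[OF x]) auto
    also have "\<dots> = nv v (\<lambda>y. ip (g y) (X y) w *\<^sub>R Y y - ip (g y) (Y y) w *\<^sub>R X y) x"
      using s by (intro nv_cong[OF x]) (auto simp: wedge_apply_on)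
    finally show ?thesis
      using x s by (simp add: nv_diff nv_scaleR_fun pd_ip wedge_apply_on mv_simps algebra_simps)
  qed
  then show ?thesis by (simp add: matrix_eq)
qed

section \<open>Curvature in a chart\<close>

lemma curvature_formula:
  assumes x: "x \<in> U"
  shows "riem g x X Y = - (pd X (\<lambda>y. conn_mat g y Y) x - pd Y (\<lambda>y. conn_mat g y X) x
    + comm (conn_mat g x X) (conn_mat g x Y))"
proof -
  have z: "nabla_vec g (lie_bracket (\<lambda>_. X) (\<lambda>_. Y)) (\<lambda>_. Z) x = 0" for Z
    by (simp add: nabla_vec_def lie_bracket_def conn_lin dir_deriv_eq_pd[of "lie_bracket _ _"])
  have n: "nv X (nv Y (\<lambda>_. Z)) x = (pd X (\<lambda>y. conn_mat g y Y) x + conn_mat g x X ** conn_mat g x Y) *v Z" for X Y Z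
    using x by (simp add: nabla_vec_def[abs_def] pd_matrix_vector_mult[of U] mv_simps)
  have "curv_op (nabla_vec g) (\<lambda>_. X) (\<lambda>_. Y) (\<lambda>_. Z) x = - (pd X (\<lambda>y. conn_mat g y Y) x
      - pd Y (\<lambda>y. conn_mat g y X) x + comm (conn_mat g x X) (conn_mat g x Y)) *v Z" for Z
    by (simp add: curv_op_def z n mv_simps)
  then show ?thesis by (simp add: riem_def)
qed

lemma smooth_riem [simp]: "smooth_on U (\<lambda>x. riem g x X Y)"
proof -
  have "smooth_on U (\<lambda>x. - (pd X (\<lambda>y. conn_mat g y Y) x - pd Y (\<lambda>y. conn_mat g y X) x
    + comm (conn_mat g x X) (conn_mat g x Y)))" unfolding comm_def by auto
  then show ?thesis by (rule smooth_on_cong[OF open_U]) (simp add: curvature_formula)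
qed

lemma ricci_identity_vec:
  assumes x: "x \<in> U" and Z: "smooth_on U Z"
  shows "nv X (nv Y Z) x - nv Y (nv X Z) x = - (riem g x X Y *v Z x)"
  using x Z pd_commute[OF open_U Z x, of X Y]
  by (simp add: curvature_formula nabla_vec_def[abs_def] pd_add[of U] pd_matrix_vector_mult[of U] mv_simps)

lemma pd_comm: "x \<in> U \<Longrightarrow> smooth_on U S \<Longrightarrow> smooth_on U T \<Longrightarrow>
    pd v (\<lambda>y. comm (S y) (T y)) x = comm (pd v S x) (T x) + comm (S x) (pd v T x)"
  unfolding comm_def by (simp add: pd_diff[of U] pd_matrix_mult[of U])

lemma smooth_comm [simp]: "smooth_on U S \<Longrightarrow> smooth_on U T \<Longrightarrow> smooth_on U (\<lambda>y. comm (S y) (T y :: real^'n^'n))"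
  unfolding comm_def by auto

lemma smooth_acomm [simp]: "smooth_on U S \<Longrightarrow> smooth_on U T \<Longrightarrow> smooth_on U (\<lambda>y. acomm (S y) (T y :: real^'n^'n))"
  unfolding acomm_def by auto

lemma ricci_identity_endo:
  assumes x: "x \<in> U" and T: "smooth_on U T"
  shows "ne X (ne Y T) x - ne Y (ne X T) x = - comm (riem g x X Y) (T x)"
  using x T pd_commute[OF open_U T x, of X Y]
  by (simp add: curvature_formula nabla_endo_def[abs_def] pd_add[of U] pd_comm)
    (simp add: matrix_eq mv_simps algebra_simps)

text \<open>Skewness is the Ricci identity for the functions \<open>g(V,W)\<close> with constant \<open>V\<close>, \<open>W\<close>, whose
  second derivatives commute; the first Bianchi identity is torsion-freeness, used under a further
  derivative.\<close>
lemma curvature_at_chart: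
  assumes x: "x \<in> U"
  shows "curvature_at (g x) (riem g x)"
proof -
  interpret metric_at "g x" by (rule metric[OF x])
  show ?thesis
  proof (intro curvature_at.intro curvature_at_axioms.intro metric[OF x])
    fix X Y Z :: "real^'n"
    show "linear (riem g x X)"
    proof (rule linearI)
      have p: "linear (\<lambda>v. pd v (\<lambda>y. conn_mat g y X) x)" by (rule linear_pd[OF smooth_conn x])
      show "riem g x X (v + w) = riem g x X v + riem g x X w" for v w
        using x by (simp add: curvature_formula conn_lin pd_add[of U] linear_add[OF p] matrix_eq mv_simps)
      show "riem g x X (c *\<^sub>R v) = c *\<^sub>R riem g x X v" for c v
        using x by (simp add: curvature_formula conn_lin pd_scaleR_const[of U] linear_scale[OF p]
            matrix_eq mv_simps algebra_simps)
    qed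
    show "riem g x X Y = - riem g x Y X"
      using x by (simp add: curvature_formula matrix_eq mv_simps)
    show "skew_endo (g x) (riem g x X Y)"
    proof (rule skew_endoI)
      fix V W
      let ?f = "\<lambda>y. ip (g y) V W"
      have c: "pd X (pd Y ?f) x = ip (g x) (nv X (nv Y (\<lambda>_. V)) x) W + ip (g x) (nv Y (\<lambda>_. V) x) (nv X (\<lambda>_. W) x)
          + ip (g x) (nv X (\<lambda>_. V) x) (nv Y (\<lambda>_. W) x) + ip (g x) V (nv X (nv Y (\<lambda>_. W)) x)" for X Y
      proof -
        have "pd X (pd Y ?f) x = pd X (\<lambda>y. ip (g y) (nv Y (\<lambda>_. V) y) W + ip (g y) V (nv Y (\<lambda>_. W) y)) x"
          by (rule pd_cong[OF open_U _ x]) (auto simp: pd_ip)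
        then show ?thesis using x by (simp add: pd_add[of U] pd_ip)
      qed
      have "pd X (pd Y ?f) x = pd Y (pd X ?f) x" by (rule pd_commute[OF open_U _ x]) auto
      then have "ip (g x) (nv X (nv Y (\<lambda>_. V)) x - nv Y (nv X (\<lambda>_. V)) x) W
          + ip (g x) V (nv X (nv Y (\<lambda>_. W)) x - nv Y (nv X (\<lambda>_. W)) x) = 0"
        unfolding c by (simp add: ip_simps)
      then show "ip (g x) (riem g x X Y *v V) W = - ip (g x) V (riem g x X Y *v W)"
        using x by (simp add: ricci_identity_vec ip_simps)
    qed
    have s: "nv X (nv Y (\<lambda>_. Z)) x = nv X (nv Z (\<lambda>_. Y)) x" for X Y Z
      by (rule nv_cong[OF x]) (auto simp: nv_const torsion_free)
    have r: "riem g x X Y *v Z = nv Y (nv X (\<lambda>_. Z)) x - nv X (nv Y (\<lambda>_. Z)) x" for X Y Z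
      using ricci_identity_vec[OF x, of "\<lambda>_. Z" X Y] by (simp add: algebra_simps)
    show "riem g x X Y *v Z + riem g x Y Z *v X + riem g x Z X *v Y = 0"
      unfolding r s[of X Z Y] s[of Y X Z] s[of Z Y X] by simp
  qed
qed

text \<open>The second Bianchi identity is the Jacobi identity for the operators \<open>\<nabla>\<^sub>X\<close>,
  \<open>\<nabla>\<^sub>Y\<close>, \<open>\<nabla>\<^sub>Z\<close> along commuting coordinate directions.\<close>
lemma second_bianchi:
  assumes x: "x \<in> U"
  shows "ne X (\<lambda>y. riem g y Y Z) x + ne Y (\<lambda>y. riem g y Z X) x + ne Z (\<lambda>y. riem g y X Y) x = 0"
proof -
  have "ne X (\<lambda>y. riem g y Y Z) x *v V + ne Y (\<lambda>y. riem g y Z X) x *v V + ne Z (\<lambda>y. riem g y X Y) x *v V = 0" for V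
  proof -
    let ?V = "\<lambda>_::real^'n. V"
    have b: "riem g y X Y *v W y = nv Y (nv X W) y - nv X (nv Y W) y" if "y \<in> U" "smooth_on U W" for X Y W y
      using ricci_identity_vec[OF that, of X Y] by (simp add: algebra_simps)
    have d: "ne Z (\<lambda>y. riem g y X Y) x *v V
        = nv Z (nv Y (nv X ?V)) x - nv Z (nv X (nv Y ?V)) x - (nv Y (nv X (nv Z ?V)) x - nv X (nv Y (nv Z ?V)) x)" for X Y Z
    proof -
      have "ne Z (\<lambda>y. riem g y X Y) x *v V = nv Z (\<lambda>y. riem g y X Y *v V) x - riem g x X Y *v nv Z ?V x"
        using x by (simp add: nv_apply)
      also have "nv Z (\<lambda>y. riem g y X Y *v V) x = nv Z (\<lambda>y. nv Y (nv X ?V) y - nv X (nv Y ?V) y) x"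
        by (rule nv_cong[OF x]) (auto simp: b[of _ ?V])
      also have "\<dots> = nv Z (nv Y (nv X ?V)) x - nv Z (nv X (nv Y ?V)) x"
        using x by (simp add: nv_diff)
      also have "riem g x X Y *v nv Z ?V x = nv Y (nv X (nv Z ?V)) x - nv X (nv Y (nv Z ?V)) x"
        by (rule b[OF x]) auto
      finally show ?thesis .
    qed
    show ?thesis unfolding d by simp
  qed
  then show ?thesis by (simp add: matrix_eq mv_simps)
qed

lemma riem_form_eq: "riem_form g x \<psi> = form_op (g x) (riem g x) \<psi>"
  by (simp add: riem_form_def form_op_def)

lemma smooth_riem_form [simp]:
  assumes "smooth_on U T"
  shows "smooth_on U (\<lambda>y. riem_form g y (T y))"
proof -
  show ?thesis unfolding riem_form_def
    by (intro smooth_on_scaleR smooth_on_sum smooth_on_nth smooth_on_matrix_mult) (use assms in auto)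
qed

end

section \<open>Kaehler structures in a chart\<close>

locale kaehler_chart = riemannian_chart U g for U :: "(real^'n::finite) set" and g +
  fixes J :: "real^'n \<Rightarrow> real^'n^'n"
  assumes smooth_J [simp]: "smooth_on U J"
    and J_square: "x \<in> U \<Longrightarrow> J x ** J x = - mat 1"
    and J_orthogonal: "x \<in> U \<Longrightarrow> ip (g x) (J x *v X) (J x *v Y) = ip (g x) X Y"
    and J_parallel: "x \<in> U \<Longrightarrow> nabla_endo g (\<lambda>_. X) J x = 0"
begin

lemma kaehler_at_chart:
  assumes x: "x \<in> U"
  shows "kaehler_at (g x) (riem g x) (J x)"
proof -
  interpret curvature_at "g x" "riem g x" by (rule curvature_at_chart[OF x])
  have z: "ne X (ne Y J) x = 0" for X Y
  proof -
    have "ne X (ne Y J) x = ne X (\<lambda>_. 0) x" by (rule ne_cong[OF x]) (auto simp: J_parallel)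
    then show ?thesis by (simp add: nabla_endo_def matrix_eq mv_simps)
  qed
  show ?thesis
  proof
    show "J x ** J x = - mat 1" by (rule J_square[OF x])
    show "ip (g x) (J x *v X) (J x *v Y) = ip (g x) X Y" for X Y by (rule J_orthogonal[OF x])
    show "riem g x X Y ** J x = J x ** riem g x X Y" for X Y
      using ricci_identity_endo[OF x smooth_J, of X Y] by (simp add: z comm_def)
  qed
qed

lemma nv_J: "x \<in> U \<Longrightarrow> smooth_on U Y \<Longrightarrow> nv v (\<lambda>y. J y *v Y y) x = J x *v nv v Y x"
  by (simp add: nv_apply J_parallel)

lemma ricci_form_eq:
  assumes x: "x \<in> U"
  shows "ricci_form g J x = riem_form g x (J x)"
proof -
  interpret kaehler_at "g x" "riem g x" "J x" by (rule kaehler_at_chart[OF x])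
  have "ric g x (J x *v X) Y = ip (g x) (riem_form g x (J x) *v X) Y" for X Y
    using Ric_J[of X Y] by (simp add: ric_def ric_of_def tr_def riem_form_eq)
  then have e: "ricci_form g J x = endo_of_form (g x) (\<lambda>X Y. ip (g x) (riem_form g x (J x) *v X) Y)"
    by (simp add: ricci_form_def)
  show ?thesis unfolding e
    by (intro ip_endo_eqI ip_endo_of_form) (auto intro!: linearI simp: mv_simps ip_simps)
qed

abbreviation \<rho> where "\<rho> \<equiv> ricci_form g J"

lemma smooth_\<rho> [simp]: "smooth_on U \<rho>"
  by (rule smooth_on_cong[OF open_U smooth_riem_form[OF smooth_J]]) (simp add: ricci_form_eq)

lemma \<rho>_skew: "x \<in> U \<Longrightarrow> skew_endo (g x) (\<rho> x)"
  by (simp add: ricci_form_eq riem_form_eq curvature_at.Rf_skew[OF curvature_at_chart])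

lemma \<rho>_J: "x \<in> U \<Longrightarrow> \<rho> x ** J x = J x ** \<rho> x"
  by (simp add: ricci_form_eq riem_form_eq kaehler_at.Rf_J[OF kaehler_at_chart])

lemma ne_commutes_J:
  assumes x: "x \<in> U" and T: "smooth_on U T" "\<And>y. y \<in> U \<Longrightarrow> T y ** J y = J y ** T y"
  shows "ne v T x ** J x = J x ** ne v T x"
proof -
  have "ne v (\<lambda>y. T y ** J y) x = ne v (\<lambda>y. J y ** T y) x"
    using T by (intro ne_cong[OF x]) auto
  then show ?thesis using x T(1) by (simp add: ne_mult J_parallel)
qed

text \<open>As \<open>\<rho>(Y,Z)\<close> is the pairing of the parallel form \<open>J\<close> with \<open>R\<^sub>Y\<^sub>,\<^sub>Z\<close>, this is
  the second Bianchi identity paired with \<open>J\<close>; the connection terms cancel by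
  torsion-freeness.\<close>
lemma \<rho>_closed:
  assumes x: "x \<in> U"
  shows "ip (g x) (ne X \<rho> x *v Y) Z + ip (g x) (ne Y \<rho> x *v Z) X + ip (g x) (ne Z \<rho> x *v X) Y = 0"
proof -
  interpret kaehler_at "g x" "riem g x" "J x" by (rule kaehler_at_chart[OF x])
  have d: "ip (g x) (ne X \<rho> x *v Y) Z = - trace (J x ** ne X (\<lambda>y. riem g y Y Z) x) / 2
      - ip (g x) (\<rho> x *v (conn_mat g x X *v Y)) Z - ip (g x) (\<rho> x *v Y) (conn_mat g x X *v Z)" for X Y Z
  proof -
    have "pd X (\<lambda>y. ip (g y) (\<rho> y *v Y) Z) x = pd X (\<lambda>y. (-1/2) *\<^sub>R trace (J y ** riem g y Y Z)) x"
      by (rule pd_cong[OF open_U _ x])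
        (auto simp: ricci_form_eq riem_form_eq curvature_at.ip_Rf[OF curvature_at_chart])
    also have "\<dots> = (-1/2) * trace (J x ** ne X (\<lambda>y. riem g y Y Z) x)"
    proof -
      have "smooth_on U (\<lambda>y. trace (J y ** riem g y Y Z))" by auto
      from pd_scaleR_const[OF this x, of X "-1/2"] show ?thesis
        using x by (simp only: pd_trace_ne ne_mult J_parallel smooth_on_matrix_mult open_U smooth_J
            smooth_riem) (simp add: matrix_eq)
    qed
    finally show ?thesis
      using x by (simp add: pd_ip nv_apply nv_const ip_simps)
  qed
  have t: "trace (J x ** ne X (\<lambda>y. riem g y Y Z) x) + trace (J x ** ne Y (\<lambda>y. riem g y Z X) x)
      + trace (J x ** ne Z (\<lambda>y. riem g y X Y) x) = 0"
    using second_bianchi[OF x, of X Y Z]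
    by (simp add: trace_add[symmetric] matrix_add_ldistrib[symmetric] linear_0[OF linear_trace])
  have s: "ip (g x) (\<rho> x *v V) W = - ip (g x) (\<rho> x *v W) V" for V W
    using \<rho>_skew[OF x] unfolding skew_endo_def by blast
  show ?thesis
    unfolding d using t s[of "conn_mat g x X *v Y" Z] s[of "conn_mat g x Y *v Z" X] s[of "conn_mat g x Z *v X" Y]
      torsion_free[OF x, of X Y] torsion_free[OF x, of Y Z] torsion_free[OF x, of Z X]
    by (simp add: field_simps)
qed

end

section \<open>Gradients, Hessians and the Laplacian\<close>

context riemannian_chart
begin

lemma smooth_grad [simp]: "smooth_on U f \<Longrightarrow> smooth_on U (grad g f)"
  unfolding grad_def[abs_def] sharp_def using smooth_on_diff_form[OF open_U] by auto

lemma ip_grad: "x \<in> U \<Longrightarrow> smooth_on U f \<Longrightarrow> ip (g x) (grad g f x) Y = pd Y f x"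
  by (simp add: grad_def metric_at.ip_sharp[OF metric] diff_inner[of U])

lemma linear_nv: "x \<in> U \<Longrightarrow> smooth_on U Y \<Longrightarrow> linear (\<lambda>v. nv v Y x)"
  unfolding nabla_vec_def
  using linear_pd[of U Y x] by (intro linear_compose_add) (auto intro!: linearI simp: conn_lin mv_simps)

lemma cov_diff_apply: "x \<in> U \<Longrightarrow> smooth_on U Y \<Longrightarrow> cov_diff g Y x *v v = nv v Y x"
  unfolding cov_diff_def by (rule linear_matrix_vector[OF linear_nv])

lemma smooth_cov_diff [simp]:
  assumes "smooth_on U Y" shows "smooth_on U (cov_diff g Y)"
  by (rule smooth_on_matrixI[OF open_U], rule smooth_on_cong[OF open_U smooth_nv[OF assms]])
    (simp add: cov_diff_apply assms)

lemma second_derivative_antisym: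
  assumes x: "x \<in> U" and Y: "smooth_on U Y"
  shows "ne v (cov_diff g Y) x *v w - ne w (cov_diff g Y) x *v v = - (riem g x v w *v Y x)"
proof -
  have "nv v (nv w Y) x = ne v (cov_diff g Y) x *v w + cov_diff g Y x *v (conn_mat g x v *v w)" for v w
  proof -
    have "nv v (nv w Y) x = nv v (\<lambda>y. cov_diff g Y y *v w) x"
      by (rule nv_cong[OF x]) (auto simp: Y cov_diff_apply)
    then show ?thesis using x Y by (simp add: nv_apply nv_const)
  qed
  then show ?thesis
    using ricci_identity_vec[OF x Y, of v w] torsion_free[OF x, of v w] by simp
qed

lemma hessian_symmetric:
  assumes x: "x \<in> U" and f: "smooth_on U f"
  shows "ip (g x) (cov_diff g (grad g f) x *v v) w = ip (g x) v (cov_diff g (grad g f) x *v w)"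
proof -
  have "pd v (pd w f) x = ip (g x) (cov_diff g (grad g f) x *v v) w + pd (conn_mat g x v *v w) f x" for v w
  proof -
    have "pd v (pd w f) x = pd v (\<lambda>y. ip (g y) (grad g f y) w) x"
      by (rule pd_cong[OF open_U _ x]) (auto simp: f ip_grad)
    then show ?thesis using x f by (simp add: pd_ip cov_diff_apply nv_const ip_grad)
  qed
  then show ?thesis
    using pd_commute[OF open_U f x, of v w] torsion_free[OF x, of v w]
      metric_at.ip_sym[OF metric[OF x], of v] by (metis add_right_cancel)
qed

lemma laplacian_eq:
  assumes x: "x \<in> U" and f: "smooth_on U f"
  shows "laplacian g f x = - trace (cov_diff g (grad g f) x)"
proof -
  interpret metric_at "g x" by (rule metric[OF x])
  let ?H = "cov_diff g (grad g f) x"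
  have d: "smooth_on U (diff f)" by (rule smooth_on_diff_form[OF open_U f])
  have "hessian g f x $ i $ j = (g x ** ?H) $ i $ j" for i j
  proof -
    have "hessian g f x $ i $ j = nabla_form g (\<lambda>_. axis i 1) (diff f) x \<bullet> axis j 1"
      by (simp add: hessian_def inner_axis)
    also have "\<dots> = pd (axis i 1) (diff f) x \<bullet> axis j 1 - diff f x \<bullet> (conn_mat g x (axis i 1) *v axis j 1)"
      by (simp add: nabla_form_def inner_diff_left dot_lmul_matrix)
    also have "pd (axis i 1) (diff f) x \<bullet> axis j 1 = pd (axis i 1) (\<lambda>y. diff f y \<bullet> axis j 1) x"
      using pd_inner[OF d smooth_on_const x, of "axis i 1" "axis j 1"] by simp
    also have "\<dots> = pd (axis i 1) (\<lambda>y. ip (g y) (grad g f y) (axis j 1)) x"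
      using d f by (intro pd_cong[OF open_U _ x]) (auto simp: ip_grad diff_inner[of U])
    also have "\<dots> = ip (g x) (?H *v axis i 1) (axis j 1) + ip (g x) (grad g f x) (conn_mat g x (axis i 1) *v axis j 1)"
      using x f by (simp add: pd_ip cov_diff_apply nv_const)
    finally have "hessian g f x $ i $ j = ip (g x) (?H *v axis i 1) (axis j 1)"
      using x f by (simp add: ip_grad diff_inner[of U])
    also have "\<dots> = axis i 1 \<bullet> ((g x ** ?H) *v axis j 1)"
      by (simp add: hessian_symmetric[OF x f]) (simp add: ip_def matrix_vector_mul_assoc)
    also have "\<dots> = (g x ** ?H) $ i $ j" by (simp add: inner_axis' matrix_vector_mul_component inner_axis)
    finally show ?thesis .
  qed
  then have "hessian g f x = g x ** ?H" by (simp add: vec_eq_iff)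
  then show ?thesis by (simp add: laplacian_def matrix_mul_assoc G_inv)
qed

end

context kaehler_chart
begin

abbreviation hw :: "real^'n \<Rightarrow> real^'n \<Rightarrow> real^'n \<Rightarrow> real^'n^'n" where
  "hw x X Y \<equiv> wedge (g x) X Y + wedge (g x) (J x *v X) (J x *v Y)"

lemma smooth_hw [simp]: "smooth_on U X \<Longrightarrow> smooth_on U Y \<Longrightarrow> smooth_on U (\<lambda>y. hw y (X y) (Y y))"
  by auto

lemma ne_hw: "x \<in> U \<Longrightarrow> smooth_on U X \<Longrightarrow> smooth_on U Y \<Longrightarrow>
    ne v (\<lambda>y. hw y (X y) (Y y)) x = hw x (nv v X x) (Y x) + hw x (X x) (nv v Y x)"
  by (simp add: ne_add ne_wedge nv_J)

lemma sharp_dc: "x \<in> U \<Longrightarrow> sharp (g x) (dc J f x) = J x *v grad g f x"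
proof -
  assume x: "x \<in> U"
  interpret kaehler_at "g x" "riem g x" "J x" by (rule kaehler_at_chart[OF x])
  show ?thesis
    by (rule ip_eqI)
      (simp add: grad_def dc_def J_form_def ip_sharp ip_J_left dot_lmul_matrix inner_minus_left)
qed

end

section \<open>Hamiltonian forms in a chart\<close>

text \<open>The last assumption is the extra requirement on surfaces; \<open>\<tau>\<close> below is the trace of
  \<open>\<phi>\<close>, while \<open>\<sigma>\<close> is whatever potential the definition of a hamiltonian form provides.\<close>
locale hamiltonian_chart = kaehler_chart U g J for U :: "(real^'n::finite) set" and g J +
  fixes \<phi> :: "real^'n \<Rightarrow> real^'n^'n" and \<sigma> :: "real^'n \<Rightarrow> real"
  assumes smooth_\<phi> [simp]: "smooth_on U \<phi>" and smooth_\<sigma> [simp]: "smooth_on U \<sigma>"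
    and skew_\<phi>: "x \<in> U \<Longrightarrow> skew_endo (g x) (\<phi> x)"
    and \<phi>_J: "x \<in> U \<Longrightarrow> \<phi> x ** J x = J x ** \<phi> x"
    and ham: "x \<in> U \<Longrightarrow> nabla_endo g (\<lambda>_. X) \<phi> x =
           (1/2) *\<^sub>R (wedge (g x) (sharp (g x) (diff \<sigma> x)) (J x *v X)
                    - wedge (g x) (sharp (g x) (dc J \<sigma> x)) X)"
    and killing_surface: "CARD('n) = 2 \<Longrightarrow> x \<in> U \<Longrightarrow> lie_metric g (\<lambda>y. J y *v grad g \<sigma> y) X Y x = 0"
begin

definition \<tau> where "\<tau> x = form_tr (J x) (\<phi> x)"
definition K where "K x = J x *v grad g \<tau> x"
abbreviation S where "S \<equiv> cov_diff g K"

lemma smooth_\<tau> [simp]: "smooth_on U \<tau>"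
proof -
  have "smooth_on U (\<lambda>x. (-1/2) *\<^sub>R trace (\<phi> x ** J x))"
    by (intro smooth_on_scaleR smooth_on_trace smooth_on_matrix_mult) auto
  then show ?thesis
    by (rule smooth_on_cong[OF open_U]) (simp add: \<tau>_def form_tr_def form_inner_def)
qed

lemma smooth_K [simp]: "smooth_on U K"
  unfolding K_def[abs_def] by auto

lemma ne_\<phi>_\<sigma>: "x \<in> U \<Longrightarrow> ne X \<phi> x = (1/2) *\<^sub>R (wedge (g x) (grad g \<sigma> x) (J x *v X) - wedge (g x) (J x *v grad g \<sigma> x) X)"
  by (simp add: ham grad_def[symmetric] sharp_dc)

text \<open>Contracting the equation of a hamiltonian form with \<open>J\<close> shows that \<open>\<sigma>\<close> and the trace of
  \<open>\<phi>\<close> have the same differential, so that either may be used to define \<open>K\<close> and \<open>u\<close>.\<close>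
lemma pd_\<tau>: "x \<in> U \<Longrightarrow> pd X \<tau> x = pd X \<sigma> x"
proof -
  assume x: "x \<in> U"
  interpret kaehler_at "g x" "riem g x" "J x" by (rule kaehler_at_chart[OF x])
  have s: "smooth_on U (\<lambda>y. trace (\<phi> y ** J y))" by auto
  have t: "trace (c *\<^sub>R A) = c * trace A" for c and A :: "real^'n^'n"
    using linear_scale[OF linear_trace, of c A] by simp
  have "pd X \<tau> x = (-1/2) * trace (ne X \<phi> x ** J x)"
  proof -
    have "pd X \<tau> x = pd X (\<lambda>y. (-1/2) *\<^sub>R trace (\<phi> y ** J y)) x"
      by (rule pd_cong[OF open_U smooth_\<tau> x]) (simp add: \<tau>_def form_tr_def form_inner_def)
    also have "\<dots> = (-1/2) *\<^sub>R pd X (\<lambda>y. trace (\<phi> y ** J y)) x"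
      by (rule pd_scaleR_const[OF s x])
    also have "pd X (\<lambda>y. trace (\<phi> y ** J y)) x = trace (ne X \<phi> x ** J x)"
      using x by (simp add: pd_trace_ne ne_mult J_parallel)
    finally show ?thesis by simp
  qed
  also have "ne X \<phi> x ** J x = (1/2) *\<^sub>R (wedge (g x) (grad g \<sigma> x) (J x *v X) ** J x - wedge (g x) (J x *v grad g \<sigma> x) X ** J x)"
    by (simp add: ne_\<phi>_\<sigma>[OF x] matrix_eq mv_simps)
  finally have "pd X \<tau> x = ip (g x) (grad g \<sigma> x) X"
    by (simp add: t trace_sub trace_wedge_comp ip_J_left ip_simps ip_sym[of X])
  then show ?thesis using x by (simp add: ip_grad)
qed

lemma grad_\<tau>: "x \<in> U \<Longrightarrow> grad g \<tau> x = grad g \<sigma> x"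
  by (rule metric_at.ip_eqI[OF metric[of x]]) (auto simp: ip_grad pd_\<tau>)

lemma ne_\<phi>: "x \<in> U \<Longrightarrow> ne X \<phi> x = - ((1/2) *\<^sub>R hw x (K x) X)"
proof -
  assume x: "x \<in> U"
  interpret kaehler_at "g x" "riem g x" "J x" by (rule kaehler_at_chart[OF x])
  show ?thesis
    by (simp add: ne_\<phi>_\<sigma>[OF x] K_def grad_\<tau>[OF x] matrix_eq mv_simps wedge_apply ip_simps algebra_simps)
qed

lemma S_eq: "x \<in> U \<Longrightarrow> S x = J x ** cov_diff g (grad g \<tau>) x"
  by (simp add: matrix_eq cov_diff_apply matrix_vector_mul_assoc[symmetric])
    (simp add: K_def[abs_def] nv_J)

text \<open>The curvature is the commutator of second derivatives of \<open>\<phi>\<close>, and these are first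
  derivatives of \<open>K\<close> because \<open>\<nabla>\<phi>\<close> is algebraic in \<open>K\<close>.\<close>
lemma integrability:
  assumes x: "x \<in> U"
  shows "comm (riem g x X Y) (\<phi> x) = (1/2) *\<^sub>R (hw x (S x *v X) Y - hw x (S x *v Y) X)"
proof -
  interpret kaehler_at "g x" "riem g x" "J x" by (rule kaehler_at_chart[OF x])
  have d: "ne X (ne Y \<phi>) x = (-1/2) *\<^sub>R (hw x (S x *v X) Y + hw x (K x) (conn_mat g x X *v Y))" for X Y
  proof -
    have "ne X (ne Y \<phi>) x = ne X (\<lambda>y. (-1/2) *\<^sub>R hw y (K y) Y) x"
      by (rule ne_cong[OF x]) (auto simp: ne_\<phi>)
    then show ?thesis using x
      by (simp only: ne_scaleR ne_hw smooth_hw smooth_K smooth_on_const nv_const cov_diff_apply)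
  qed
  have "comm (riem g x X Y) (\<phi> x) = ne Y (ne X \<phi>) x - ne X (ne Y \<phi>) x"
    using ricci_identity_endo[OF x smooth_\<phi>, of X Y] by (metis minus_diff_eq minus_minus)
  then show ?thesis unfolding d
    using torsion_free[OF x, of X Y] by (simp add: matrix_eq mv_simps algebra_simps)
qed

text \<open>With the symmetric Hessian \<open>H\<close> one has \<open>S = JH\<close>, so for \<open>S\<close> to be skew is the same as to
  commute with \<open>J\<close>. On a surface the former is the Killing equation; otherwise the latter follows
  from the contracted integrability condition.\<close>
lemma S_J_linear:
  assumes x: "x \<in> U" and dim: "CARD('n) = 2 * m"
  shows "S x ** J x = J x ** S x" and "skew_endo (g x) (S x)"
proof -
  interpret kaehler_at "g x" "riem g x" "J x" by (rule kaehler_at_chart[OF x])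
  let ?H = "cov_diff g (grad g \<tau>) x"
  have H: "ip (g x) (?H *v v) w = ip (g x) v (?H *v w)" for v w
    by (rule hessian_symmetric[OF x smooth_\<tau>])
  have S: "S x *v v = J x *v (?H *v v)" for v
    by (simp add: S_eq[OF x] matrix_vector_mul_assoc)
  have SJ: "S x ** J x = J x ** S x"
  proof (cases "CARD('n) = 2")
    case True
    have k: "lie_metric g K X Y x = 0" for X Y
    proof -
      have e: "dir_deriv (\<lambda>y. J y *v grad g \<sigma> y) f x = dir_deriv K f x" for f :: "real^'n \<Rightarrow> real"
        using grad_\<tau>[OF x] by (simp add: dir_deriv_def K_def)
      have "pd Z K x = pd Z (\<lambda>y. J y *v grad g \<sigma> y) x" for Z
        by (rule pd_cong[OF open_U smooth_K x]) (simp add: K_def grad_\<tau>)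
      then have "lie_bracket K (\<lambda>_. Z) x = lie_bracket (\<lambda>y. J y *v grad g \<sigma> y) (\<lambda>_. Z) x" for Z
        by (simp add: lie_bracket_def dir_deriv_eq_pd[of K] dir_deriv_eq_pd[of "\<lambda>y. J y *v grad g \<sigma> y"])
      then show ?thesis
        using killing_surface[OF True x, of X Y] by (simp add: lie_metric_def e)
    qed
    have br: "lie_bracket K (\<lambda>_. Z) x = conn_mat g x Z *v K x - S x *v Z" for Z
      using x by (simp add: lie_bracket_def dir_deriv_eq_pd[of K] cov_diff_apply nabla_vec_def)
    have "ip (g x) (S x *v X) Y = - ip (g x) X (S x *v Y)" for X Y
      using k[of X Y] x torsion_free[OF x, of "K x"] unfolding lie_metric_def br dir_deriv_eq_pd[of K]
      by (simp add: pd_ip nv_const ip_simps)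
    then have "ip (g x) (J x *v (?H *v v)) w = ip (g x) (?H *v (J x *v v)) w" for v w
      unfolding S by (simp add: H ip_J_left)
    then have "J x *v (?H *v v) = ?H *v (J x *v v)" for v by (rule ip_eqI)
    then show ?thesis by (simp add: matrix_eq matrix_vector_mul_assoc[symmetric] S)
  next
    case False
    have "CARD('n) \<noteq> 0" by simp
    then have gt: "CARD('n) > 2" using dim False by (cases m) auto
    have "trace (S x) = trace (- (?H ** J x))"
      by (rule trace_adjoint) (simp add: S ip_J_left H mv_simps ip_simps)
    also have "\<dots> = - trace (S x)"
      using linear_neg[OF linear_trace, of "?H ** J x"] trace_mul_sym[of ?H "J x"] by (simp add: S_eq[OF x])
    finally have "trace (S x) = 0" by simp
    then show ?thesis
      using integrability_J_linear[OF skew_\<phi>[OF x] \<phi>_J[OF x] integrability[OF x] _ gt] by blast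
  qed
  then show "S x ** J x = J x ** S x" .
  have "J x *v (?H *v (J x *v v)) = J x *v (J x *v (?H *v v))" for v
    using arg_cong[OF SJ, of "\<lambda>A. A *v v"] by (simp add: matrix_vector_mul_assoc[symmetric] S)
  then have "J x *v (J x *v (?H *v (J x *v v))) = J x *v (J x *v (J x *v (?H *v v)))" for v by metis
  then have HJ: "?H *v (J x *v v) = J x *v (?H *v v)" for v by simp
  show "skew_endo (g x) (S x)"
    by (rule skew_endoI) (simp add: S ip_J_left H HJ ip_simps)
qed

definition u where "u x = laplacian g \<tau> x / 2"

lemma u_eq: "x \<in> U \<Longrightarrow> u x = trace (J x ** S x) / 2"
proof -
  assume x: "x \<in> U"
  have "J x ** S x = - cov_diff g (grad g \<tau>) x"
    by (simp add: S_eq[OF x] matrix_mul_assoc J_square[OF x]) (simp add: matrix_eq mv_simps)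
  then show ?thesis
    using linear_neg[OF linear_trace, of "cov_diff g (grad g \<tau>) x"] by (simp add: u_def laplacian_eq[OF x])
qed

lemma smooth_u [simp]: "smooth_on U u"
proof -
  have "smooth_on U (\<lambda>x. (1/2) *\<^sub>R trace (J x ** S x))" by auto
  then show ?thesis by (rule smooth_on_cong[OF open_U]) (simp add: u_eq)
qed

lemma form_equation: "x \<in> U \<Longrightarrow> ne X \<phi> x + (1/2) *\<^sub>R hw x (K x) X = 0"
  by (simp add: ne_\<phi>)

lemma vector_equation:
  assumes x: "x \<in> U" and dim: "CARD('n) = 2 * m"
  shows "S x + (1 / (2 * real m)) *\<^sub>R ((2 * u x) *\<^sub>R J x - J x ** acomm (\<rho> x) (\<phi> x)
    - 2 *\<^sub>R riem_form g x (\<phi> x)) = 0"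
proof -
  interpret kaehler_at "g x" "riem g x" "J x" by (rule kaehler_at_chart[OF x])
  have m: "m \<noteq> 0" using dim zero_less_card_finite[where 'a='n] by auto
  have "(2 * u x) *\<^sub>R J x - J x ** acomm (\<rho> x) (\<phi> x) - 2 *\<^sub>R riem_form g x (\<phi> x) = - (real CARD('n) *\<^sub>R S x)"
    using integrability_solved(1)[OF skew_\<phi>[OF x] \<phi>_J[OF x] integrability[OF x] S_J_linear(2,1)[OF x dim]]
    by (simp add: u_eq[OF x] riem_form_eq ricci_form_eq[OF x])
  then show ?thesis using m dim by simp
qed

text \<open>The difference is skew because \<open>\<nabla>K\<close> is, and symmetric in its two arguments by the Ricci
  identity for \<open>K\<close> and the first Bianchi identity.\<close>
lemma ne_S:
  assumes x: "x \<in> U" and dim: "CARD('n) = 2 * m"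
  shows "ne X S x = riem g x (K x) X"
proof -
  interpret kaehler_at "g x" "riem g x" "J x" by (rule kaehler_at_chart[OF x])
  have "skew_endo (g x) (ne X S x - riem g x (K x) X)" for X
    by (intro skew_diff R_skew skew_ne[OF x]) (auto intro: S_J_linear(2)[OF _ dim])
  moreover have "(ne X S x - riem g x (K x) X) *v Y = (ne Y S x - riem g x (K x) Y) *v X" for X Y
  proof -
    let ?R = "riem g x"
    have "(ne X S x - ?R (K x) X) *v Y - (ne Y S x - ?R (K x) Y) *v X
        = (ne X S x *v Y - ne Y S x *v X) + ?R X Y *v K x
          - (?R (K x) X *v Y + ?R X Y *v K x + ?R Y (K x) *v X)"
      by (simp add: mv_simps R_anti[of Y "K x"])
    also have "\<dots> = 0"
      unfolding second_derivative_antisym[OF x smooth_K] R_bianchi by simp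
    finally show ?thesis by simp
  qed
  ultimately have "ne X S x - riem g x (K x) X = 0" by (rule symmetric_skew_zero)
  then show ?thesis by simp
qed

text \<open>As \<open>2u\<close> is the trace of \<open>J\<nabla>K\<close>, its derivative is the trace of \<open>J R\<^sub>K\<^sub>,\<^sub>X\<close>, which
  is \<open>- 2\<rho>(K,X)\<close> since \<open>\<rho>\<close> is the image of \<open>J\<close> under the curvature operator.\<close>
lemma scalar_equation:
  assumes x: "x \<in> U" and dim: "CARD('n) = 2 * m"
  shows "pd X u x + ip (g x) (\<rho> x *v K x) X = 0"
proof -
  interpret kaehler_at "g x" "riem g x" "J x" by (rule kaehler_at_chart[OF x])
  have s: "smooth_on U (\<lambda>y. trace (J y ** S y))" by auto
  have "pd X u x = pd X (\<lambda>y. (1/2) *\<^sub>R trace (J y ** S y)) x"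
    by (rule pd_cong[OF open_U smooth_u x]) (simp add: u_eq)
  also have "\<dots> = (1/2) * trace (J x ** riem g x (K x) X)"
  proof -
    have "pd X (\<lambda>y. trace (J y ** S y)) x = trace (J x ** riem g x (K x) X)"
      using x by (simp add: pd_trace_ne ne_mult J_parallel ne_S[OF x dim])
    then show ?thesis using pd_scaleR_const[OF s x, of X "1/2"] by simp
  qed
  finally show ?thesis by (simp add: ricci_form_eq[OF x] riem_form_eq ip_Rf)
qed

end

section \<open>The curvature of the covariant derivative on triples\<close>

context kaehler_chart
begin

lemma ne_riem_form: "nabla_endo g (\<lambda>_. X) (\<lambda>y. riem_form g y (T y)) x
    = nabla_riem_form g (\<lambda>_. X) T x + riem_form g x (ne X T x)"
  by (simp add: nabla_riem_form_def)

end

locale triple_chart = kaehler_chart U g J for U :: "(real^'n::finite) set" and g J +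
  fixes \<phi> :: "real^'n \<Rightarrow> real^'n^'n" and K :: "real^'n \<Rightarrow> real^'n" and u :: "real^'n \<Rightarrow> real" and m :: nat
  assumes smooth_\<phi> [simp]: "smooth_on U \<phi>" and smooth_K [simp]: "smooth_on U K"
    and smooth_u [simp]: "smooth_on U u"
    and skew_\<phi>: "x \<in> U \<Longrightarrow> skew_endo (g x) (\<phi> x)"
    and \<phi>_J: "x \<in> U \<Longrightarrow> \<phi> x ** J x = J x ** \<phi> x"
    and dim: "CARD('n) = 2 * m"
begin

lemma m_pos: "m \<noteq> 0"
  using dim zero_less_card_finite[where 'a='n] by auto

text \<open>\<open>P\<close>, \<open>Q\<close> and \<open>r\<close> are the three components of the covariant derivative of the triple
  \<open>(\<phi>, K, u)\<close>, and \<open>E\<close> is the endomorphism in the second of them.\<close>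
definition E where
  "E y = (2 * u y) *\<^sub>R J y - J y ** acomm (\<rho> y) (\<phi> y) - 2 *\<^sub>R riem_form g y (\<phi> y)"
definition P where "P Y y = ne Y \<phi> y + (1/2) *\<^sub>R hw y (K y) Y"
definition Q where "Q Y y = nv Y K y + (1 / (2 * real m)) *\<^sub>R (E y *v Y)"
definition r where "r Y y = pd Y u y + ip (g y) (\<rho> y *v K y) Y"

lemma smooth_E [simp]: "smooth_on U E"
  unfolding E_def[abs_def] by auto

lemma ham_D_triple: "ham_D m g J (\<lambda>_. Y) (\<lambda>y. (\<phi> y, K y, u y)) = (\<lambda>y. (P Y y, Q Y y, r Y y))"
  by (simp add: fun_eq_iff ham_D_def Let_def P_def Q_def r_def E_def)

lemma E_skew: "x \<in> U \<Longrightarrow> skew_endo (g x) (E x)"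
proof -
  assume x: "x \<in> U"
  interpret kaehler_at "g x" "riem g x" "J x" by (rule kaehler_at_chart[OF x])
  show ?thesis unfolding E_def riem_form_eq
    by (intro skew_diff skew_scaleR skew_J Rf_skew skew_J_acomm \<rho>_skew \<rho>_J skew_\<phi> \<phi>_J x)
qed

lemma E_J: "x \<in> U \<Longrightarrow> E x ** J x = J x ** E x"
proof -
  assume x: "x \<in> U"
  interpret kaehler_at "g x" "riem g x" "J x" by (rule kaehler_at_chart[OF x])
  have "E x *v (J x *v V) = J x *v (E x *v V)" for V
    using arg_cong[OF acomm_commutes_J[OF \<rho>_J[OF x] \<phi>_J[OF x]], of "\<lambda>A. A *v V"]
    by (simp add: E_def riem_form_eq mv_simps commutes_Rf_apply)
  then show ?thesis by (simp add: matrix_eq matrix_vector_mul_assoc[symmetric])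
qed

abbreviation triple where "triple \<equiv> \<lambda>y. (\<phi> y, K y, u y)"
abbreviation D where "D X \<equiv> ham_D m g J (\<lambda>_. X)"
abbreviation F where "F X Y x \<equiv> D X (D Y triple) x - D Y (D X triple) x"

text \<open>Up to a factor, \<open>W\<close> is what \<open>E\<close> contributes to commutators with \<open>J\<close>-linear endomorphisms;
  \<open>I1\<close>, \<open>I2\<close> and \<open>I3\<close> are the left hand sides of the three integrability conditions.\<close>
definition W where "W x = riem_form g x (\<phi> x) + (1/2) *\<^sub>R (J x ** acomm (\<rho> x) (\<phi> x))"

lemma E_W: "E x = 2 *\<^sub>R (u x *\<^sub>R J x - W x)"
  by (simp add: E_def W_def matrix_eq mv_simps algebra_simps)

definition I1 where
  "I1 x \<psi> = real m *\<^sub>R comm (riem_form g x \<psi>) (\<phi> x) - comm (W x) (J_inv_part (g x) (J x) \<psi>)"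
definition I2 where
  "I2 x X = (real m + 1) *\<^sub>R riem g x (K x) X
     - ip (g x) (\<rho> x *v K x) X *\<^sub>R J x
     + (1/2) *\<^sub>R (J x ** acomm (\<rho> x) (J_inv_part (g x) (J x) (wedge (g x) (K x) X)))
     - (1/2) *\<^sub>R (J x ** acomm (ne X \<rho> x) (\<phi> x))
     - nabla_riem_form g (\<lambda>_. X) \<phi> x"
definition I3 where
  "I3 x = - (real m *\<^sub>R ne (K x) \<rho> x) + comm (riem_form g x (\<phi> x)) (\<rho> x)"

lemma ham_D_second: "D X (D Y triple) x =
    (ne X (P Y) x + (1/2) *\<^sub>R hw x (Q Y x) X,
     nv X (Q Y) x + (1 / (2 * real m)) *\<^sub>R
       (((2 * r Y x) *\<^sub>R J x - J x ** acomm (\<rho> x) (P Y x) - 2 *\<^sub>R riem_form g x (P Y x)) *v X),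
     pd X (r Y) x + ip (g x) (\<rho> x *v Q Y x) X)"
  by (simp add: ham_D_triple) (simp add: ham_D_def Let_def)

lemma ham_D_zero: "x \<in> U \<Longrightarrow> D 0 triple x = 0"
proof -
  assume x: "x \<in> U"
  have "pd 0 \<phi> x = 0" "pd 0 K x = 0" "pd 0 u x = 0"
    using linear_0[OF linear_pd[OF smooth_\<phi> x]] linear_0[OF linear_pd[OF smooth_K x]]
      linear_0[OF linear_pd[OF smooth_u x]] by auto
  moreover have "wedge (g x) V 0 = 0" for V
    using x by (simp add: matrix_eq wedge_apply_on ip_simps)
  ultimately show ?thesis
    by (simp add: ham_D_def Let_def nabla_endo_def nabla_vec_def conn_lin comm_def ip_simps zero_prod_def)
qed

lemma curv_op_triple:
  assumes x: "x \<in> U"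
  shows "curv_op (ham_D m g J) (\<lambda>_. X) (\<lambda>_. Y) triple x =
    - (F X Y x)"
proof -
  have "lie_bracket (\<lambda>_. X) (\<lambda>_. Y) = (\<lambda>_. 0)" by (simp add: fun_eq_iff lie_bracket_def)
  then show ?thesis by (simp add: curv_op_def ham_D_zero[OF x])
qed

text \<open>The derivatives of \<open>K\<close> in the two second derivatives cancel, and what remains of the wedge
  products is the derivation action of \<open>E\<close> on the invariant part of \<open>X \<and> Y\<close>.\<close>
lemma curvature_form_part:
  assumes x: "x \<in> U"
  shows "- fst (F X Y x)
    = (1 / real m) *\<^sub>R I1 x (wedge (g x) X Y)"
proof -
  interpret kaehler_at "g x" "riem g x" "J x" by (rule kaehler_at_chart[OF x])
  let ?c = "1 / (2 * real m)"
  let ?h = "hw x"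
  have hadd: "?h (V + V') Z = ?h V Z + ?h V' Z" and hsc: "?h (c *\<^sub>R V) Z = c *\<^sub>R ?h V Z"
    and hanti: "?h Z V = - ?h V Z" for V V' Z c
    by (simp_all add: mv_simps wedge_add1 wedge_scaleR1 wedge_anti[of Z] wedge_anti[of "J x *v Z"] scaleR_add_right)
  have nP: "ne X (P Y) x = ne X (ne Y \<phi>) x + (1/2) *\<^sub>R (?h (nv X K x) Y + ?h (K x) (conn_mat g x X *v Y))" for X Y
    unfolding P_def[abs_def] using x
    by (subst ne_add) (auto simp: ne_scaleR ne_hw nv_const simp del: scaleR_right.add)
  have "- fst (F X Y x)
     = - (ne X (P Y) x + (1/2) *\<^sub>R ?h (Q Y x) X - (ne Y (P X) x + (1/2) *\<^sub>R ?h (Q X x) Y))"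
    by (simp only: ham_D_second fst_diff fst_conv)
  also have "\<dots> = - (ne X (ne Y \<phi>) x - ne Y (ne X \<phi>) x)
     + (1/2) *\<^sub>R (?c *\<^sub>R (?h (E x *v X) Y + ?h X (E x *v Y)))"
    unfolding nP Q_def hadd hsc hanti[of X] hanti[of Y "nv X K x"] torsion_free[OF x, of Y X]
    by (simp add: scaleR_add_right scaleR_diff_right hanti[of X "E x *v Y"])
  also have "\<dots> = comm (riem g x X Y) (\<phi> x) + (1/2) *\<^sub>R (?c *\<^sub>R comm (E x) (?h X Y))"
    by (simp only: comm_hwedge[OF E_skew[OF x] E_J[OF x]] ricci_identity_endo[OF x smooth_\<phi>] minus_minus)
  also have "comm (E x) (?h X Y) = - (2 *\<^sub>R comm (W x) (?h X Y))"
  proof -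
    have "?h X Y *v (J x *v V) = J x *v (?h X Y *v V)" for V
      using arg_cong[OF hwedge_J, of "\<lambda>A. A *v V"] by (simp only: matrix_vector_mul_assoc)
    then show ?thesis by (simp add: E_W matrix_eq mv_simps algebra_simps)
  qed
  also have "comm (riem g x X Y) (\<phi> x) + (1/2) *\<^sub>R (?c *\<^sub>R (- (2 *\<^sub>R comm (W x) (?h X Y))))
     = (1 / real m) *\<^sub>R I1 x (wedge (g x) X Y)"
  proof -
    have "comm (W x) ((1/2) *\<^sub>R ?h X Y) = (1/2) *\<^sub>R comm (W x) (?h X Y)"
      by (simp add: comm_def matrix_eq mv_simps algebra_simps)
    then show ?thesis
      using m_pos by (simp only: I1_def riem_form_eq Rf_wedge J_inv_part_wedge)
        (simp add: scaleR_diff_right)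
  qed
  finally show ?thesis .
qed

lemma ne_E:
  assumes x: "x \<in> U"
  shows "ne X E x = (2 * pd X u x) *\<^sub>R J x - J x ** (acomm (ne X \<rho> x) (\<phi> x) + acomm (\<rho> x) (ne X \<phi> x))
    - 2 *\<^sub>R (nabla_riem_form g (\<lambda>_. X) \<phi> x + riem_form g x (ne X \<phi> x))"
proof -
  have u2: "smooth_on U (\<lambda>y. 2 * u y)" by auto
  have "pd X (\<lambda>y. 2 * u y) x = 2 * pd X u x"
    using pd_scaleR_const[OF smooth_u x, of X 2] by simp
  moreover have "smooth_on U (\<lambda>y. (2 * u y) *\<^sub>R J y)" by auto
  ultimately show ?thesis
    unfolding E_def[abs_def] using x u2
    by (simp add: ne_diff ne_scaleR_fun ne_scaleR ne_mult ne_acomm J_parallel ne_riem_form)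
qed

text \<open>In the vector component all first derivatives of the triple cancel. The curvature term
  \<open>R\<^sub>X\<^sub>,\<^sub>Y K\<close> is distributed over the two slots by the first Bianchi identity, which
  leaves an antisymmetrization of \<open>I2\<close>.\<close>
lemma curvature_vector_part:
  assumes x: "x \<in> U"
  shows "- fst (snd (F X Y x))
    = (1 / real m) *\<^sub>R (I2 x Y *v X - I2 x X *v Y)"
proof -
  interpret kaehler_at "g x" "riem g x" "J x" by (rule kaehler_at_chart[OF x])
  let ?c = "1 / (2 * real m)"
  let ?R = "riem g x"
  let ?E' = "\<lambda>Y. (2 * r Y x) *\<^sub>R J x - J x ** acomm (\<rho> x) (P Y x) - 2 *\<^sub>R riem_form g x (P Y x)"
  have nQ: "nv X (Q Y) x = nv X (nv Y K) x + ?c *\<^sub>R (ne X E x *v Y + E x *v (conn_mat g x X *v Y))" for X Y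
    unfolding Q_def[abs_def] using x
    by (subst nv_add) (auto simp: nv_scaleR nv_apply nv_const simp del: scaleR_right.add)
  have rP: "riem_form g x (P X x) = riem_form g x (ne X \<phi> x) + ?R (K x) X" for X
    by (simp add: P_def riem_form_eq form_op_add[of _ _ "ne X \<phi> x"] form_op_scaleR[of _ _ "1/2"] Rf_hwedge
        del: scaleR_right.add)
  have aP: "acomm (\<rho> x) (P X x) = acomm (\<rho> x) (ne X \<phi> x) + acomm (\<rho> x) (J_inv_part (g x) (J x) (wedge (g x) (K x) X))" for X
    by (simp add: P_def J_inv_part_wedge acomm_def matrix_eq mv_simps algebra_simps)
  \<comment> \<open>On the left the endomorphism \<open>E\<close> is formed from the derivative of the triple, and compared
     with the derivative of the one formed from the triple itself.\<close>
  have key: "?E' X - ne X E x = 2 *\<^sub>R (real m *\<^sub>R ?R (K x) X - I2 x X)" for X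
  proof -
    have "(?E' X - ne X E x) *v V = (2 *\<^sub>R (real m *\<^sub>R ?R (K x) X - I2 x X)) *v V" for V
      unfolding ne_E[OF x] rP aP I2_def r_def by (simp add: mv_simps algebra_simps)
    then show ?thesis by (simp add: matrix_eq)
  qed
  have "- fst (snd (F X Y x))
     = - (nv X (Q Y) x + ?c *\<^sub>R (?E' Y *v X) - (nv Y (Q X) x + ?c *\<^sub>R (?E' X *v Y)))"
    by (simp only: ham_D_second fst_diff snd_diff fst_conv snd_conv)
  also have "\<dots> = - (nv X (nv Y K) x - nv Y (nv X K) x)
      + ?c *\<^sub>R ((?E' X - ne X E x) *v Y - (?E' Y - ne Y E x) *v X)"
    unfolding nQ torsion_free[OF x, of Y X]
    by (simp only: scaleR_add_right scaleR_diff_right matrix_vector_mult_diff_rdistrib) simp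
  also have "\<dots> = ?R X Y *v K x + (2 * ?c) *\<^sub>R ((real m *\<^sub>R ?R (K x) X - I2 x X) *v Y
      - (real m *\<^sub>R ?R (K x) Y - I2 x Y) *v X)"
    unfolding key ricci_identity_vec[OF x smooth_K]
    by (simp add: mv_simps algebra_simps)
  also have "\<dots> = (?R X Y *v K x + ?R (K x) X *v Y + ?R Y (K x) *v X) + (1 / real m) *\<^sub>R (I2 x Y *v X - I2 x X *v Y)"
    using m_pos by (simp add: mv_simps R_anti[of Y "K x"] algebra_simps)
  also have "\<dots> = (1 / real m) *\<^sub>R (I2 x Y *v X - I2 x X *v Y)"
    using R_bianchi[of X Y "K x"] by (simp add: algebra_simps)
  finally show ?thesis .
qed

lemma ne_\<rho>_skew: "x \<in> U \<Longrightarrow> skew_endo (g x) (ne X \<rho> x)"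
  by (rule skew_ne) (auto simp: \<rho>_skew)

text \<open>Closedness of \<open>\<rho>\<close> combines the two derivatives of \<open>\<rho>\<close> into \<open>\<nabla>\<^sub>K\<rho>\<close>; the rest is the
  commutator of \<open>\<rho>\<close> with \<open>E\<close>, in which the term in \<open>J{\<rho>,\<phi>}\<close> has no counterpart in the
  third condition.\<close>
lemma curvature_scalar_part:
  assumes x: "x \<in> U"
  shows "- snd (snd (F X Y x))
    = (1 / real m) * ip (g x) ((I3 x + (1/2) *\<^sub>R comm (J x ** acomm (\<rho> x) (\<phi> x)) (\<rho> x)) *v X) Y"
proof -
  interpret kaehler_at "g x" "riem g x" "J x" by (rule kaehler_at_chart[OF x])
  let ?c = "1 / (2 * real m)"
  let ?N = "\<lambda>X. ne X \<rho> x"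
  have dr: "pd X (r Y) x = pd X (pd Y u) x + (ip (g x) (?N X *v K x) Y + ip (g x) (\<rho> x *v nv X K x) Y
      + ip (g x) (\<rho> x *v K x) (conn_mat g x X *v Y))" for X Y
    unfolding r_def[abs_def] using x
    by (subst pd_add[of U]) (auto simp: pd_ip nv_apply nv_const ip_simps)
  have "- snd (snd (F X Y x))
     = - (pd X (r Y) x + ip (g x) (\<rho> x *v Q Y x) X - (pd Y (r X) x + ip (g x) (\<rho> x *v Q X x) Y))"
    by (simp only: ham_D_second snd_diff snd_conv)
  also have "\<dots> = - (ip (g x) (?N X *v K x) Y - ip (g x) (?N Y *v K x) X)
      - ?c * (ip (g x) (\<rho> x *v (E x *v Y)) X - ip (g x) (\<rho> x *v (E x *v X)) Y)"
    unfolding dr Q_def torsion_free[OF x, of Y X] pd_commute[OF open_U smooth_u x, of Y X]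
    by (simp add: mv_simps ip_simps algebra_simps)
  also have "ip (g x) (?N X *v K x) Y - ip (g x) (?N Y *v K x) X = ip (g x) (?N (K x) *v X) Y"
  proof -
    have s: "ip (g x) (?N X *v V) Z = - ip (g x) (?N X *v Z) V" for X V Z
      using ne_\<rho>_skew[OF x] unfolding skew_endo_def by blast
    show ?thesis
      using \<rho>_closed[OF x, of X "K x" Y] s[of Y X "K x"] s[of "K x" X Y] by linarith
  qed
  also have "ip (g x) (\<rho> x *v (E x *v Y)) X = ip (g x) (E x *v (\<rho> x *v X)) Y"
    by (simp add: skew_endoD[OF E_skew[OF x]] skew_endoD[OF \<rho>_skew[OF x]] ip_sym[of Y])
  also have "E x *v (\<rho> x *v X) = \<rho> x *v (E x *v X) - 2 *\<^sub>R (comm (W x) (\<rho> x) *v X)"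
    using arg_cong[OF \<rho>_J[OF x], of "\<lambda>A. A *v X"] by (simp add: E_W mv_simps algebra_simps)
  finally show ?thesis
    using m_pos by (simp add: I3_def W_def mv_simps ip_simps field_simps)
qed

text \<open>The second component yields \<open>I2\<close> only up to a part symmetric in its arguments, and the third
  component contains an extra commutator.\<close>
lemma curv_op_triple_zero_iff:
  assumes x: "x \<in> U"
  shows "(\<forall>X Y. curv_op (ham_D m g J) (\<lambda>_. X) (\<lambda>_. Y) triple x = 0) \<longleftrightarrow>
    (\<forall>X Y. I1 x (wedge (g x) X Y) = 0) \<and> (\<forall>X Y. I2 x X *v Y = I2 x Y *v X) \<and>
    I3 x + (1/2) *\<^sub>R comm (J x ** acomm (\<rho> x) (\<phi> x)) (\<rho> x) = 0"
    (is "?L \<longleftrightarrow> ?A \<and> ?B \<and> ?C = 0")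
proof -
  interpret kaehler_at "g x" "riem g x" "J x" by (rule kaehler_at_chart[OF x])
  have "curv_op (ham_D m g J) (\<lambda>_. X) (\<lambda>_. Y) triple x = 0 \<longleftrightarrow>
    I1 x (wedge (g x) X Y) = 0 \<and> I2 x Y *v X = I2 x X *v Y \<and> ip (g x) (?C *v X) Y = 0" for X Y
  proof -
    have z: "- a = 0 \<longleftrightarrow> - fst a = 0 \<and> - fst (snd a) = 0 \<and> - snd (snd a) = 0" for a :: "'n triple"
      by (simp add: prod_eq_iff)
    show ?thesis
      unfolding curv_op_triple[OF x] z
      unfolding curvature_form_part[OF x] curvature_vector_part[OF x] curvature_scalar_part[OF x]
      using m_pos by simp
  qed
  moreover have "(\<forall>X Y. ip (g x) (?C *v X) Y = 0) \<longleftrightarrow> ?C = 0"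
    using ip_endo_eqI[of ?C 0] by (auto simp: ip_simps)
  moreover have "(\<forall>X Y. I2 x Y *v X = I2 x X *v Y) \<longleftrightarrow> ?B" by metis
  ultimately show ?thesis by (simp only: all_conj_distrib)
qed

lemma I2_skew:
  assumes x: "x \<in> U"
  shows "skew_endo (g x) (I2 x X)"
proof -
  interpret kaehler_at "g x" "riem g x" "J x" by (rule kaehler_at_chart[OF x])
  have R: "skew_endo (g x) (nabla_riem_form g (\<lambda>_. X) \<phi> x)"
    unfolding nabla_riem_form_def riem_form_eq
    by (intro skew_diff skew_ne[OF x] Rf_skew)
      (auto simp: riem_form_eq[symmetric] intro: curvature_at.Rf_skew[OF curvature_at_chart, folded riem_form_eq])
  have h: "skew_endo (g x) (hw x (K x) X)" by (intro skew_add skew_wedge)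
  have "(1/2) *\<^sub>R hw x (K x) X ** J x = J x ** ((1/2) *\<^sub>R hw x (K x) X)"
    using hwedge_J[of "K x" X] by (simp only: scalar_matrix_assoc[symmetric] matrix_scalar_ac)
  then show ?thesis
    unfolding I2_def J_inv_part_wedge
    by (intro skew_diff skew_add skew_scaleR R_skew skew_J R skew_J_acomm \<rho>_skew \<rho>_J x
        skew_\<phi> \<phi>_J h ne_\<rho>_skew ne_commutes_J) auto
qed

lemma I1_linear: "x \<in> U \<Longrightarrow> linear (I1 x)"
proof -
  assume x: "x \<in> U"
  interpret kaehler_at "g x" "riem g x" "J x" by (rule kaehler_at_chart[OF x])
  show ?thesis
    by (rule linearI) (simp_all add: I1_def J_inv_part_eq riem_form_eq form_op_add form_op_scaleR
        matrix_eq mv_simps algebra_simps)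
qed

lemma I1_all_skew:
  assumes x: "x \<in> U" and "\<And>X Y. I1 x (wedge (g x) X Y) = 0" and "skew_endo (g x) \<psi>"
  shows "I1 x \<psi> = 0"
proof -
  interpret kaehler_at "g x" "riem g x" "J x" by (rule kaehler_at_chart[OF x])
  note L = I1_linear[OF x]
  show ?thesis
    by (subst skew_eq_sum_wedge[OF assms(3)]) (simp add: linear_sum[OF L] linear_scale[OF L] assms(2))
qed

text \<open>For the Kaehler form the first condition says that \<open>\<phi>\<close> commutes with the Ricci form; this
  removes the extra term from the scalar part of the curvature.\<close>
lemma I1_J:
  assumes x: "x \<in> U" and "I1 x (J x) = 0"
  shows "comm (J x ** acomm (\<rho> x) (\<phi> x)) (\<rho> x) = 0"
proof -
  interpret kaehler_at "g x" "riem g x" "J x" by (rule kaehler_at_chart[OF x])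
  have \<rho>J: "\<rho> x *v (J x *v V) = J x *v (\<rho> x *v V)" for V
    by (simp add: matrix_vector_mul_assoc \<rho>_J[OF x])
  have \<phi>J: "\<phi> x *v (J x *v V) = J x *v (\<phi> x *v V)" for V
    by (simp add: matrix_vector_mul_assoc \<phi>_J[OF x])
  have WJ: "W x *v (J x *v V) = J x *v (W x *v V)" for V
    by (simp add: W_def mv_simps riem_form_eq commutes_Rf_apply \<rho>J \<phi>J)
  have "comm (W x) (J x) = 0" by (simp add: matrix_eq mv_simps WJ)
  then have "comm (\<rho> x) (\<phi> x) = 0"
    using assms(2) m_pos by (simp add: I1_def J_inv_part_commuting ricci_form_eq[OF x])
  then have "\<rho> x ** \<phi> x = \<phi> x ** \<rho> x" by (simp add: comm_def)
  then have c: "\<rho> x *v (\<phi> x *v V) = \<phi> x *v (\<rho> x *v V)" for V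
    by (simp add: matrix_vector_mul_assoc)
  show ?thesis by (simp add: matrix_eq mv_simps \<rho>J c)
qed

text \<open>The symmetric ambiguity in \<open>I2\<close> disappears because \<open>I2\<close> is skew, and the extra commutator
  because the first condition is also available for \<open>\<psi> = J\<close>.\<close>
lemma integrability_conditions:
  assumes x: "x \<in> U"
  shows "(\<forall>X Y. curv_op (ham_D m g J) (\<lambda>_. X) (\<lambda>_. Y) triple x = 0) \<longleftrightarrow>
    (\<forall>\<psi>. skew_endo (g x) \<psi> \<longrightarrow> I1 x \<psi> = 0) \<and> (\<forall>X. I2 x X = 0) \<and> I3 x = 0"
proof -
  interpret kaehler_at "g x" "riem g x" "J x" by (rule kaehler_at_chart[OF x])
  have 1: "(\<forall>X Y. I1 x (wedge (g x) X Y) = 0) \<longleftrightarrow> (\<forall>\<psi>. skew_endo (g x) \<psi> \<longrightarrow> I1 x \<psi> = 0)"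
    using I1_all_skew[OF x] skew_wedge by blast
  have 2: "(\<forall>X Y. I2 x X *v Y = I2 x Y *v X) \<longleftrightarrow> (\<forall>X. I2 x X = 0)"
  proof
    assume "\<forall>X Y. I2 x X *v Y = I2 x Y *v X"
    then show "\<forall>X. I2 x X = 0"
      by (intro allI symmetric_skew_zero[of "I2 x", OF I2_skew[OF x]]) blast
  qed simp
  have 3: "comm (J x ** acomm (\<rho> x) (\<phi> x)) (\<rho> x) = 0" if "\<forall>\<psi>. skew_endo (g x) \<psi> \<longrightarrow> I1 x \<psi> = 0"
    using that skew_J I1_J[OF x] by blast
  show ?thesis unfolding curv_op_triple_zero_iff[OF x] 1 2 using 3 by auto
qed

end

section \<open>Naturality under a change of charts\<close>

text \<open>Two charts with domains \<open>U\<close>, \<open>U'\<close>, a change of coordinates \<open>\<psi>\<close> defined on the overlap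
  \<open>V\<close>, its Jacobian \<open>B\<close> and the inverse \<open>L\<close> of the latter.\<close>
locale chart_change = c: riemannian_chart U g + d: riemannian_chart U' g'
  for U :: "(real^'n::finite) set" and g and U' :: "(real^'n) set" and g' +
  fixes V :: "(real^'n) set" and \<psi> :: "real^'n \<Rightarrow> real^'n" and B L :: "real^'n \<Rightarrow> real^'n^'n"
  assumes open_V [simp]: "open V" and V_subset: "V \<subseteq> U"
    and smooth_\<psi> [simp]: "smooth_on V \<psi>" and \<psi>_image: "x \<in> V \<Longrightarrow> \<psi> x \<in> U'"
    and pd_\<psi>: "x \<in> V \<Longrightarrow> pd v \<psi> x = B x *v v"
    and LB: "x \<in> V \<Longrightarrow> L x ** B x = mat 1" and BL: "x \<in> V \<Longrightarrow> B x ** L x = mat 1"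
    and g_change: "x \<in> V \<Longrightarrow> transpose (B x) ** g' (\<psi> x) ** B x = g x"
begin

lemma V_U: "x \<in> V \<Longrightarrow> x \<in> U" using V_subset by blast

lemma smooth_V [simp]: "smooth_on U f \<Longrightarrow> smooth_on V f"
  by (rule smooth_on_subset[OF _ V_subset])

lemma smooth_V' [simp]: "smooth_on U' f \<Longrightarrow> smooth_on V (\<lambda>y. f (\<psi> y))"
  by (rule smooth_on_compose[OF open_V smooth_\<psi>]) (use \<psi>_image in auto)

lemma smooth_B [simp]: "smooth_on V B"
  by (rule smooth_on_matrixI[OF open_V], rule smooth_on_cong[OF open_V smooth_on_pd[OF smooth_\<psi>]])
    (simp add: pd_\<psi>)

lemma pd_change: "x \<in> V \<Longrightarrow> smooth_on U' f \<Longrightarrow> pd v (\<lambda>y. f (\<psi> y)) x = pd (B x *v v) f (\<psi> x)"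
  using pd_compose[OF smooth_\<psi> _ _ \<psi>_image] by (simp add: pd_\<psi>)

lemma LB_apply: "x \<in> V \<Longrightarrow> L x *v (B x *v v) = v" and BL_apply: "x \<in> V \<Longrightarrow> B x *v (L x *v v) = v"
  by (simp_all add: matrix_vector_mul_assoc LB BL)

lemma ip_change: "x \<in> V \<Longrightarrow> ip (g' (\<psi> x)) (B x *v v) (B x *v w) = ip (g x) v w"
  using dot_lmul_matrix[of "g' (\<psi> x) *v (B x *v w)" "B x" v]
  by (simp add: g_change[symmetric] ip_def matrix_vector_mul_assoc[symmetric] inner_commute)

lemma ip_change_eqI:
  assumes x: "x \<in> V" and "\<And>Y. ip (g' (\<psi> x)) Z (B x *v Y) = ip (g x) X Y"
  shows "Z = B x *v X"
proof (rule metric_at.ip_eqI[OF d.metric[OF \<psi>_image[OF x]]])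
  show "ip (g' (\<psi> x)) Z W = ip (g' (\<psi> x)) (B x *v X) W" for W
    using assms(2)[of "L x *v W"] ip_change[OF x, of X "L x *v W"] by (simp add: BL_apply[OF x])
qed

text \<open>The connection matrices transform inhomogeneously: the pulled back connection is torsion
  free because second derivatives of \<open>\<psi>\<close> commute, and metric, hence it is the Levi-Civita
  connection.\<close>
lemma connection_change:
  assumes x: "x \<in> V"
  shows "pd v B x = B x ** conn_mat g x v - conn_mat g' (\<psi> x) (B x *v v) ** B x"
proof -
  let ?\<Gamma>' = "conn_mat g' (\<psi> x)"
  let ?C = "\<lambda>v. L x ** (?\<Gamma>' (B x *v v) ** B x + pd v B x)"
  have sym: "pd v B x *v w = pd w B x *v v" for v w
  proof -
    have "pd v B x *v w = pd v (pd w \<psi>) x" for v w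
    proof -
      have "pd v (pd w \<psi>) x = pd v (\<lambda>y. B y *v w) x"
        by (rule pd_cong[OF open_V _ x]) (auto simp: pd_\<psi>)
      then show ?thesis using pd_matrix_vector_mult[OF smooth_B smooth_on_const x] by simp
    qed
    then show ?thesis using pd_commute[OF open_V smooth_\<psi> x, of v w] by simp
  qed
  have "?C v = conn_mat g x v"
  proof (rule c.levi_civita_unique[OF V_U[OF x]])
    show "?C v *v w = ?C w *v v" for v w
      using sym[of v w] d.torsion_free[OF \<psi>_image[OF x], of "B x *v v" "B x *v w"]
      by (simp add: mv_simps)
    fix v w z
    have pB: "pd v (\<lambda>y. B y *v w) x = pd v B x *v w" for w
      using pd_matrix_vector_mult[OF smooth_B smooth_on_const x] by simp
    have "ip (pd v g x) w z = pd v (\<lambda>y. ip (g y) w z) x"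
      using pd_inner[of V "\<lambda>_. w" "\<lambda>y. g y *v z" x v] pd_matrix_vector_mult[of V g "\<lambda>_. z" x v] x
      by (simp add: ip_def)
    also have "\<dots> = pd v (\<lambda>y. (B y *v w) \<bullet> (g' (\<psi> y) *v (B y *v z))) x"
    proof (rule pd_cong[OF open_V _ x])
      show "smooth_on V (\<lambda>y. ip (g y) w z)" unfolding ip_def by auto
      show "ip (g y) w z = (B y *v w) \<bullet> (g' (\<psi> y) *v (B y *v z))" if "y \<in> V" for y
        using ip_change[OF that, of w z] by (simp add: ip_def)
    qed
    also have "\<dots> = (B x *v w) \<bullet> (g' (\<psi> x) *v (pd v B x *v z))
        + (B x *v w) \<bullet> (pd (B x *v v) g' (\<psi> x) *v (B x *v z)) + (pd v B x *v w) \<bullet> (g' (\<psi> x) *v (B x *v z))"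
      using x by (simp add: pd_inner[of V] pd_matrix_vector_mult[of V] pB pd_change inner_add_right)
    also have "(B x *v w) \<bullet> (pd (B x *v v) g' (\<psi> x) *v (B x *v z))
       = ip (g' (\<psi> x)) (?\<Gamma>' (B x *v v) *v (B x *v w)) (B x *v z) + ip (g' (\<psi> x)) (B x *v w) (?\<Gamma>' (B x *v v) *v (B x *v z))"
      using d.metric_compatible[OF \<psi>_image[OF x], of "B x *v v" "B x *v w" "B x *v z"] by (simp add: ip_def)
    finally have "ip (pd v g x) w z = ip (g' (\<psi> x)) (B x *v (?C v *v w)) (B x *v z)
        + ip (g' (\<psi> x)) (B x *v w) (B x *v (?C v *v z))"
      by (simp add: BL_apply[OF x] mv_simps ip_simps) (simp add: ip_def)
    then show "ip (pd v g x) w z = ip (g x) (?C v *v w) z + ip (g x) w (?C v *v z)"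
      by (simp only: ip_change[OF x])
  qed
  then have "B x ** ?C v = B x ** conn_mat g x v" by simp
  then show ?thesis by (simp add: matrix_mul_assoc BL[OF x] algebra_simps)
qed

lemma scalar_change:
  assumes x: "x \<in> V" and "smooth_on U' f'" "smooth_on U f" "\<And>y. y \<in> V \<Longrightarrow> f' (\<psi> y) = f y"
  shows "pd (B x *v v) f' (\<psi> x) = pd v f x"
proof -
  have "pd v (\<lambda>y. f' (\<psi> y)) x = pd v f x"
    using assms by (intro pd_cong[OF open_V _ x]) auto
  then show ?thesis using pd_change[OF x assms(2)] by simp
qed

lemma vector_change:
  assumes x: "x \<in> V" and s: "smooth_on U' Y'" "smooth_on U Y" and ch: "\<And>y. y \<in> V \<Longrightarrow> Y' (\<psi> y) = B y *v Y y"
  shows "nabla_vec g' (\<lambda>_. B x *v v) Y' (\<psi> x) = B x *v nabla_vec g (\<lambda>_. v) Y x"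
proof -
  have "pd (B x *v v) Y' (\<psi> x) = pd v (\<lambda>y. B y *v Y y) x"
    unfolding pd_change[OF x s(1), symmetric] using s by (intro pd_cong[OF open_V _ x]) (auto simp: ch)
  also have "\<dots> = B x *v pd v Y x + pd v B x *v Y x"
    using x s by (simp add: pd_matrix_vector_mult[of V])
  finally show ?thesis
    by (simp add: nabla_vec_def ch[OF x] connection_change[OF x] mv_simps)
qed

text \<open>The inhomogeneous terms of \<open>connection_change\<close> are exactly those that come from
  differentiating \<open>B\<close> in the transformation law of the field.\<close>
lemma endo_change:
  assumes x: "x \<in> V" and s: "smooth_on U' T'" "smooth_on U T" and ch: "\<And>y. y \<in> V \<Longrightarrow> T' (\<psi> y) ** B y = B y ** T y"
  shows "nabla_endo g' (\<lambda>_. B x *v v) T' (\<psi> x) ** B x = B x ** nabla_endo g (\<lambda>_. v) T x"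
proof -
  have "pd v (\<lambda>y. T' (\<psi> y) ** B y) x = pd v (\<lambda>y. B y ** T y) x"
    using s by (intro pd_cong[OF open_V _ x]) (auto simp: ch)
  then have e: "T' (\<psi> x) ** pd v B x + pd (B x *v v) T' (\<psi> x) ** B x = B x ** pd v T x + pd v B x ** T x"
    using x s by (simp add: pd_matrix_mult[of V] pd_change)
  have c: "T' (\<psi> x) *v (B x *v w) = B x *v (T x *v w)" for w
    using ch[OF x] by (simp add: matrix_vector_mul_assoc)
  have "pd (B x *v v) T' (\<psi> x) *v (B x *v w) = B x *v (pd v T x *v w) + pd v B x *v (T x *v w) - T' (\<psi> x) *v (pd v B x *v w)" for w
    using arg_cong[OF e, of "\<lambda>A. A *v w"] by (simp add: mv_simps algebra_simps)
  then show ?thesis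
    by (simp add: matrix_eq nabla_endo_def mv_simps connection_change[OF x] c)
qed

text \<open>Differentiating the transformation law of the connection and antisymmetrizing eliminates
  the third derivatives of \<open>\<psi>\<close>.\<close>
lemma curvature_change:
  assumes x: "x \<in> V"
  shows "riem g' (\<psi> x) (B x *v v) (B x *v w) ** B x = B x ** riem g x v w"
proof -
  let ?\<Gamma> = "conn_mat g x" and ?\<Gamma>' = "conn_mat g' (\<psi> x)"
  let ?d = "\<lambda>w v. pd w (\<lambda>y. conn_mat g y v) x" and ?d' = "\<lambda>w v. pd w (\<lambda>y. conn_mat g' y v) (\<psi> x)"
  have m: "smooth_on V (\<lambda>y. conn_mat g' (\<psi> y) (B y *v v))"
    and pm: "pd w (\<lambda>y. conn_mat g' (\<psi> y) (B y *v v)) x = ?\<Gamma>' (pd w B x *v v) + ?d' (B x *v w) (B x *v v)" for v w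
  proof -
    have s: "smooth_on V (\<lambda>y. (B y *v v) $ i *\<^sub>R conn_mat g' (\<psi> y) (axis i 1))" for i
      by (intro smooth_on_scaleR smooth_on_nth smooth_on_matrix_vector_mult smooth_V'[OF d.smooth_conn]) auto
    have sB: "smooth_on V (\<lambda>y. B y *v v)" by auto
    show "smooth_on V (\<lambda>y. conn_mat g' (\<psi> y) (B y *v v))"
      by (subst d.conn_basis) (intro smooth_on_sum s open_V)
    have pB: "pd w (\<lambda>y. (B y *v v) $ i) x = (pd w B x *v v) $ i" for i
      unfolding pd_nth[OF sB x] using pd_matrix_vector_mult[OF smooth_B smooth_on_const x] by simp
    have "pd w (\<lambda>y. conn_mat g' (\<psi> y) (B y *v v)) x
        = pd w (\<lambda>y. \<Sum>i\<in>UNIV. (B y *v v) $ i *\<^sub>R conn_mat g' (\<psi> y) (axis i 1)) x"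
      by (subst d.conn_basis) (rule refl)
    also have "\<dots> = (\<Sum>i\<in>UNIV. pd w (\<lambda>y. (B y *v v) $ i *\<^sub>R conn_mat g' (\<psi> y) (axis i 1)) x)"
      by (rule pd_sum[OF open_V s x])
    also have "\<dots> = (\<Sum>i\<in>UNIV. (B x *v v) $ i *\<^sub>R ?d' (B x *v w) (axis i 1) + (pd w B x *v v) $ i *\<^sub>R ?\<Gamma>' (axis i 1))"
    proof (rule sum.cong[OF refl])
      fix i
      have "smooth_on V (\<lambda>y. (B y *v v) $ i)" "smooth_on V (\<lambda>y. conn_mat g' (\<psi> y) (axis i 1))"
        by (auto intro: smooth_V'[OF d.smooth_conn])
      from pd_scaleR[OF this x, of w]
      show "pd w (\<lambda>y. (B y *v v) $ i *\<^sub>R conn_mat g' (\<psi> y) (axis i 1)) x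
        = (B x *v v) $ i *\<^sub>R ?d' (B x *v w) (axis i 1) + (pd w B x *v v) $ i *\<^sub>R ?\<Gamma>' (axis i 1)"
        by (simp only: pB pd_change[OF x d.smooth_conn])
    qed
    also have "\<dots> = (\<Sum>i\<in>UNIV. (B x *v v) $ i *\<^sub>R ?d' (B x *v w) (axis i 1)) + ?\<Gamma>' (pd w B x *v v)"
      by (simp only: sum.distrib d.conn_basis[of "\<psi> x" "pd w B x *v v"])
    also have "(\<Sum>i\<in>UNIV. (B x *v v) $ i *\<^sub>R ?d' (B x *v w) (axis i 1)) = ?d' (B x *v w) (B x *v v)"
    proof -
      let ?b = "B x *v v"
      have "?d' (B x *v w) ?b = pd (B x *v w) (\<lambda>y. \<Sum>i\<in>UNIV. ?b $ i *\<^sub>R conn_mat g' y (axis i 1)) (\<psi> x)"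
        by (subst d.conn_basis[of _ ?b]) (rule refl)
      also have "\<dots> = (\<Sum>i\<in>UNIV. pd (B x *v w) (\<lambda>y. ?b $ i *\<^sub>R conn_mat g' y (axis i 1)) (\<psi> x))"
        by (rule pd_sum[OF d.open_U _ \<psi>_image[OF x]]) auto
      also have "\<dots> = (\<Sum>i\<in>UNIV. ?b $ i *\<^sub>R ?d' (B x *v w) (axis i 1))"
        by (simp only: pd_scaleR_const[OF d.smooth_conn \<psi>_image[OF x]])
      finally show ?thesis by simp
    qed
    finally show "pd w (\<lambda>y. conn_mat g' (\<psi> y) (B y *v v)) x = ?\<Gamma>' (pd w B x *v v) + ?d' (B x *v w) (B x *v v)"
      by simp
  qed
  have second: "pd w (pd v B) x = pd w B x ** ?\<Gamma> v + B x ** ?d w v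
      - (?\<Gamma>' (pd w B x *v v) + ?d' (B x *v w) (B x *v v)) ** B x - ?\<Gamma>' (B x *v v) ** pd w B x" for v w
  proof -
    have "pd w (pd v B) x = pd w (\<lambda>y. B y ** conn_mat g y v - conn_mat g' (\<psi> y) (B y *v v) ** B y) x"
      by (rule pd_cong[OF open_V _ x]) (auto simp: connection_change)
    also have "\<dots> = pd w (\<lambda>y. B y ** conn_mat g y v) x - pd w (\<lambda>y. conn_mat g' (\<psi> y) (B y *v v) ** B y) x"
      by (rule pd_diff[OF _ _ x]) (auto simp: m)
    also have "\<dots> = (B x ** ?d w v + pd w B x ** ?\<Gamma> v) - (?\<Gamma>' (B x *v v) ** pd w B x
        + (?\<Gamma>' (pd w B x *v v) + ?d' (B x *v w) (B x *v v)) ** B x)"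
      using x m by (simp add: pd_matrix_mult[of V] pm)
    finally show ?thesis by (simp add: algebra_simps)
  qed
  have sym: "pd w B x *v v = pd v B x *v w"
    by (simp add: connection_change[OF x] mv_simps c.torsion_free[OF V_U[OF x], of w v]
        d.torsion_free[OF \<psi>_image[OF x], of "B x *v w" "B x *v v"])
  have "(pd w (pd v B) x - pd v (pd w B) x) *v z = 0" for z
    using pd_commute[OF open_V smooth_B x, of w v] by simp
  then have "(riem g' (\<psi> x) (B x *v v) (B x *v w) ** B x) *v z = (B x ** riem g x v w) *v z" for z
    unfolding second sym
    by (simp add: c.curvature_formula[OF V_U[OF x]] d.curvature_formula[OF \<psi>_image[OF x]]
        connection_change[OF x, of v] connection_change[OF x, of w] mv_simps algebra_simps)
  then show ?thesis by (simp add: matrix_eq)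
qed

lemma conjugate:
  assumes x: "x \<in> V" and "T' ** B x = B x ** T"
  shows "T' = B x ** T ** L x"
  unfolding assms(2)[symmetric] by (simp add: matrix_mul_assoc[symmetric] BL[OF x])

lemma trace_change:
  assumes x: "x \<in> V" and "T' ** B x = B x ** T"
  shows "trace T' = trace T"
  unfolding conjugate[OF assms] using trace_mul_sym[of "B x ** T" "L x"]
  by (simp add: matrix_mul_assoc LB[OF x])

lemma wedge_change:
  assumes x: "x \<in> V"
  shows "wedge (g' (\<psi> x)) (B x *v X) (B x *v Y) ** B x = B x ** wedge (g x) X Y"
  by (simp add: matrix_eq matrix_vector_mul_assoc[symmetric] d.wedge_apply_on[OF \<psi>_image[OF x]]
      c.wedge_apply_on[OF V_U[OF x]] ip_change[OF x] mv_simps)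

lemma riem_form_change:
  assumes x: "x \<in> V" and T: "T' ** B x = B x ** T"
  shows "riem_form g' (\<psi> x) T' ** B x = B x ** riem_form g x T"
proof -
  have "riem_form g' (\<psi> x) T' *v (B x *v X) = B x *v (riem_form g x T *v X)" for X
  proof (rule ip_change_eqI[OF x])
    fix Y
    have "(T' ** riem g' (\<psi> x) (B x *v X) (B x *v Y)) ** B x = B x ** (T ** riem g x X Y)"
      by (simp add: matrix_mul_assoc[symmetric] curvature_change[OF x]) (simp add: matrix_mul_assoc T)
    then show "ip (g' (\<psi> x)) (riem_form g' (\<psi> x) T' *v (B x *v X)) (B x *v Y) = ip (g x) (riem_form g x T *v X) Y"
      using trace_change[OF x]
      by (simp add: c.riem_form_eq d.riem_form_eq curvature_at.ip_Rf[OF c.curvature_at_chart[OF V_U[OF x]]]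
          curvature_at.ip_Rf[OF d.curvature_at_chart[OF \<psi>_image[OF x]]])
  qed
  then show ?thesis by (simp add: matrix_eq matrix_vector_mul_assoc[symmetric])
qed

lemma grad_change:
  assumes x: "x \<in> V" and s: "smooth_on U' f'" "smooth_on U f" "\<And>y. y \<in> V \<Longrightarrow> f' (\<psi> y) = f y"
  shows "grad g' f' (\<psi> x) = B x *v grad g f x"
  by (rule ip_change_eqI[OF x])
    (simp add: d.ip_grad[OF \<psi>_image[OF x] s(1)] c.ip_grad[OF V_U[OF x] s(2)] scalar_change[OF x s])

lemma laplacian_change:
  assumes x: "x \<in> V" and s: "smooth_on U' f'" "smooth_on U f" "\<And>y. y \<in> V \<Longrightarrow> f' (\<psi> y) = f y"
  shows "laplacian g' f' (\<psi> x) = laplacian g f x"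
proof -
  have "cov_diff g' (grad g' f') (\<psi> x) ** B x = B x ** cov_diff g (grad g f) x"
    using s vector_change[OF x d.smooth_grad[OF s(1)] c.smooth_grad[OF s(2)] grad_change[OF _ s]]
    by (simp add: matrix_eq matrix_vector_mul_assoc[symmetric] d.cov_diff_apply[OF \<psi>_image[OF x]]
        c.cov_diff_apply[OF V_U[OF x]])
  then show ?thesis
    using trace_change[OF x] by (simp add: d.laplacian_eq[OF \<psi>_image[OF x] s(1)] c.laplacian_eq[OF V_U[OF x] s(2)])
qed

end

section \<open>The covariant derivative on triples in a chart\<close>

text \<open>Constant coefficient fields suffice, because the operator is tensorial in the direction.\<close>
lemma ham_D_pointwise: "ham_D m g J X s x = ham_D m g J (\<lambda>_. X x) s x"
  by (simp add: ham_D_def Let_def nabla_endo_def nabla_vec_def dir_deriv_eq_pd[of X])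

context riemannian_chart
begin

lemma linear_ne: "x \<in> U \<Longrightarrow> smooth_on U T \<Longrightarrow> linear (\<lambda>v. ne v T x)"
  unfolding nabla_endo_def
  by (intro linear_compose_add linear_pd[of U]) (auto intro!: linearI simp: conn_lin matrix_eq mv_simps algebra_simps)

lemma smooth_conn_along: "smooth_on U X \<Longrightarrow> smooth_on U (\<lambda>x. conn_mat g x (X x))"
proof -
  assume X: "smooth_on U X"
  have "smooth_on U (\<lambda>x. \<Sum>i\<in>UNIV. X x $ i *\<^sub>R conn_mat g x (axis i 1))"
    using X by (intro smooth_on_sum smooth_on_scaleR smooth_on_nth) auto
  then show ?thesis by (rule smooth_on_cong[OF open_U]) (rule conn_basis[symmetric])
qed

lemma smooth_nabla_vec: "smooth_on U X \<Longrightarrow> smooth_on U Y \<Longrightarrow> smooth_on U (nabla_vec g X Y)"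
  unfolding nabla_vec_def[abs_def]
  by (intro smooth_on_add smooth_on_dir_deriv smooth_on_matrix_vector_mult smooth_conn_along open_U)

lemma smooth_nabla_endo: "smooth_on U X \<Longrightarrow> smooth_on U T \<Longrightarrow> smooth_on U (nabla_endo g X T)"
  unfolding nabla_endo_def[abs_def]
  by (intro smooth_on_add smooth_on_dir_deriv smooth_comm smooth_conn_along open_U)

lemma nabla_endo_pointwise: "nabla_endo g X T x = ne (X x) T x"
  by (simp add: nabla_endo_def dir_deriv_eq_pd[of X])

end

context kaehler_chart
begin

context
  fixes s :: "real^'n \<Rightarrow> 'n triple" and m :: nat
  assumes s: "smooth_on U (\<lambda>y. fst (s y))" "smooth_on U (\<lambda>y. fst (snd (s y)))" "smooth_on U (\<lambda>y. snd (snd (s y)))"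
begin

lemma ham_D_add_direction:
  "x \<in> U \<Longrightarrow> ham_D m g J (\<lambda>y. X y + Y y) s x = ham_D m g J X s x + ham_D m g J Y s x"
proof -
  assume x: "x \<in> U"
  interpret kaehler_at "g x" "riem g x" "J x" by (rule kaehler_at_chart[OF x])
  show ?thesis
    unfolding ham_D_pointwise[of _ _ _ "\<lambda>y. X y + Y y"] ham_D_pointwise[of _ _ _ X] ham_D_pointwise[of _ _ _ Y]
    using linear_add[OF linear_ne[OF x s(1)]] linear_add[OF linear_nv[OF x s(2)]] linear_add[OF linear_pd[OF s(3) x]]
    by (simp add: ham_D_def Let_def wedge_add2 mv_simps ip_simps algebra_simps)
qed

lemma ham_D_scaleR_direction:
  "x \<in> U \<Longrightarrow> ham_D m g J (\<lambda>y. f y *\<^sub>R X y) s x = f x *\<^sub>R ham_D m g J X s x"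
proof -
  assume x: "x \<in> U"
  interpret kaehler_at "g x" "riem g x" "J x" by (rule kaehler_at_chart[OF x])
  show ?thesis
    unfolding ham_D_pointwise[of _ _ _ "\<lambda>y. f y *\<^sub>R X y"] ham_D_pointwise[of _ _ _ X]
    using linear_scale[OF linear_ne[OF x s(1)]] linear_scale[OF linear_nv[OF x s(2)]] linear_scale[OF linear_pd[OF s(3) x]]
    by (simp add: ham_D_def Let_def wedge_scaleR2 mv_simps ip_simps algebra_simps)
qed

lemma ham_D_add:
  assumes x: "x \<in> U"
    and t: "smooth_on U (\<lambda>y. fst (t y))" "smooth_on U (\<lambda>y. fst (snd (t y)))" "smooth_on U (\<lambda>y. snd (snd (t y)))"
  shows "ham_D m g J X (\<lambda>y. s y + t y) x = ham_D m g J X s x + ham_D m g J X t x"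
proof -
  interpret kaehler_at "g x" "riem g x" "J x" by (rule kaehler_at_chart[OF x])
  show ?thesis
    unfolding ham_D_pointwise[of _ _ _ X]
    by (simp add: ham_D_def Let_def ne_add[OF x s(1) t(1)] nv_add[OF x s(2) t(2)] pd_add[OF s(3) t(3) x]
        wedge_add1 riem_form_eq form_op_add mv_simps ip_simps)
      (simp add: matrix_add_ldistrib matrix_add_rdistrib' acomm_def algebra_simps add_divide_distrib)
qed

lemma ham_D_scaleR:
  assumes x: "x \<in> U" and f: "smooth_on U f"
  shows "ham_D m g J X (\<lambda>y. f y *\<^sub>R s y) x = dir_deriv X f x *\<^sub>R s x + f x *\<^sub>R ham_D m g J X s x"
proof -
  interpret kaehler_at "g x" "riem g x" "J x" by (rule kaehler_at_chart[OF x])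
  show ?thesis
    unfolding ham_D_pointwise[of _ _ _ X] dir_deriv_eq_pd[of X]
    by (simp add: ham_D_def Let_def prod_eq_iff ne_scaleR_fun[OF x f s(1)] nv_scaleR_fun[OF x f s(2)]
        pd_mult[OF f s(3) x] wedge_scaleR1 riem_form_eq form_op_scaleR mv_simps ip_simps)
      (simp add: matrix_scalar_ac scalar_matrix_assoc[symmetric] acomm_def mv_simps algebra_simps)
qed

lemma smooth_ham_D:
  assumes X: "smooth_on U X"
  shows "smooth_on U (\<lambda>y. fst (ham_D m g J X s y))" "smooth_on U (\<lambda>y. fst (snd (ham_D m g J X s y)))"
    "smooth_on U (\<lambda>y. snd (snd (ham_D m g J X s y)))"
proof -
  show "smooth_on U (\<lambda>y. fst (ham_D m g J X s y))"
    using s X smooth_nabla_endo[OF X s(1)] by (simp add: ham_D_def Let_def smooth_on_scaleR)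
  have "smooth_on U (\<lambda>y. (2 * snd (snd (s y))) *\<^sub>R J y - J y ** acomm (\<rho> y) (fst (s y)) - 2 *\<^sub>R riem_form g y (fst (s y)))"
    using s by (intro smooth_on_diff smooth_on_scaleR smooth_on_mult smooth_on_matrix_mult smooth_acomm smooth_riem_form) auto
  then show "smooth_on U (\<lambda>y. fst (snd (ham_D m g J X s y)))"
    using smooth_nabla_vec[OF X s(2)] X
    by (simp only: ham_D_def Let_def fst_conv snd_conv)
      (intro smooth_on_add smooth_on_scaleR smooth_on_matrix_vector_mult; simp)
  show "smooth_on U (\<lambda>y. snd (snd (ham_D m g J X s y)))"
    using s X smooth_on_dir_deriv[OF open_U X s(3)] by (simp add: ham_D_def Let_def)
qed

lemma ham_D_form_component:
  assumes x: "x \<in> U" and \<phi>: "\<And>y. y \<in> U \<Longrightarrow> skew_endo (g y) (fst (s y))"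
    "\<And>y. y \<in> U \<Longrightarrow> fst (s y) ** J y = J y ** fst (s y)"
  shows "skew_endo (g x) (fst (ham_D m g J X s x))"
    and "fst (ham_D m g J X s x) ** J x = J x ** fst (ham_D m g J X s x)"
proof -
  interpret kaehler_at "g x" "riem g x" "J x" by (rule kaehler_at_chart[OF x])
  let ?h = "hw x (fst (snd (s x))) (X x)"
  have e: "fst (ham_D m g J X s x) = ne (X x) (\<lambda>y. fst (s y)) x + (1/2) *\<^sub>R ?h"
    by (simp add: ham_D_def Let_def nabla_endo_pointwise[of X])
  show "skew_endo (g x) (fst (ham_D m g J X s x))"
    unfolding e by (intro skew_add skew_scaleR skew_wedge skew_ne[OF x] s \<phi>)
  have "((1/2) *\<^sub>R ?h) ** J x = J x ** ((1/2) *\<^sub>R ?h)"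
    using hwedge_J by (simp only: scalar_matrix_assoc[symmetric] matrix_scalar_ac)
  moreover have "ne (X x) (\<lambda>y. fst (s y)) x ** J x = J x ** ne (X x) (\<lambda>y. fst (s y)) x"
    by (rule ne_commutes_J[OF x s(1) \<phi>(2)])
  ultimately show "fst (ham_D m g J X s x) ** J x = J x ** fst (ham_D m g J X s x)"
    unfolding e by (simp only: matrix_add_rdistrib' matrix_add_ldistrib)
qed

end

end

locale kaehler_change = chart_change U g U' g' V \<psi> B L + c: kaehler_chart U g J + d: kaehler_chart U' g' J'
  for U :: "(real^'n::finite) set" and g and U' :: "(real^'n) set" and g' V \<psi> B L J J' +
  assumes J_change: "x \<in> V \<Longrightarrow> J' (\<psi> x) ** B x = B x ** J x"
begin

lemma apply_change: "T' ** B x = B x ** T \<Longrightarrow> T' *v (B x *v v) = B x *v (T *v v)"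
  by (simp add: matrix_vector_mul_assoc)

lemma ricci_form_change: "x \<in> V \<Longrightarrow> ricci_form g' J' (\<psi> x) ** B x = B x ** ricci_form g J x"
  using riem_form_change[OF _ J_change]
  by (simp add: c.ricci_form_eq[OF V_U] d.ricci_form_eq[OF \<psi>_image])

text \<open>Every ingredient of the operator is natural, and the values of the vector field along which it
  differentiates enter at the point only.\<close>
lemma ham_D_change:
  assumes x: "x \<in> V"
    and s: "smooth_on U (\<lambda>y. fst (s y))" "smooth_on U (\<lambda>y. fst (snd (s y)))" "smooth_on U (\<lambda>y. snd (snd (s y)))"
    and s': "smooth_on U' (\<lambda>y. fst (s' y))" "smooth_on U' (\<lambda>y. fst (snd (s' y)))" "smooth_on U' (\<lambda>y. snd (snd (s' y)))"
    and ch: "\<And>y. y \<in> V \<Longrightarrow> fst (s' (\<psi> y)) ** B y = B y ** fst (s y)"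
      "\<And>y. y \<in> V \<Longrightarrow> fst (snd (s' (\<psi> y))) = B y *v fst (snd (s y))"
      "\<And>y. y \<in> V \<Longrightarrow> snd (snd (s' (\<psi> y))) = snd (snd (s y))"
    and X: "X' (\<psi> x) = B x *v X x"
  shows "fst (ham_D m g' J' X' s' (\<psi> x)) ** B x = B x ** fst (ham_D m g J X s x)"
    and "fst (snd (ham_D m g' J' X' s' (\<psi> x))) = B x *v fst (snd (ham_D m g J X s x))"
    and "snd (snd (ham_D m g' J' X' s' (\<psi> x))) = snd (snd (ham_D m g J X s x))"
proof -
  note pw = ham_D_pointwise[of _ _ _ X'] ham_D_pointwise[of _ _ _ X] X
  note J' = apply_change[OF J_change[OF x]]
  have n: "nabla_endo g' (\<lambda>_. B x *v X x) (\<lambda>y. fst (s' y)) (\<psi> x) ** B x = B x ** nabla_endo g (\<lambda>_. X x) (\<lambda>y. fst (s y)) x"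
    by (rule endo_change[OF x s'(1) s(1) ch(1)])
  show "fst (ham_D m g' J' X' s' (\<psi> x)) ** B x = B x ** fst (ham_D m g J X s x)"
    unfolding pw
    using apply_change[OF n] apply_change[OF wedge_change[OF x]]
    by (simp add: ham_D_def Let_def ch(2)[OF x] J' matrix_eq mv_simps)
  have "((2 * snd (snd (s' (\<psi> x)))) *\<^sub>R J' (\<psi> x) - J' (\<psi> x) ** acomm (ricci_form g' J' (\<psi> x)) (fst (s' (\<psi> x)))
        - 2 *\<^sub>R riem_form g' (\<psi> x) (fst (s' (\<psi> x)))) *v (B x *v v)
     = B x *v (((2 * snd (snd (s x))) *\<^sub>R J x - J x ** acomm (ricci_form g J x) (fst (s x))
        - 2 *\<^sub>R riem_form g x (fst (s x))) *v v)" for v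
    by (simp add: mv_simps ch(3)[OF x] J' apply_change[OF ricci_form_change[OF x]] apply_change[OF ch(1)[OF x]]
        apply_change[OF riem_form_change[OF x ch(1)[OF x]]])
  then show "fst (snd (ham_D m g' J' X' s' (\<psi> x))) = B x *v fst (snd (ham_D m g J X s x))"
    unfolding pw using vector_change[OF x s'(2) s(2) ch(2)]
    by (simp add: ham_D_def Let_def mv_simps(2-5) matrix_vector_mult_scaleR)
  show "snd (snd (ham_D m g' J' X' s' (\<psi> x))) = snd (snd (ham_D m g J X s x))"
    unfolding pw using scalar_change[OF x s'(3) s(3) ch(3)]
    by (simp add: ham_D_def Let_def ch(2)[OF x] apply_change[OF ricci_form_change[OF x]] ip_change[OF x])
qed

end

section \<open>Transition maps of an atlas\<close>

lemma overlap_subset: "overlap c d \<subseteq> chart_img c"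
  by (auto simp: overlap_def chart_img_def chart_dom_def)

context
  fixes M :: "'a topology" and A :: "('a, 'n::finite) chart set"
  assumes man: "smooth_manifold M A"
begin

lemma chart_inj: "c \<in> A \<Longrightarrow> inj_on (snd c) (chart_dom c)"
proof -
  assume "c \<in> A"
  then have "openin M (chart_dom c)"
    "homeomorphic_map (subtopology M (chart_dom c)) (top_of_set (chart_img c)) (snd c)"
    using man by (auto simp: smooth_manifold_def)
  then show ?thesis
    by (metis homeomorphic_imp_injective_map openin_subset topspace_subtopology_subset)
qed

lemma open_chart_img: "c \<in> A \<Longrightarrow> open (chart_img c)"
  using man by (auto simp: smooth_manifold_def)

lemma open_overlap: "c \<in> A \<Longrightarrow> d \<in> A \<Longrightarrow> open (overlap c d)"
proof -
  assume c: "c \<in> A" and d: "d \<in> A"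
  have o: "openin M (chart_dom c)" "openin M (chart_dom d)"
    and h: "homeomorphic_map (subtopology M (chart_dom c)) (top_of_set (chart_img c)) (snd c)"
    using man c d by (auto simp: smooth_manifold_def)
  have "openin (subtopology M (chart_dom c)) (chart_dom c \<inter> chart_dom d)"
    using o by (auto simp: openin_subtopology)
  then have "openin (top_of_set (chart_img c)) (overlap c d)"
    using homeomorphic_imp_open_map[OF h] unfolding open_map_def overlap_def by blast
  then show ?thesis using openin_open_trans open_chart_img[OF c] by blast
qed

lemma transition_apply: "c \<in> A \<Longrightarrow> p \<in> chart_dom c \<Longrightarrow> transition c d (snd c p) = snd d p"
  by (simp add: transition_def inv_into_f_f[OF chart_inj])

lemma transition_overlap:
  assumes "c \<in> A" "x \<in> overlap c d"
  shows "transition c d x \<in> overlap d c"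
proof -
  obtain p where "p \<in> chart_dom c" "p \<in> chart_dom d" "x = snd c p"
    using assms(2) unfolding overlap_def by blast
  then show ?thesis using transition_apply[OF assms(1)] by (simp add: overlap_def)
qed

lemma transition_inverse:
  assumes "c \<in> A" "d \<in> A" "x \<in> overlap c d"
  shows "transition d c (transition c d x) = x"
proof -
  obtain p where "p \<in> chart_dom c" "p \<in> chart_dom d" "x = snd c p"
    using assms(3) unfolding overlap_def by blast
  then show ?thesis using transition_apply assms(1,2) by simp
qed

lemma smooth_transition: "c \<in> A \<Longrightarrow> d \<in> A \<Longrightarrow> smooth_on (overlap c d) (transition c d)"
  using man by (auto simp: smooth_manifold_def)

lemma pd_transition:
  assumes "c \<in> A" "d \<in> A" "x \<in> overlap c d"
  shows "pd v (transition c d) x = jac c d x *v v"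
proof -
  have l: "linear (\<lambda>v. pd v (transition c d) x)"
    by (rule linear_pd[OF smooth_transition]) (use assms in auto)
  then have "linear (frechet_derivative (transition c d) (at x))" by (simp add: dir_deriv_def)
  then show ?thesis by (simp add: jac_def linear_matrix_vector dir_deriv_def)
qed

lemma jac_inverse:
  assumes "c \<in> A" "d \<in> A" "x \<in> overlap c d"
  shows "jac d c (transition c d x) ** jac c d x = mat 1"
proof -
  note o = transition_overlap[OF assms(1,3)]
  have "jac d c (transition c d x) *v (jac c d x *v v) = v" for v
  proof -
    have "jac d c (transition c d x) *v (jac c d x *v v) = pd v (\<lambda>y. transition d c (transition c d y)) x"
      using pd_compose[OF smooth_transition[OF assms(1,2)] assms(3) smooth_transition[OF assms(2,1)] o, of v]
      by (simp add: pd_transition assms o)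
    also have "\<dots> = pd v (\<lambda>y. y) x"
    proof (rule pd_cong[OF open_overlap[OF assms(1,2)] _ assms(3)])
      show "smooth_on (overlap c d) (\<lambda>y. transition d c (transition c d y))"
        by (rule smooth_on_compose[OF open_overlap[OF assms(1,2)] smooth_transition[OF assms(1,2)] _
              smooth_transition[OF assms(2,1)]])
          (rule image_subsetI, rule transition_overlap[OF assms(1)])
    qed (use transition_inverse assms in auto)
    also have "\<dots> = v" by (rule pd_eqI) (rule has_derivative_ident)
    finally show ?thesis .
  qed
  then show ?thesis by (simp add: matrix_eq matrix_vector_mul_assoc[symmetric])
qed

end

section \<open>Kaehler manifolds\<close>

context
  fixes M :: "'a topology" and A :: "('a, 'n::finite) chart set"
    and g J :: "('a, 'n) chart \<Rightarrow> real ^ 'n \<Rightarrow> real ^ 'n ^ 'n"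
  assumes K: "kaehler_manifold M A g J"
begin

lemma chart_kaehler: "c \<in> A \<Longrightarrow> kaehler_chart (chart_img c) (g c) (J c)"
proof -
  assume c: "c \<in> A"
  have man: "smooth_manifold M A" using K by (simp add: kaehler_manifold_def)
  show ?thesis
  proof (intro kaehler_chart.intro riemannian_chart.intro kaehler_chart_axioms.intro)
    show "open (chart_img c)" by (rule open_chart_img[OF man c])
    show "smooth_on (chart_img c) (g c)" "smooth_on (chart_img c) (J c)"
      using K c by (auto simp: kaehler_manifold_def riemannian_metric_def bilinear_field_def endo_field_def smooth_field_def)
    show "metric_at (g c x)" if "x \<in> chart_img c" for x
      using K c that by unfold_locales (auto simp: kaehler_manifold_def riemannian_metric_def)
    show "J c x ** J c x = - mat 1" if "x \<in> chart_img c" for x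
      using K c that by (auto simp: kaehler_manifold_def)
    show "ip (g c x) (J c x *v X) (J c x *v Y) = ip (g c x) X Y" if "x \<in> chart_img c" for x X Y
      using K c that by (auto simp: kaehler_manifold_def)
    show "nabla_endo (g c) (\<lambda>_. X) (J c) x = 0" if "x \<in> chart_img c" for x X
      using K c that by (auto simp: kaehler_manifold_def)
  qed
qed

lemma charts_kaehler_change:
  assumes c: "c \<in> A" and d: "d \<in> A"
  shows "kaehler_change (chart_img c) (g c) (chart_img d) (g d) (overlap c d) (transition c d)
    (jac c d) (\<lambda>x. jac d c (transition c d x)) (J c) (J d)"
proof -
  interpret c: kaehler_chart "chart_img c" "g c" "J c" by (rule chart_kaehler[OF c])
  interpret d: kaehler_chart "chart_img d" "g d" "J d" by (rule chart_kaehler[OF d])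
  have man: "smooth_manifold M A" using K by (simp add: kaehler_manifold_def)
  show ?thesis
  proof unfold_locales
    show "open (overlap c d)" by (rule open_overlap[OF man c d])
    show "overlap c d \<subseteq> chart_img c" by (rule overlap_subset)
    show "smooth_on (overlap c d) (transition c d)" by (rule smooth_transition[OF man c d])
    fix x assume x: "x \<in> overlap c d"
    note x' = transition_overlap[OF man c x]
    show "transition c d x \<in> chart_img d" using x' overlap_subset by blast
    show "pd v (transition c d) x = jac c d x *v v" for v by (rule pd_transition[OF man c d x])
    show "jac d c (transition c d x) ** jac c d x = mat 1" by (rule jac_inverse[OF man c d x])
    then show "jac c d x ** jac d c (transition c d x) = mat 1" using matrix_left_right_inverse by blast
    show "transpose (jac c d x) ** g d (transition c d x) ** jac c d x = g c x"
      using K c d x by (auto simp: kaehler_manifold_def riemannian_metric_def bilinear_field_def)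
    show "J d (transition c d x) ** jac c d x = jac c d x ** J c x"
      using K c d x by (auto simp: kaehler_manifold_def endo_field_def)
  qed
qed

text \<open>A skew endomorphism is \<open>J\<close>-invariant as a form exactly if it commutes with \<open>J\<close>; apart from
  this the conditions are those of the definition, sorted by charts and overlaps.\<close>
lemma triple_sections_iff: "s \<in> triple_sections A g J \<longleftrightarrow>
  (\<forall>c\<in>A. smooth_on (chart_img c) (\<lambda>x. fst (s c x)) \<and> smooth_on (chart_img c) (\<lambda>x. fst (snd (s c x)))
    \<and> smooth_on (chart_img c) (\<lambda>x. snd (snd (s c x)))
    \<and> (\<forall>x\<in>chart_img c. skew_endo (g c x) (fst (s c x)) \<and> fst (s c x) ** J c x = J c x ** fst (s c x)))
  \<and> (\<forall>c\<in>A. \<forall>d\<in>A. \<forall>x\<in>overlap c d.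
      fst (s d (transition c d x)) ** jac c d x = jac c d x ** fst (s c x)
      \<and> fst (snd (s d (transition c d x))) = jac c d x *v fst (snd (s c x))
      \<and> snd (snd (s d (transition c d x))) = snd (snd (s c x)))"
proof -
  have "J_invariant (g c x) (J c x) \<psi> \<longleftrightarrow> \<psi> ** J c x = J c x ** \<psi>" if "c \<in> A" "x \<in> chart_img c" for c x \<psi>
    by (rule kaehler_at.J_invariant_commutes[OF kaehler_chart.kaehler_at_chart[OF chart_kaehler[OF that(1)] that(2)]])
  then show ?thesis
    unfolding triple_sections_def J_inv_two_form_def endo_field_def vector_field_def scalar_field_def smooth_field_def
    by auto
qed

lemma section_smooth:
  assumes "s \<in> triple_sections A g J" "c \<in> A"
  shows "smooth_on (chart_img c) (\<lambda>x. fst (s c x))" "smooth_on (chart_img c) (\<lambda>x. fst (snd (s c x)))"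
    "smooth_on (chart_img c) (\<lambda>x. snd (snd (s c x)))"
  using assms unfolding triple_sections_iff by auto

lemma ham_D_sections:
  assumes X: "vector_field A X" and s: "s \<in> triple_sections A g J"
  shows "(\<lambda>c. ham_D m (g c) (J c) (X c) (s c)) \<in> triple_sections A g J"
  unfolding triple_sections_iff
proof (intro conjI ballI)
  fix c assume c: "c \<in> A"
  interpret kaehler_chart "chart_img c" "g c" "J c" by (rule chart_kaehler[OF c])
  note sm = section_smooth[OF s c]
  have Xs: "smooth_on (chart_img c) (X c)" using X c by (simp add: vector_field_def smooth_field_def)
  show "smooth_on (chart_img c) (\<lambda>x. fst (ham_D m (g c) (J c) (X c) (s c) x))"
    "smooth_on (chart_img c) (\<lambda>x. fst (snd (ham_D m (g c) (J c) (X c) (s c) x)))"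
    "smooth_on (chart_img c) (\<lambda>x. snd (snd (ham_D m (g c) (J c) (X c) (s c) x)))"
    by (rule smooth_ham_D[OF sm Xs])+
  fix x assume x: "x \<in> chart_img c"
  have p: "\<And>y. y \<in> chart_img c \<Longrightarrow> skew_endo (g c y) (fst (s c y))"
    "\<And>y. y \<in> chart_img c \<Longrightarrow> fst (s c y) ** J c y = J c y ** fst (s c y)"
    using s c unfolding triple_sections_iff by auto
  show "skew_endo (g c x) (fst (ham_D m (g c) (J c) (X c) (s c) x))"
    "fst (ham_D m (g c) (J c) (X c) (s c) x) ** J c x = J c x ** fst (ham_D m (g c) (J c) (X c) (s c) x)"
    by (rule ham_D_form_component[OF sm x p]; assumption)+
next
  fix c d x assume c: "c \<in> A" and d: "d \<in> A" and x: "x \<in> overlap c d"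
  interpret kaehler_change "chart_img c" "g c" "chart_img d" "g d" "overlap c d" "transition c d"
    "jac c d" "\<lambda>x. jac d c (transition c d x)" "J c" "J d"
    by (rule charts_kaehler_change[OF c d])
  note sm = section_smooth[OF s c] section_smooth[OF s d]
  have ch: "fst (s d (transition c d y)) ** jac c d y = jac c d y ** fst (s c y)"
    "fst (snd (s d (transition c d y))) = jac c d y *v fst (snd (s c y))"
    "snd (snd (s d (transition c d y))) = snd (snd (s c y))" if "y \<in> overlap c d" for y
    using s c d that unfolding triple_sections_iff by auto
  have X': "X d (transition c d x) = jac c d x *v X c x" using X c d x by (simp add: vector_field_def)
  note D = ham_D_change[where s = "s c" and s' = "s d" and X = "X c" and X' = "X d" and m = m, OF x sm ch X']
  show "fst (ham_D m (g d) (J d) (X d) (s d) (transition c d x)) ** jac c d x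
      = jac c d x ** fst (ham_D m (g c) (J c) (X c) (s c) x)"
    "fst (snd (ham_D m (g d) (J d) (X d) (s d) (transition c d x)))
      = jac c d x *v fst (snd (ham_D m (g c) (J c) (X c) (s c) x))"
    "snd (snd (ham_D m (g d) (J d) (X d) (s d) (transition c d x)))
      = snd (snd (ham_D m (g c) (J c) (X c) (s c) x))"
    by (rule D; assumption)+
qed

lemma ham_D_covariant_derivative:
  "covariant_derivative A (triple_sections A g J) (\<lambda>c. ham_D m (g c) (J c))"
  unfolding covariant_derivative_def
proof (intro conjI allI impI ballI)
  show "(\<lambda>c. ham_D m (g c) (J c) (X c) (s c)) \<in> triple_sections A g J"
    if "vector_field A X" "s \<in> triple_sections A g J" for X s
    by (rule ham_D_sections[OF that])
next
  fix X Y s t f c x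
  assume s: "s \<in> triple_sections A g J" and t: "t \<in> triple_sections A g J"
    and f: "scalar_field A f" and c: "c \<in> A" and x: "x \<in> chart_img c"
  interpret kaehler_chart "chart_img c" "g c" "J c" by (rule chart_kaehler[OF c])
  note sm = section_smooth[OF s c] and tm = section_smooth[OF t c]
  have fm: "smooth_on (chart_img c) (f c)" using f c by (simp add: scalar_field_def smooth_field_def)
  show "ham_D m (g c) (J c) (\<lambda>y. X c y + Y c y) (s c) x
      = ham_D m (g c) (J c) (X c) (s c) x + ham_D m (g c) (J c) (Y c) (s c) x"
    by (rule ham_D_add_direction[OF sm x])
  show "ham_D m (g c) (J c) (\<lambda>y. f c y *\<^sub>R X c y) (s c) x = f c x *\<^sub>R ham_D m (g c) (J c) (X c) (s c) x"
    by (rule ham_D_scaleR_direction[OF sm x])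
  show "ham_D m (g c) (J c) (X c) (\<lambda>y. s c y + t c y) x
      = ham_D m (g c) (J c) (X c) (s c) x + ham_D m (g c) (J c) (X c) (t c) x"
    by (rule ham_D_add[OF sm x tm])
  show "ham_D m (g c) (J c) (X c) (\<lambda>y. f c y *\<^sub>R s c y) x
      = dir_deriv (X c) (f c) x *\<^sub>R s c x + f c x *\<^sub>R ham_D m (g c) (J c) (X c) (s c) x"
    by (rule ham_D_scaleR[OF sm x fm])
qed

lemma triple_chart_of_section:
  assumes "(\<lambda>c x. (\<phi> c x, k c x, u c x)) \<in> triple_sections A g J" and "c \<in> A" and "CARD('n) = 2 * m"
  shows "triple_chart (chart_img c) (g c) (J c) (\<phi> c) (k c) (u c) m"
proof -
  interpret kaehler_chart "chart_img c" "g c" "J c" by (rule chart_kaehler[OF assms(2)])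
  show ?thesis
    using assms unfolding triple_sections_iff by unfold_locales auto
qed

lemma hamiltonian_in_chart:
  assumes "hamiltonian A g J \<phi>"
  obtains \<sigma> where "\<And>c. c \<in> A \<Longrightarrow> hamiltonian_chart (chart_img c) (g c) (J c) (\<phi> c) (\<sigma> c)"
    and "endo_field A \<phi>"
proof -
  obtain \<sigma> where \<sigma>: "scalar_field A \<sigma>" and inv: "J_inv_two_form A g J \<phi>"
    and h: "\<forall>c\<in>A. \<forall>x\<in>chart_img c. \<forall>X.
           nabla_endo (g c) (\<lambda>_. X) (\<phi> c) x =
           (1/2) *\<^sub>R (wedge (g c x) (sharp (g c x) (diff (\<sigma> c) x)) (J c x *v X)
                    - wedge (g c x) (sharp (g c x) (dc (J c) (\<sigma> c) x)) X)"
    and k: "CARD('n) = 2 \<longrightarrow> killing A g (\<lambda>c x. J c x *v grad (g c) (\<sigma> c) x)"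
    using assms unfolding hamiltonian_def by blast
  have "hamiltonian_chart (chart_img c) (g c) (J c) (\<phi> c) (\<sigma> c)" if c: "c \<in> A" for c
  proof -
    interpret kaehler_chart "chart_img c" "g c" "J c" by (rule chart_kaehler[OF c])
    show ?thesis
    proof
      show "smooth_on (chart_img c) (\<phi> c)"
        using inv c by (simp add: J_inv_two_form_def endo_field_def smooth_field_def)
      show "smooth_on (chart_img c) (\<sigma> c)" using \<sigma> c by (simp add: scalar_field_def smooth_field_def)
      fix x assume x: "x \<in> chart_img c"
      show "skew_endo (g c x) (\<phi> c x)" using inv c x by (simp add: J_inv_two_form_def)
      show "\<phi> c x ** J c x = J c x ** \<phi> c x"
        using inv c x unfolding J_inv_two_form_def
        by (simp add: kaehler_at.J_invariant_commutes[OF kaehler_at_chart[OF x], symmetric])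
      show "nabla_endo (g c) (\<lambda>_. X) (\<phi> c) x =
           (1/2) *\<^sub>R (wedge (g c x) (sharp (g c x) (diff (\<sigma> c) x)) (J c x *v X)
                    - wedge (g c x) (sharp (g c x) (dc (J c) (\<sigma> c) x)) X)" for X
        using h c x by blast
      show "CARD('n) = 2 \<Longrightarrow> lie_metric (g c) (\<lambda>y. J c y *v grad (g c) (\<sigma> c) y) X Y x = 0" for X Y
        using k c x by (simp add: killing_def)
    qed
  qed
  then show thesis using that inv by (auto simp: J_inv_two_form_def)
qed

text \<open>The trace of \<open>\<phi>\<close> is a scalar field, so \<open>K\<close> and \<open>u\<close> are fields by naturality of gradient
  and Laplacian; everything else is a statement in one chart.\<close>
lemma hamiltonian_section:
  assumes \<phi>: "hamiltonian A g J \<phi>" and dim: "CARD('n) = 2 * m"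
  defines "\<sigma> \<equiv> \<lambda>c x. form_tr (J c x) (\<phi> c x)"
  defines "k \<equiv> \<lambda>c x. J c x *v grad (g c) (\<sigma> c) x"
  defines "u \<equiv> \<lambda>c x. laplacian (g c) (\<sigma> c) x / 2"
  shows "(\<lambda>c x. (\<phi> c x, k c x, u c x)) \<in> triple_sections A g J"
    and "c \<in> A \<Longrightarrow> x \<in> chart_img c \<Longrightarrow>
      nabla_endo (g c) (\<lambda>_. X) (\<phi> c) x + (1/2) *\<^sub>R (wedge (g c x) (k c x) X
                              + wedge (g c x) (J c x *v k c x) (J c x *v X)) = 0"
    and "c \<in> A \<Longrightarrow> x \<in> chart_img c \<Longrightarrow>
      cov_diff (g c) (k c) x + (1 / (2 * real m)) *\<^sub>R ((2 * u c x) *\<^sub>R J c x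
                     - J c x ** acomm (ricci_form (g c) (J c) x) (\<phi> c x)
                     - 2 *\<^sub>R riem_form (g c) x (\<phi> c x)) = 0"
    and "c \<in> A \<Longrightarrow> x \<in> chart_img c \<Longrightarrow>
      diff (u c) x \<bullet> X + ip (g c x) (ricci_form (g c) (J c) x *v k c x) X = 0"
    and "c \<in> A \<Longrightarrow> x \<in> chart_img c \<Longrightarrow>
      ham_D m (g c) (J c) (\<lambda>_. X) (\<lambda>y. (\<phi> c y, k c y, u c y)) x = 0"
proof -
  obtain \<sigma>' where hc: "\<And>c. c \<in> A \<Longrightarrow> hamiltonian_chart (chart_img c) (g c) (J c) (\<phi> c) (\<sigma>' c)"
    and e: "endo_field A \<phi>"
    using hamiltonian_in_chart[OF \<phi>] by blast
  have eq: "hamiltonian_chart.\<tau> (J c) (\<phi> c) = \<sigma> c \<and> hamiltonian_chart.K (g c) (J c) (\<phi> c) = k c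
    \<and> hamiltonian_chart.u (g c) (J c) (\<phi> c) = u c" if "c \<in> A" for c
  proof -
    interpret h: hamiltonian_chart "chart_img c" "g c" "J c" "\<phi> c" "\<sigma>' c" by (rule hc[OF that])
    have t: "h.\<tau> = \<sigma> c" by (simp add: fun_eq_iff h.\<tau>_def \<sigma>_def)
    show ?thesis by (simp add: t fun_eq_iff h.K_def h.u_def k_def u_def)
  qed
  have chart: "smooth_on (chart_img c) (\<phi> c) \<and> smooth_on (chart_img c) (\<sigma> c) \<and> smooth_on (chart_img c) (k c)
    \<and> smooth_on (chart_img c) (u c)
    \<and> (\<forall>x\<in>chart_img c. skew_endo (g c x) (\<phi> c x) \<and> \<phi> c x ** J c x = J c x ** \<phi> c x)" if "c \<in> A" for c
  proof -
    interpret h: hamiltonian_chart "chart_img c" "g c" "J c" "\<phi> c" "\<sigma>' c" by (rule hc[OF that])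
    show ?thesis using h.smooth_\<tau> h.smooth_K h.smooth_u h.skew_\<phi> h.\<phi>_J by (simp add: eq[OF that])
  qed
  have "k d (transition c d x) = jac c d x *v k c x \<and> u d (transition c d x) = u c x"
    if c: "c \<in> A" and d: "d \<in> A" and x: "x \<in> overlap c d" for c d x
  proof -
    interpret kaehler_change "chart_img c" "g c" "chart_img d" "g d" "overlap c d" "transition c d"
      "jac c d" "\<lambda>x. jac d c (transition c d x)" "J c" "J d"
      by (rule charts_kaehler_change[OF c d])
    have s: "\<sigma> d (transition c d y) = \<sigma> c y" if y: "y \<in> overlap c d" for y
    proof -
      have p: "\<phi> d (transition c d y) ** jac c d y = jac c d y ** \<phi> c y"
        using e c d y by (simp add: endo_field_def)
      have "(\<phi> d (transition c d y) ** J d (transition c d y)) ** jac c d y = jac c d y ** (\<phi> c y ** J c y)"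
        by (simp add: matrix_mul_assoc[symmetric] J_change[OF y]) (simp add: matrix_mul_assoc p)
      then show ?thesis using trace_change[OF y] by (simp add: \<sigma>_def form_tr_def form_inner_def)
    qed
    have \<sigma>s: "smooth_on (chart_img c) (\<sigma> c)" "smooth_on (chart_img d) (\<sigma> d)" using chart c d by auto
    show ?thesis
      using grad_change[OF x \<sigma>s(2,1) s] laplacian_change[OF x \<sigma>s(2,1) s] apply_change[OF J_change[OF x]]
      by (simp add: k_def u_def)
  qed
  then show sec: "(\<lambda>c x. (\<phi> c x, k c x, u c x)) \<in> triple_sections A g J"
    unfolding triple_sections_iff using chart e by (auto simp: endo_field_def)
  assume c: "c \<in> A" and x: "x \<in> chart_img c"
  interpret h: hamiltonian_chart "chart_img c" "g c" "J c" "\<phi> c" "\<sigma>' c" by (rule hc[OF c])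
  note q = eq[OF c]
  show e1: "nabla_endo (g c) (\<lambda>_. X) (\<phi> c) x + (1/2) *\<^sub>R (wedge (g c x) (k c x) X
                              + wedge (g c x) (J c x *v k c x) (J c x *v X)) = 0"
    using h.form_equation[OF x, of X] by (simp only: q)
  show e2: "cov_diff (g c) (k c) x + (1 / (2 * real m)) *\<^sub>R ((2 * u c x) *\<^sub>R J c x
                     - J c x ** acomm (ricci_form (g c) (J c) x) (\<phi> c x)
                     - 2 *\<^sub>R riem_form (g c) x (\<phi> c x)) = 0"
    using h.vector_equation[OF x dim] by (simp only: q)
  have e3: "pd X (u c) x + ip (g c x) (ricci_form (g c) (J c) x *v k c x) X = 0"
    using h.scalar_equation[OF x dim, of X] by (simp only: q)
  have us: "smooth_on (chart_img c) (u c)" and ks: "smooth_on (chart_img c) (k c)" using chart[OF c] by auto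
  then show "diff (u c) x \<bullet> X + ip (g c x) (ricci_form (g c) (J c) x *v k c x) X = 0"
    using e3 x by (simp add: diff_inner[of "chart_img c"])
  have "nabla_vec (g c) (\<lambda>_. X) (k c) x + (1 / (2 * real m)) *\<^sub>R (((2 * u c x) *\<^sub>R J c x
                     - J c x ** acomm (ricci_form (g c) (J c) x) (\<phi> c x)
                     - 2 *\<^sub>R riem_form (g c) x (\<phi> c x)) *v X) = 0"
    using arg_cong[OF e2, of "\<lambda>T. T *v X"]
    by (simp only: matrix_vector_mult_add_rdistrib h.cov_diff_apply[OF x ks] scaleR_matrix_vector_assoc[symmetric]
        matrix_vector_mult_0)
  then show "ham_D m (g c) (J c) (\<lambda>_. X) (\<lambda>y. (\<phi> c y, k c y, u c y)) x = 0"
    using e1 e3 by (simp add: ham_D_def Let_def zero_prod_def)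
qed

end

theorem proposition4:
  fixes M :: "'a topology" and A :: "('a, 'n::finite) chart set"
    and g J :: "('a, 'n) chart \<Rightarrow> real ^ 'n \<Rightarrow> real ^ 'n ^ 'n" and m :: nat
  assumes "kaehler_manifold M A g J" and "CARD('n) = 2 * m"
  shows
    "covariant_derivative A (triple_sections A g J) (\<lambda>c. ham_D m (g c) (J c)) \<and>
     (\<forall>\<phi>. hamiltonian A g J \<phi> \<longrightarrow>
       (let \<sigma> = (\<lambda>c x. form_tr (J c x) (\<phi> c x));
            K = (\<lambda>c x. J c x *v grad (g c) (\<sigma> c) x);
            u = (\<lambda>c x. laplacian (g c) (\<sigma> c) x / 2)
        in (\<forall>c\<in>A. \<forall>x\<in>chart_img c.
              (\<forall>X. nabla_endo (g c) (\<lambda>_. X) (\<phi> c) x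
                   + (1/2) *\<^sub>R (wedge (g c x) (K c x) X
                              + wedge (g c x) (J c x *v K c x) (J c x *v X)) = 0) \<and>
              cov_diff (g c) (K c) x
                + (1 / (2 * real m)) *\<^sub>R
                    ((2 * u c x) *\<^sub>R J c x
                     - J c x ** acomm (ricci_form (g c) (J c) x) (\<phi> c x)
                     - 2 *\<^sub>R riem_form (g c) x (\<phi> c x)) = 0 \<and>
              (\<forall>X. diff (u c) x \<bullet> X
                   + ip (g c x) (ricci_form (g c) (J c) x *v K c x) X = 0)) \<and>
           (\<lambda>c x. (\<phi> c x, K c x, u c x)) \<in> triple_sections A g J \<and>
           (\<forall>c\<in>A. \<forall>x\<in>chart_img c. \<forall>X.
              ham_D m (g c) (J c) (\<lambda>_. X) (\<lambda>y. (\<phi> c y, K c y, u c y)) x = 0))) \<and>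
     (\<forall>\<phi> K u. (\<lambda>c x. (\<phi> c x, K c x, u c x)) \<in> triple_sections A g J \<longrightarrow>
       ((\<forall>c\<in>A. \<forall>x\<in>chart_img c. \<forall>X Y.
           curv_op (ham_D m (g c) (J c)) (\<lambda>_. X) (\<lambda>_. Y) (\<lambda>y. (\<phi> c y, K c y, u c y)) x = 0)
        \<longleftrightarrow>
        (\<forall>c\<in>A. \<forall>x\<in>chart_img c. let G = g c x; j = J c x; \<rho> = ricci_form (g c) (J c) in
           (\<forall>\<psi>. skew_endo G \<psi> \<longrightarrow>
              real m *\<^sub>R comm (riem_form (g c) x \<psi>) (\<phi> c x)
              - comm (riem_form (g c) x (\<phi> c x) + (1/2) *\<^sub>R (j ** acomm (\<rho> x) (\<phi> c x)))
                     (J_inv_part G j \<psi>) = 0) \<and>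
           (\<forall>X. (real m + 1) *\<^sub>R riem (g c) x (K c x) X
                - ip G (\<rho> x *v K c x) X *\<^sub>R j
                + (1/2) *\<^sub>R (j ** acomm (\<rho> x) (J_inv_part G j (wedge G (K c x) X)))
                - (1/2) *\<^sub>R (j ** acomm (nabla_endo (g c) (\<lambda>_. X) \<rho> x) (\<phi> c x))
                - nabla_riem_form (g c) (\<lambda>_. X) (\<phi> c) x = 0) \<and>
           - (real m *\<^sub>R nabla_endo (g c) (\<lambda>_. K c x) \<rho> x)
             + comm (riem_form (g c) x (\<phi> c x)) (\<rho> x) = 0)))"
proof (intro conjI allI impI, goal_cases)
  case 1
  show ?case by (rule ham_D_covariant_derivative[OF assms(1)])
next
  case (2 \<phi>)
  show ?case
    unfolding Let_def by (intro conjI ballI allI hamiltonian_section[OF assms(1) 2 assms(2)])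
next
  case (3 \<phi> K u)
  show ?case
  proof (intro ball_cong refl, goal_cases)
    case (1 c x)
    interpret t: triple_chart "chart_img c" "g c" "J c" "\<phi> c" "K c" "u c" m
      by (rule triple_chart_of_section[OF assms(1) 3 1(1) assms(2)])
    show ?case
      unfolding Let_def t.integrability_conditions[OF 1(2)] t.I1_def t.I2_def t.I3_def t.W_def ..
  qed
qed

end
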